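(* There exist convex embeddings of the 2-sphere in $\mathbb{R}^3$ minimising the distortion among all convex embeddings of the 2-sphere in $\mathbb{R}^3$; that is, there is a compact convex set $K\subset\mathbb{R}^3$ with nonempty interior such that $\delta(\partial K)\le\delta(\partial K')$ for every compact convex set $K'\subset\mathbb{R}^3$ with nonempty interior. Moreover, these minimisers have uniformly bounded eccentricity: there is a constant $E<\infty$ such that for every such minimiser $K$ the eccentricity of $\partial K$ is at most $E$.
   Context: For a path-connected subset $A\subset\mathbb{R}^3$, the intrinsic distance $d_A(p,q)$ of $p,q\in A$ is the infimum of the lengths of paths in $A$ connecting $p$ and $q$. The distortion of $A$ is $\delta(A)=\sup_{p\neq q\in A}\frac{d_A(p,q)}{|p-q|}$, where $|\cdot|$ is the Euclidean norm. A convex (embedded) 2-sphere in $\mathbb{R}^3$ is the boundary $\partial K$ of a compact convex set $K\subset\mathbb{R}^3$ with nonempty interior. The eccentricity of such a sphere is the ratio of its circumradius (the smallest radius of a closed ball containing $K$) and its inradius (the largest radius of a closed ball contained in $K$). *)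

theory Defs
  imports "HOL-Analysis.Analysis"
begin

text \<open>
  Length as the supremum over subdivisions \<open>0 = t 0 \<le> \<dots> \<le> t n = 1\<close>; it is infinite
  exactly for non-rectifiable paths.
\<close>

definition path_length :: "(real \<Rightarrow> 'a::metric_space) \<Rightarrow> ennreal" where
  "path_length g =
     (SUP (n, t) \<in> {(n :: nat, t :: nat \<Rightarrow> real).
                     t 0 = 0 \<and> t n = 1 \<and> (\<forall>i<n. t i \<le> t (Suc i))}.
        \<Sum>i<n. ennreal (dist (g (t i)) (g (t (Suc i)))))"

definition intrinsic_dist :: "'a::metric_space set \<Rightarrow> 'a \<Rightarrow> 'a \<Rightarrow> ennreal" where
  "intrinsic_dist A p q =
     (INF g \<in> {g. path g \<and> path_image g \<subseteq> A \<and> pathstart g = p \<and> pathfinish g = q}.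
        path_length g)"

definition distortion :: "'a::metric_space set \<Rightarrow> ennreal" where
  "distortion A =
     (SUP (p, q) \<in> {(p, q). p \<in> A \<and> q \<in> A \<and> p \<noteq> q}.
        intrinsic_dist A p q / ennreal (dist p q))"

definition convex_body :: "'a::euclidean_space set \<Rightarrow> bool" where
  "convex_body K \<longleftrightarrow> compact K \<and> convex K \<and> interior K \<noteq> {}"

text \<open>
  A convex sphere \<open>frontier K\<close> determines the convex body \<open>K\<close>, so its radii and eccentricity
  are expressed as functions of \<open>K\<close>. For convex bodies the infimum and the supremum below are
  attained and the inradius is positive. The condition \<open>0 \<le> r\<close> excludes negative radii,
  for which \<open>cball c r\<close> is empty.
\<close>

definition circumradius :: "'a::metric_space set \<Rightarrow> real" where
  "circumradius K = Inf {r. 0 \<le> r \<and> (\<exists>c. K \<subseteq> cball c r)}"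

definition inradius :: "'a::metric_space set \<Rightarrow> real" where
  "inradius K = Sup {r. 0 \<le> r \<and> (\<exists>c. cball c r \<subseteq> K)}"

definition eccentricity :: "'a::metric_space set \<Rightarrow> real" where
  "eccentricity K = circumradius K / inradius K"

definition minimises_distortion :: "'a::euclidean_space set \<Rightarrow> bool" where
  "minimises_distortion K \<longleftrightarrow>
     convex_body K \<and>
     (\<forall>K' :: 'a set. convex_body K' \<longrightarrow> distortion (frontier K) \<le> distortion (frontier K'))"

end

theory Submission
  imports Defs "HOL-Complex_Analysis.Great_Picard"
begin

text \<open>
  The number \<open>\<pi> / 2\<close> separates two kinds of convex bodies.

  Bodies of huge eccentricity have distortion at least about \<open>\<pi> / 2\<close>. By Gromov's argument
  every closed plane curve, in particular every convex one, has two points whose distance along the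
  curve is at least \<open>\<pi> / 2\<close> times the chord (\<open>convex_curve_far_pair\<close>). If a body is long
  compared with the section through the middle of a diameter, it contains a long cylinder over almost
  all of that section, and the surface near the section is as distorted as the boundary curve of the
  section (\<open>elongated_body_distortion\<close>). If a body is not long in this sense, it contains a large
  plane disc; if it contains no large ball, the surface points straight above and below the centre of the
  disc are close, but every path on the surface between them has to go round the disc
  (\<open>flat_body_distortion\<close>).

  On the other hand a slender circular cone with a flat base has distortion strictly below
  \<open>\<pi> / 2\<close> (\<open>convex_body_distortion_less_half_pi\<close>): on the lateral surface
  a path between opposite points can bend towards the apex, where the cone is thinner, and the angle
  at the rim is almost a right angle. Hence bodies of nearly minimal distortion have bounded
  eccentricity (\<open>inradius_diameter_bound\<close>, \<open>eccentricity_le\<close>).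

  With the eccentricity under control, a minimising sequence can be normalised by similarities, which
  do not change the distortion, and it has a convergent subsequence (\<open>convex_sets_subsequence\<close>).
  The distortion is lower semicontinuous along it (\<open>intrinsic_dist_le_outer_distortion\<close>): the
  nearest-point projection to the limit body is 1-Lipschitz, so paths on the surface of a slightly larger body
  can be pushed to the surface of the limit without becoming longer, and each pair of points of the
  limit surface is the projection of a nearby pair. The same projection, applied to plane sections,
  compares surfaces with curves in the elongated case. So the limit minimises the distortion.
\<close>

section \<open>Lengths and intrinsic distances\<close>

text \<open>
  The subdivisions in the definition of the length run from \<open>0\<close> to \<open>1\<close>; a partial one is
  completed by these two points.
\<close>

lemma path_length_ge_sum:
  fixes g :: "real \<Rightarrow> 'a::metric_space" and t :: "nat \<Rightarrow> real"
  assumes mono: "\<And>i. i < n \<Longrightarrow> t i \<le> t (Suc i)" and "0 \<le> t 0" "t n \<le> 1"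
  shows "ennreal (\<Sum>i<n. dist (g (t i)) (g (t (Suc i)))) \<le> path_length g"
proof -
  define T where "T = (\<lambda>i. case i of 0 \<Rightarrow> 0 | Suc j \<Rightarrow> if j \<le> n then t j else 1)"
  have T0: "T 0 = 0" and Tn: "T (Suc (Suc n)) = 1"
    and TS: "\<And>i. i \<le> n \<Longrightarrow> T (Suc i) = t i"
    by (auto simp: T_def)
  have Tm: "T i \<le> T (Suc i)" if "i < Suc (Suc n)" for i
  proof (cases i)
    case (Suc j)
    then consider "j < n" | "j = n" using \<open>i < Suc (Suc n)\<close> by linarith
    then show ?thesis by cases (use Suc mono assms in \<open>auto simp: T_def\<close>)
  qed (use assms in \<open>auto simp: T_def\<close>)
  have "ennreal (\<Sum>i<n. dist (g (t i)) (g (t (Suc i)))) =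
        (\<Sum>i<n. ennreal (dist (g (T (Suc i))) (g (T (Suc (Suc i))))))"
    by (simp add: TS sum_ennreal)
  also have "\<dots> \<le> (\<Sum>i<Suc n. ennreal (dist (g (T i)) (g (T (Suc i)))))"
    by (subst sum.lessThan_Suc_shift) simp
  also have "\<dots> \<le> (\<Sum>i<Suc (Suc n). ennreal (dist (g (T i)) (g (T (Suc i)))))"
    by simp
  also have "\<dots> \<le> path_length g"
    unfolding path_length_def
    by (rule SUP_upper2[of "(Suc (Suc n), T)"])
       (use T0 Tn Tm in \<open>auto simp del: sum.lessThan_Suc\<close>)
  finally show ?thesis .
qed

lemma path_length_ge_dist:
  fixes g :: "real \<Rightarrow> 'a::metric_space"
  assumes "s \<in> {0..1}" "t \<in> {0..1}"
  shows "ennreal (dist (g s) (g t)) \<le> path_length g"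
  using path_length_ge_sum[of 1 "\<lambda>i. if i = 0 then min s t else max s t" g] assms
  by (cases "s \<le> t") (auto simp: dist_commute)

lemma subdivision_in_unit_interval:
  fixes t :: "nat \<Rightarrow> real"
  assumes "t 0 = 0" "t n = 1" "\<forall>i<n. t i \<le> t (Suc i)" "i \<le> n"
  shows "t i \<in> {0..1}"
proof -
  have "t j \<le> t k" if "j \<le> k" "k \<le> n" for j k
    using that
  proof (induction k rule: dec_induct)
    case (step m)
    then show ?case using assms(3)[rule_format, of m] by linarith
  qed simp
  from this[of 0 i] this[of i n] assms show ?thesis by auto
qed

lemma path_length_le_scaled:
  fixes g :: "real \<Rightarrow> 'a::metric_space" and h :: "real \<Rightarrow> 'b::metric_space"
  assumes "\<And>s t. s \<in> {0..1} \<Longrightarrow> t \<in> {0..1} \<Longrightarrow> dist (h s) (h t) \<le> a * dist (g s) (g t)"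
  shows "path_length h \<le> ennreal a * path_length g"
  unfolding path_length_def[of h]
proof (rule SUP_least, clarsimp simp del: sum_ennreal)
  fix n :: nat and t :: "nat \<Rightarrow> real"
  assume t: "t 0 = 0" "t n = 1" "\<forall>i<n. t i \<le> t (Suc i)"
  have "(\<Sum>i<n. ennreal (dist (h (t i)) (h (t (Suc i)))))
     \<le> (\<Sum>i<n. ennreal (a * dist (g (t i)) (g (t (Suc i)))))"
    using subdivision_in_unit_interval[OF t]
    by (intro sum_mono ennreal_leI assms) (auto simp: Suc_leI less_imp_le)
  also have "\<dots> = ennreal a * (\<Sum>i<n. ennreal (dist (g (t i)) (g (t (Suc i)))))"
    by (simp add: sum_distrib_left ennreal_mult'' del: sum_ennreal)
  also have "\<dots> \<le> ennreal a * path_length g"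
    unfolding path_length_def
    by (intro mult_left_mono SUP_upper2[of "(n, t)"]) (use t in auto)
  finally show "(\<Sum>i<n. ennreal (dist (h (t i)) (h (t (Suc i))))) \<le> ennreal a * path_length g" .
qed

lemma path_length_le_lipschitz:
  fixes g :: "real \<Rightarrow> 'a::metric_space"
  assumes "L-lipschitz_on {0..1} g"
  shows "path_length g \<le> ennreal L"
  unfolding path_length_def
proof (rule SUP_least, clarsimp simp del: sum_ennreal)
  fix n :: nat and t :: "nat \<Rightarrow> real"
  assume t: "t 0 = 0" "t n = 1" "\<forall>i<n. t i \<le> t (Suc i)"
  have "(\<Sum>i<n. ennreal (dist (g (t i)) (g (t (Suc i)))))
     \<le> (\<Sum>i<n. ennreal (L * (t (Suc i) - t i)))"
  proof (intro sum_mono ennreal_leI)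
    fix i assume "i \<in> {..<n}"
    then show "dist (g (t i)) (g (t (Suc i))) \<le> L * (t (Suc i) - t i)"
      using lipschitz_onD[OF assms, of "t i" "t (Suc i)"] t
        subdivision_in_unit_interval[OF t, of i] subdivision_in_unit_interval[OF t, of "Suc i"]
      by (auto simp: dist_real_def)
  qed
  also have "\<dots> = ennreal (\<Sum>i<n. L * (t (Suc i) - t i))"
    using t lipschitz_on_nonneg[OF assms] by (intro sum_ennreal) auto
  also have "(\<Sum>i<n. L * (t (Suc i) - t i)) = L"
    using sum_lessThan_telescope[of t n] t by (simp flip: sum_distrib_left)
  finally show "(\<Sum>i<n. ennreal (dist (g (t i)) (g (t (Suc i))))) \<le> ennreal L" .
qed

lemma intrinsic_dist_le_lipschitz:
  fixes g :: "real \<Rightarrow> 'a::metric_space"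
  assumes "L-lipschitz_on {0..1} g" "g ` {0..1} \<subseteq> S" "g 0 = p" "g 1 = q"
  shows "intrinsic_dist S p q \<le> ennreal L"
proof -
  have "path g" using assms(1) by (auto simp: path_def intro: lipschitz_on_continuous_on)
  then show ?thesis
    unfolding intrinsic_dist_def
    by (intro INF_lower2[of g] path_length_le_lipschitz assms(1))
       (use assms in \<open>auto simp: path_image_def pathstart_def pathfinish_def\<close>)
qed

lemma intrinsic_dist_self:
  fixes p :: "'a::metric_space"
  assumes "p \<in> S" shows "intrinsic_dist S p p = 0"
  using intrinsic_dist_le_lipschitz[of 0 "\<lambda>_. p" S p p] assms
  by (auto simp: lipschitz_on_def)

text \<open>
  Composing a path with a Lipschitz map scales every sum over a subdivision by at most the
  Lipschitz constant, hence also the infimum over all paths.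
\<close>

lemma intrinsic_dist_contraction:
  fixes f :: "'a::metric_space \<Rightarrow> 'b::metric_space"
  assumes "0 < a" and lip: "a-lipschitz_on S f" and "f ` S \<subseteq> T"
  shows "intrinsic_dist T (f p) (f q) \<le> ennreal a * intrinsic_dist S p q"
proof -
  have "intrinsic_dist T (f p) (f q) / ennreal a \<le> intrinsic_dist S p q"
    unfolding intrinsic_dist_def[of S]
  proof (rule INF_greatest)
    fix g assume "g \<in> {g. path g \<and> path_image g \<subseteq> S \<and> pathstart g = p \<and> pathfinish g = q}"
    then have g: "path g" "path_image g \<subseteq> S" "pathstart g = p" "pathfinish g = q" by auto
    have "path (f \<circ> g)"
      using g lipschitz_on_continuous_on[OF lip]
      by (meson continuous_on_subset path_continuous_image)
    moreover have "path_image (f \<circ> g) \<subseteq> T"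
      using g assms by (auto simp: path_image_compose)
    ultimately have "intrinsic_dist T (f p) (f q) \<le> path_length (f \<circ> g)"
      unfolding intrinsic_dist_def using g
      by (intro INF_lower) (auto simp: pathstart_compose pathfinish_compose)
    also have "\<dots> \<le> ennreal a * path_length g"
      using g(2)
      by (intro path_length_le_scaled) (auto simp: path_image_def intro!: lipschitz_onD[OF lip])
    finally show "intrinsic_dist T (f p) (f q) / ennreal a \<le> path_length g"
      using \<open>0 < a\<close>
      by (metis divide_right_mono_ennreal ennreal_mult_divide_eq ennreal_eq_0_iff ennreal_neq_top
          mult.commute not_le)
  qed
  then show ?thesis
    using \<open>0 < a\<close>
    by (metis ennreal_divide_times ennreal_eq_0_iff ennreal_neq_top ennreal_times_divide
        mult_divide_eq_ennreal mult_left_mono mult.commute not_le zero_le)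
qed

lemma intrinsic_dist_le_distortion:
  fixes p q :: "'a::metric_space"
  assumes "p \<in> S" "q \<in> S"
  shows "intrinsic_dist S p q \<le> distortion S * ennreal (dist p q)"
proof (cases "p = q")
  case True
  then show ?thesis using intrinsic_dist_self assms by simp
next
  case False
  have "intrinsic_dist S p q / ennreal (dist p q) \<le> distortion S"
    unfolding distortion_def
    by (rule SUP_upper2[of "(p, q)"]) (use assms False in auto)
  then have "intrinsic_dist S p q / ennreal (dist p q) * ennreal (dist p q)
      \<le> distortion S * ennreal (dist p q)"
    by (rule mult_right_mono) simp
  then show ?thesis
    using False by (simp add: ennreal_divide_times ennreal_times_divide mult_divide_eq_ennreal)
qed

lemma distortion_le:
  fixes S :: "'a::metric_space set"
  assumes "\<And>p q. p \<in> S \<Longrightarrow> q \<in> S \<Longrightarrow> p \<noteq> q \<Longrightarrow> intrinsic_dist S p q \<le> D * ennreal (dist p q)"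
  shows "distortion S \<le> D"
  unfolding distortion_def
proof (rule SUP_least, clarsimp)
  fix p q assume pq: "p \<in> S" "q \<in> S" "p \<noteq> q"
  have "intrinsic_dist S p q / ennreal (dist p q) \<le> D * ennreal (dist p q) / ennreal (dist p q)"
    by (intro divide_right_mono_ennreal assms pq)
  also have "\<dots> = D"
    using pq by (simp add: mult_divide_eq_ennreal)
  finally show "intrinsic_dist S p q / ennreal (dist p q) \<le> D" .
qed

lemma distortion_similarity_le:
  fixes f :: "'a::metric_space \<Rightarrow> 'b::metric_space"
  assumes "0 < a" and f: "\<And>x y. dist (f x) (f y) = a * dist x y"
  shows "distortion (f ` S) \<le> distortion S"
proof (rule distortion_le, clarsimp)
  fix p q assume pq: "p \<in> S" "q \<in> S"
  have "intrinsic_dist (f ` S) (f p) (f q) \<le> ennreal a * intrinsic_dist S p q"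
    using assms by (intro intrinsic_dist_contraction) (auto simp: lipschitz_on_def)
  also have "\<dots> \<le> ennreal a * (distortion S * ennreal (dist p q))"
    by (intro mult_left_mono intrinsic_dist_le_distortion pq) simp
  also have "\<dots> = distortion S * ennreal (dist (f p) (f q))"
    using \<open>0 < a\<close> by (simp add: f ennreal_mult mult_ac)
  finally show "intrinsic_dist (f ` S) (f p) (f q) \<le> distortion S * ennreal (dist (f p) (f q))" .
qed

section \<open>Projection to a smaller convex set\<close>

lemma closest_point_in_frontier:
  fixes A :: "'a::euclidean_space set"
  assumes "closed A" "A \<noteq> {}" "x \<notin> interior A"
  shows "closest_point A x \<in> frontier A"
proof (cases "interior A = {}")
  case True
  then show ?thesis using assms closest_point_in_set[of A x] by (simp add: frontier_def)
next
  case False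
  then have "affine hull A = UNIV" "rel_interior A = interior A"
    by (auto simp: affine_hull_nonempty_interior rel_interior_nonempty_interior)
  then show ?thesis
    using closest_point_in_rel_frontier[of A x] assms False
    by (simp add: rel_frontier_nonempty_interior)
qed

text \<open>
  This is the source of all lower bounds for intrinsic distances that compare two convex sets: the
  nearest-point projection is 1-Lipschitz and maps everything outside the interior to the frontier.
\<close>

lemma intrinsic_dist_closest_point_le:
  fixes A :: "'a::euclidean_space set"
  assumes "closed A" "convex A" "A \<noteq> {}"
  shows "intrinsic_dist (frontier A) (closest_point A x) (closest_point A y)
       \<le> intrinsic_dist (- interior A) x y"
  using intrinsic_dist_contraction[of 1 "- interior A" "closest_point A" "frontier A" x y]
    closest_point_in_frontier[OF assms(1,3)] closest_point_lipschitz[OF assms(2,1,3)]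
  by (auto simp: lipschitz_on_def)

lemma intrinsic_dist_mono:
  assumes "S \<subseteq> T" shows "intrinsic_dist T p q \<le> intrinsic_dist S p q"
  unfolding intrinsic_dist_def using assms by (intro INF_superset_mono) auto

text \<open>
  Starting at \<open>u\<close>, walk along an outer normal of \<open>A\<close> until \<open>B\<close> is left; the end
  point projects back to \<open>u\<close>. The walk is short because the half-space supporting \<open>A\<close> at
  \<open>u\<close>, scaled by \<open>\<kappa>\<close>, contains \<open>B\<close>.
\<close>

lemma ray_from_frontier_normal:
  fixes A B :: "'a::euclidean_space set"
  assumes A: "closed A" "convex A" "interior A \<noteq> {}" and B: "compact B" "A \<subseteq> B"
    and \<kappa>: "B \<subseteq> (\<lambda>x. \<kappa> *\<^sub>R x) ` A" "1 \<le> \<kappa>" and u: "u \<in> frontier A"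
  obtains x where "x \<in> frontier B" "closest_point A x = u" "dist x u \<le> (\<kappa> - 1) * norm u"
proof -
  have uA: "u \<in> A" using u A frontier_subset_closed by blast
  have "u \<notin> rel_interior A"
    using u A by (simp add: frontier_def rel_interior_nonempty_interior)
  then obtain \<nu>' where \<nu>': "\<nu>' \<noteq> 0" "\<And>y. y \<in> A \<Longrightarrow> \<nu>' \<bullet> u \<le> \<nu>' \<bullet> y"
    using supporting_hyperplane_rel_boundary[OF A(2) uA] by metis
  define \<nu> where "\<nu> = - sgn \<nu>'"
  have \<nu>1: "norm \<nu> = 1" using \<nu>' by (simp add: \<nu>_def norm_sgn)
  have \<nu>: "\<nu> \<bullet> y \<le> \<nu> \<bullet> u" if "y \<in> A" for y
    using \<nu>'(2)[OF that] by (simp add: \<nu>_def sgn_div_norm mult_left_mono)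
  obtain s where s: "0 \<le> s" "u + s *\<^sub>R \<nu> \<in> frontier B"
  proof (cases "u \<in> interior B")
    case True
    have "\<nu> \<noteq> 0" using \<nu>1 by auto
    from ray_to_frontier[OF compact_imp_bounded[OF B(1)] True this]
    obtain d where "0 < d" "u + d *\<^sub>R \<nu> \<in> frontier B" by metis
    then show ?thesis using that[of d] by simp
  next
    case False
    then have "u \<in> frontier B" using uA B closure_subset by (auto simp: frontier_def)
    then show ?thesis using that[of 0] by simp
  qed
  define x where "x = u + s *\<^sub>R \<nu>"
  have "x \<in> B" using s B frontier_subset_closed compact_imp_closed unfolding x_def by blast
  then obtain y where y: "y \<in> A" "x = \<kappa> *\<^sub>R y" using \<kappa> by auto
  have "\<nu> \<bullet> u + s = \<nu> \<bullet> x"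
    using \<nu>1 by (simp add: x_def inner_add_right power2_norm_eq_inner[symmetric])
  also have "\<dots> \<le> \<kappa> * (\<nu> \<bullet> u)" using y \<nu>[OF y(1)] \<kappa>(2) by simp
  finally have "s \<le> (\<kappa> - 1) * (\<nu> \<bullet> u)" by (simp add: algebra_simps)
  also have "\<dots> \<le> (\<kappa> - 1) * norm u"
    using \<kappa>(2) norm_cauchy_schwarz[of \<nu> u] \<nu>1 by (intro mult_left_mono) auto
  finally have "dist x u \<le> (\<kappa> - 1) * norm u"
    using s \<nu>1 by (simp add: x_def dist_norm)
  moreover have "u = closest_point A x"
  proof (rule closest_point_unique[OF A(2,1) uA], rule ballI)
    fix z assume "z \<in> A"
    then have "s \<le> \<nu> \<bullet> (x - z)"
      using \<nu>[of z] \<nu>1 by (simp add: x_def inner_add_right inner_diff_right power2_norm_eq_inner[symmetric])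
    also have "\<dots> \<le> dist x z"
      using norm_cauchy_schwarz[of \<nu> "x - z"] \<nu>1 by (simp add: dist_norm)
    finally show "dist x u \<le> dist x z" using s \<nu>1 by (simp add: x_def dist_norm)
  qed
  ultimately show thesis using that[of x] s(2) unfolding x_def by metis
qed

lemma frontier_similarity:
  fixes K :: "'a::euclidean_space set"
  assumes "a \<noteq> 0"
  shows "frontier ((\<lambda>x. c + a *\<^sub>R x) ` K) = (\<lambda>x. c + a *\<^sub>R x) ` frontier K"
proof -
  have lin: "linear (\<lambda>x::'a. a *\<^sub>R x)" and inj: "inj (\<lambda>x::'a. a *\<^sub>R x)"
    using assms by (auto simp: inj_on_def)
  have "frontier ((\<lambda>x. a *\<^sub>R x) ` K) = (\<lambda>x. a *\<^sub>R x) ` frontier K"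
    unfolding frontier_def closure_injective_linear_image[OF lin inj, symmetric]
      interior_injective_linear_image[OF lin inj] image_set_diff[OF inj] ..
  then show ?thesis
    using frontier_translation[of c "(\<lambda>x. a *\<^sub>R x) ` K"] by (simp add: image_image)
qed

lemma convex_body_similarity:
  fixes K :: "'a::euclidean_space set"
  assumes "convex_body K" "a \<noteq> 0"
  shows "convex_body ((\<lambda>x. c + a *\<^sub>R x) ` K)"
proof -
  have lin: "linear (\<lambda>x::'a. a *\<^sub>R x)" and inj: "inj (\<lambda>x::'a. a *\<^sub>R x)"
    using assms by (auto simp: inj_on_def)
  have "interior ((\<lambda>x. a *\<^sub>R x) ` K) \<noteq> {}"
    using assms interior_injective_linear_image[OF lin inj, of K] by (simp add: convex_body_def)
  then have "interior ((+) c ` (\<lambda>x. a *\<^sub>R x) ` K) \<noteq> {}"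
    by (simp add: interior_translation)
  then show ?thesis
    using assms convex_affinity[of K c a] compact_affinity[of K c a]
    by (simp add: convex_body_def image_image)
qed

lemma distortion_frontier_similarity:
  fixes K :: "'a::euclidean_space set"
  assumes "0 < a"
  shows "distortion (frontier ((\<lambda>x. c + a *\<^sub>R x) ` K)) = distortion (frontier K)"
proof (rule antisym)
  have le: "distortion (frontier ((\<lambda>x. c + a *\<^sub>R x) ` K)) \<le> distortion (frontier K)"
    if "0 < a" for c a and K :: "'a set"
  proof -
    have "dist (c + a *\<^sub>R x) (c + a *\<^sub>R y) = a * dist x y" for x y :: 'a
      using that by (simp add: dist_norm flip: scaleR_diff_right)
    then show ?thesis
      using distortion_similarity_le[OF that, of "\<lambda>x. c + a *\<^sub>R x" "frontier K"] that
      by (simp add: frontier_similarity)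
  qed
  show "distortion (frontier ((\<lambda>x. c + a *\<^sub>R x) ` K)) \<le> distortion (frontier K)"
    by (rule le[OF assms])
  have "K = (\<lambda>x. - (c /\<^sub>R a) + inverse a *\<^sub>R x) ` (\<lambda>x. c + a *\<^sub>R x) ` K"
    using assms by (simp add: image_image algebra_simps)
  with le[of "inverse a" "- (c /\<^sub>R a)" "(\<lambda>x. c + a *\<^sub>R x) ` K"] assms
  show "distortion (frontier K) \<le> distortion (frontier ((\<lambda>x. c + a *\<^sub>R x) ` K))"
    by simp
qed

section \<open>Convex curves in the plane\<close>

lemma norm_Ln_le_dist_one:
  assumes "norm (z - 1) \<le> \<eta>" "\<eta> < 1"
  shows "norm (Ln z) \<le> norm (z - 1) / (1 - \<eta>)"
proof -
  have Re: "1 - \<eta> \<le> Re w" if "w \<in> cball 1 \<eta>" for w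
  proof -
    have "norm (1 - w) \<le> \<eta>" using that by (simp add: dist_norm)
    then have "Re (1 - w) \<le> \<eta>" using complex_Re_le_cmod order_trans by blast
    then show ?thesis by simp
  qed
  have "norm (Ln z - Ln 1) \<le> (1 / (1 - \<eta>)) * norm (z - 1)"
  proof (rule field_differentiable_bound[of "cball 1 \<eta>" Ln "\<lambda>w. 1 / w"])
    fix w assume w: "w \<in> cball (1::complex) \<eta>"
    have "w \<notin> \<real>\<^sub>\<le>\<^sub>0"
      using Re[OF w] assms by (auto simp: complex_nonpos_Reals_iff)
    then show "(Ln has_field_derivative 1 / w) (at w within cball 1 \<eta>)"
      using has_field_derivative_Ln[of w] by (simp add: has_field_derivative_at_within divide_inverse)
    have "1 - \<eta> \<le> norm w" using Re[OF w] complex_Re_le_cmod order_trans by blast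
    then show "norm (1 / w) \<le> 1 / (1 - \<eta>)"
      using assms by (simp add: norm_divide frac_le)
  next
    show "z \<in> cball 1 \<eta>" using assms by (simp add: dist_norm norm_minus_commute)
    show "1 \<in> cball (1::complex) \<eta>" using assms by (auto intro: order_trans[OF norm_ge_zero])
  qed simp
  then show ?thesis by simp
qed

text \<open>
  A curve from \<open>v\<close> to \<open>- v\<close> that avoids the open disc of radius \<open>\<rho>\<close> around the
  origin has length at least \<open>\<pi> \<rho>\<close>; for a polygon
  the factor \<open>1 - \<eta>\<close> pays for its steps being chords. The
  logarithms of the quotients of consecutive vertices add up to a logarithm of \<open>-1\<close>, and all
  these logarithms have modulus at least \<open>\<pi>\<close>.
\<close>

lemma polygonal_half_turn_length:
  fixes \<beta> :: "nat \<Rightarrow> complex"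
  assumes far: "\<And>i. i \<le> n \<Longrightarrow> \<rho> \<le> norm (\<beta> i)" and "0 < \<rho>"
    and step: "\<And>i. i < n \<Longrightarrow> norm (\<beta> (Suc i) - \<beta> i) \<le> \<eta> * \<rho>" and "\<eta> < 1"
    and turn: "\<beta> n = - \<beta> 0"
  shows "pi * \<rho> * (1 - \<eta>) \<le> (\<Sum>i<n. norm (\<beta> (Suc i) - \<beta> i))"
proof -
  define z where "z i = \<beta> (Suc i) / \<beta> i" for i
  have nz: "\<beta> i \<noteq> 0" if "i \<le> n" for i using far[OF that] \<open>0 < \<rho>\<close> by auto
  have z1: "norm (z i - 1) \<le> norm (\<beta> (Suc i) - \<beta> i) / \<rho>" if "i < n" for i
  proof -
    have "z i - 1 = (\<beta> (Suc i) - \<beta> i) / \<beta> i"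
      using nz[of i] that by (simp add: z_def diff_divide_distrib)
    then show ?thesis
      using far[of i] that \<open>0 < \<rho>\<close> by (simp add: norm_divide frac_le)
  qed
  have Ln: "norm (Ln (z i)) \<le> norm (\<beta> (Suc i) - \<beta> i) / \<rho> / (1 - \<eta>)" if "i < n" for i
  proof -
    have "norm (z i - 1) \<le> \<eta>"
      using z1[OF that] step[OF that] \<open>0 < \<rho>\<close> by (smt (verit) pos_divide_le_eq)
    then have "norm (Ln (z i)) \<le> norm (z i - 1) / (1 - \<eta>)"
      using norm_Ln_le_dist_one \<open>\<eta> < 1\<close> by blast
    also have "\<dots> \<le> norm (\<beta> (Suc i) - \<beta> i) / \<rho> / (1 - \<eta>)"
      using z1[OF that] \<open>\<eta> < 1\<close> by (intro divide_right_mono) auto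
    finally show ?thesis .
  qed
  define W where "W = (\<Sum>i<n. Ln (z i))"
  have "exp W = (\<Prod>i<n. z i)"
    using nz unfolding W_def exp_sum[OF finite_lessThan]
    by (intro prod.cong refl exp_Ln) (auto simp: z_def)
  also have "\<dots> = \<beta> n / \<beta> 0"
    using nz unfolding z_def by (intro prod_lessThan_telescope) auto
  also have "\<dots> = -1" using turn nz[of 0] by simp
  finally have "exp W = exp (\<i> * pi)" by (simp add: exp_pi_i')
  then obtain k :: int where k: "W = \<i> * pi + (of_int (2 * k) * pi) * \<i>"
    unfolding exp_eq by blast
  have "1 \<le> \<bar>1 + 2 * k\<bar>" by presburger
  then have "1 \<le> \<bar>real_of_int (1 + 2 * k)\<bar>" by linarith
  then have "pi \<le> \<bar>real_of_int (1 + 2 * k)\<bar> * pi" by simp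
  also have "\<dots> = \<bar>real_of_int (1 + 2 * k) * pi\<bar>" by (simp only: abs_mult abs_of_pos[OF pi_gt_zero])
  also have "\<dots> = \<bar>Im W\<bar>" unfolding k by (simp add: algebra_simps)
  also have "\<dots> \<le> norm W" by (rule abs_Im_le_cmod)
  also have "\<dots> \<le> (\<Sum>i<n. norm (\<beta> (Suc i) - \<beta> i) / \<rho> / (1 - \<eta>))"
    unfolding W_def using Ln by (intro sum_norm_le) auto
  also have "\<dots> = (\<Sum>i<n. norm (\<beta> (Suc i) - \<beta> i)) / \<rho> / (1 - \<eta>)"
    by (simp add: sum_divide_distrib)
  finally show ?thesis
    using \<open>0 < \<rho>\<close> \<open>\<eta> < 1\<close> by (simp add: field_simps)
qed

text \<open>
  The law of cosines in half-angle form. It makes the comparison of the cone with its planar development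
  a comparison of sines.
\<close>

lemma dist_polar_sq:
  "(dist (of_real r * cis \<alpha>) (of_real s * cis \<beta>))\<^sup>2 = (r - s)\<^sup>2 + 4 * r * s * (sin ((\<alpha> - \<beta>) / 2))\<^sup>2"
proof -
  have "(dist (of_real r * cis \<alpha>) (of_real s * cis \<beta>))\<^sup>2
      = (r * cos \<alpha> - s * cos \<beta>)\<^sup>2 + (r * sin \<alpha> - s * sin \<beta>)\<^sup>2"
    by (simp add: dist_norm cmod_power2)
  also have "\<dots> = r\<^sup>2 * ((sin \<alpha>)\<^sup>2 + (cos \<alpha>)\<^sup>2) + s\<^sup>2 * ((sin \<beta>)\<^sup>2 + (cos \<beta>)\<^sup>2)
      - 2 * r * s * cos (\<alpha> - \<beta>)"
    by (simp only: cos_diff) algebra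
  also have "cos (\<alpha> - \<beta>) = 1 - 2 * (sin ((\<alpha> - \<beta>) / 2))\<^sup>2"
    using cos_double_sin[of "(\<alpha> - \<beta>) / 2"] by (simp only: mult_2 field_sum_of_halves)
  finally show ?thesis by (simp add: power2_eq_square algebra_simps)
qed

lemma dist_cis_le: "dist (cis \<alpha>) (cis \<beta>) \<le> \<bar>\<alpha> - \<beta>\<bar>"
proof -
  have "(dist (cis \<alpha>) (cis \<beta>))\<^sup>2 = (2 * sin ((\<alpha> - \<beta>) / 2))\<^sup>2"
    using dist_polar_sq[of 1 \<alpha> 1 \<beta>] by (simp add: power_mult_distrib)
  then have "dist (cis \<alpha>) (cis \<beta>) = \<bar>2 * sin ((\<alpha> - \<beta>) / 2)\<bar>"
    by (metis abs_of_nonneg power2_eq_iff_nonneg abs_ge_zero power2_abs zero_le_dist)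
  also have "\<dots> \<le> \<bar>\<alpha> - \<beta>\<bar>"
    using abs_sin_x_le_abs_x[of "(\<alpha> - \<beta>) / 2"] by (simp add: abs_mult)
  finally show ?thesis .
qed

text \<open>
  Radial projection from \<open>c\<close> maps the frontier bijectively to the unit circle, because open
  segments from an interior point to the frontier are interior. By compactness the inverse is
  continuous; \<open>V\<close> is this inverse as a function of the polar angle.
\<close>

lemma radial_parametrisation:
  fixes A :: "complex set"
  assumes A: "compact A" "convex A" and c: "c \<in> interior A"
  obtains V :: "real \<Rightarrow> complex"
  where "uniformly_continuous_on UNIV V" "\<And>\<theta>. V \<theta> \<in> frontier A"
    "\<And>\<theta>. sgn (V \<theta> - c) = cis \<theta>"
    "\<And>x \<theta>. x \<in> frontier A \<Longrightarrow> sgn (x - c) = cis \<theta> \<Longrightarrow> V \<theta> = x"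
proof -
  let ?F = "frontier A" and ?f = "\<lambda>x. sgn (x - c)"
  have cF: "c \<notin> ?F" using c by (simp add: frontier_def)
  have F: "?F \<subseteq> A" using A by (simp add: compact_imp_closed frontier_subset_closed)
  have "compact ?F" using A by (simp add: compact_frontier)
  have "inj_on ?f ?F"
  proof (rule inj_onI, rule ccontr)
    fix x y assume xy: "x \<in> ?F" "y \<in> ?F" "?f x = ?f y" "x \<noteq> y"
    have False if xy: "x \<in> ?F" "y \<in> ?F" "?f x = ?f y" and less: "norm (x - c) < norm (y - c)" for x y
    proof -
      have nz: "x \<noteq> c" "y \<noteq> c" using xy cF by auto
      define t where "t = norm (x - c) / norm (y - c)"
      have t: "0 < t" "t < 1" using less nz by (auto simp: t_def)
      have "x - c = of_real (norm (x - c)) * ?f x" using nz by (simp add: sgn_eq)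
      also have "\<dots> = of_real t * (y - c)" using nz xy(3) by (simp add: sgn_eq t_def)
      finally have "x = (1 - t) *\<^sub>R c + t *\<^sub>R y" by (simp add: scaleR_conv_of_real algebra_simps)
      then have "x \<in> open_segment c y" using t nz unfolding in_segment by metis
      moreover have "open_segment c y \<subseteq> interior A"
        using in_interior_closure_convex_segment[OF A(2) c] xy F closure_subset by blast
      ultimately show False using xy(1) by (auto simp: frontier_def)
    qed
    from this[of x y] this[of y x] xy
    have eq: "norm (x - c) = norm (y - c)" by fastforce
    have "z = of_real (norm z) * sgn z" for z :: complex by (simp add: sgn_eq)
    from this[of "x - c"] this[of "y - c"] have "x - c = y - c" using xy(3) eq by metis
    then show False using \<open>x \<noteq> y\<close> by simp
  qed
  moreover have "?f ` ?F = sphere 0 1"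
  proof
    show "?f ` ?F \<subseteq> sphere 0 1" using cF by (auto simp: norm_sgn)
    show "sphere 0 1 \<subseteq> ?f ` ?F"
    proof
      fix l :: complex assume l: "l \<in> sphere 0 1"
      then have "l \<noteq> 0" by auto
      then obtain d where d: "0 < d" "c + d *\<^sub>R l \<in> ?F"
        using ray_to_frontier[OF compact_imp_bounded[OF A(1)] c] by metis
      moreover have "?f (c + d *\<^sub>R l) = l"
        using d l by (simp add: sgn_scaleR sgn_div_norm)
      ultimately show "l \<in> ?f ` ?F" by force
    qed
  qed
  moreover have "continuous_on ?F ?f"
    using cF by (intro continuous_on_sgn continuous_intros) auto
  ultimately obtain g where g: "homeomorphism ?F (sphere 0 1) ?f g"
    using homeomorphism_compact[OF \<open>compact ?F\<close>] by metis
  show thesis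
  proof
    have "uniformly_continuous_on (sphere 0 1) g"
      using g by (intro compact_uniformly_continuous) (auto simp: homeomorphism_def)
    moreover have "uniformly_continuous_on UNIV cis"
      unfolding uniformly_continuous_on_def
      by (metis dist_cis_le dist_real_def dist_commute order.strict_trans1)
    ultimately show "uniformly_continuous_on UNIV (\<lambda>\<theta>. g (cis \<theta>))"
      unfolding uniformly_continuous_on_def by (metis UNIV_I dist_0_norm mem_sphere norm_cis)
    show "g (cis \<theta>) \<in> ?F" for \<theta> using g by (force simp: homeomorphism_def)
    show "?f (g (cis \<theta>)) = cis \<theta>" for \<theta> using g by (simp add: homeomorphism_def)
    show "g (cis \<theta>) = x" if "x \<in> ?F" "?f x = cis \<theta>" for x \<theta>
      using g that by (metis homeomorphism_apply1)
  qed
qed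

lemma increasing_times:
  fixes f :: "real \<Rightarrow> real" and \<theta> :: "nat \<Rightarrow> real"
  assumes f: "continuous_on {0..1} f" "f 0 \<le> \<theta> 0" "\<theta> m \<le> f 1"
    and \<theta>: "\<And>i. i < m \<Longrightarrow> \<theta> i \<le> \<theta> (Suc i)"
  obtains t where "\<And>i. i \<le> m \<Longrightarrow> t i \<in> {0..1} \<and> f (t i) = \<theta> i"
    "\<And>i. i < m \<Longrightarrow> t i \<le> t (Suc i)"
proof -
  have top: "\<theta> i \<le> f 1" if "i \<le> m" for i
    using that by (induction i rule: inc_induct) (use f \<theta> in \<open>auto intro: order_trans\<close>)
  have "\<exists>t. (\<forall>i\<le>k. t i \<in> {0..1} \<and> f (t i) = \<theta> i) \<and> (\<forall>i<k. t i \<le> t (Suc i))" if "k \<le> m" for k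
    using that
  proof (induction k)
    case 0
    obtain x where "0 \<le> x" "x \<le> 1" "f x = \<theta> 0"
      using IVT'[of f 0 "\<theta> 0" 1] f top[of 0] by auto
    then show ?case by (intro exI[of _ "\<lambda>_. x"]) auto
  next
    case (Suc k)
    then obtain t where t: "\<forall>i\<le>k. t i \<in> {0..1} \<and> f (t i) = \<theta> i" "\<forall>i<k. t i \<le> t (Suc i)"
      by auto
    have tk: "t k \<in> {0..1}" "f (t k) = \<theta> k" using t by auto
    have "continuous_on {t k..1} f"
      using f(1) tk by (auto intro: continuous_on_subset)
    then obtain x where "t k \<le> x" "x \<le> 1" "f x = \<theta> (Suc k)"
      using IVT'[of f "t k" "\<theta> (Suc k)" 1] tk \<theta>[of k] Suc.prems top[of "Suc k"] by auto
    then show ?case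
      using t tk by (intro exI[of _ "t(Suc k := x)"]) (auto simp: le_Suc_eq less_Suc_eq)
  qed
  from this[of m] that show thesis by auto
qed

text \<open>
  Used for paths that run round a curve clockwise.
\<close>

lemma path_length_ge_sum_decreasing:
  fixes g :: "real \<Rightarrow> 'a::metric_space" and t :: "nat \<Rightarrow> real"
  assumes "\<And>i. i < n \<Longrightarrow> t (Suc i) \<le> t i" and "t 0 \<le> 1" "0 \<le> t n"
  shows "ennreal (\<Sum>i<n. dist (g (t i)) (g (t (Suc i)))) \<le> path_length g"
proof -
  have "(\<Sum>i<n. dist (g (t i)) (g (t (Suc i))))
      = (\<Sum>i<n. dist (g (t (n - Suc i))) (g (t (Suc (n - Suc i)))))"
    by (rule sum.nat_diff_reindex[symmetric])
  also have "\<dots> = (\<Sum>i<n. dist (g (t (n - i))) (g (t (n - Suc i))))"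
    by (intro sum.cong refl) (simp add: Suc_diff_Suc dist_commute)
  finally have eq: "(\<Sum>i<n. dist (g (t i)) (g (t (Suc i))))
      = (\<Sum>i<n. dist (g (t (n - i))) (g (t (n - Suc i))))" .
  have "t (n - i) \<le> t (n - Suc i)" if "i < n" for i
    using assms(1)[of "n - Suc i"] that by (simp add: Suc_diff_Suc)
  then show ?thesis
    unfolding eq using path_length_ge_sum[of n "\<lambda>i. t (n - i)" g] assms(2,3) by simp
qed

lemma cis_eq_iff_int: "cis a = cis b \<longleftrightarrow> (\<exists>k::int. a = b + 2 * pi * of_int k)"
  using sin_cos_eq_iff[of a b] by (auto simp: complex_eq_iff)

text \<open>
  The polar angle along \<open>g\<close> lifts to a continuous real function that starts at \<open>a\<close> and
  ends at \<open>b + 2 * pi * l\<close> for an integer \<open>l\<close>. By the intermediate value theorem it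
  runs through all angles from \<open>a\<close> to \<open>b\<close> if \<open>l \<ge> 0\<close>, and through all angles
  from \<open>a\<close> down to \<open>b - 2 * pi\<close> otherwise. So the path visits, in order, all chosen points on
  one of the two arcs.
\<close>

lemma path_length_in_convex_curve:
  fixes A :: "complex set"
  assumes A: "compact A" "convex A" and c: "c \<in> interior A"
    and V: "\<And>\<theta>. V \<theta> \<in> frontier A" "\<And>\<theta>. sgn (V \<theta> - c) = cis \<theta>"
      "\<And>x \<theta>. x \<in> frontier A \<Longrightarrow> sgn (x - c) = cis \<theta> \<Longrightarrow> V \<theta> = x"
    and g: "path g" "path_image g \<subseteq> frontier A" "pathstart g = V a" "pathfinish g = V b"
    and \<theta>: "\<theta> 0 = a" "\<theta> m = b" "\<And>i. i < m \<Longrightarrow> \<theta> i \<le> \<theta> (Suc i)"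
    and \<psi>: "\<psi> 0 = b" "\<psi> n = a + 2 * pi" "\<And>i. i < n \<Longrightarrow> \<psi> i \<le> \<psi> (Suc i)"
  shows "ennreal (min (\<Sum>i<m. dist (V (\<theta> i)) (V (\<theta> (Suc i))))
                      (\<Sum>i<n. dist (V (\<psi> i)) (V (\<psi> (Suc i))))) \<le> path_length g"
proof -
  have cF: "c \<notin> frontier A" using c by (simp add: frontier_def)
  have gF: "g t \<in> frontier A" if "t \<in> {0..1}" for t using g that by (auto simp: path_image_def)
  have contg: "continuous_on {0..1} g" using g by (simp add: path_def)
  have per: "V (\<phi> + 2 * pi * of_int k) = V \<phi>" for \<phi> k
    using V(3)[OF V(1)[of \<phi>], of "\<phi> + 2 * pi * of_int k"] V(2)[of \<phi>]
    by (metis cis_eq_iff_int)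
  obtain L where L: "continuous_on {0..1} L" "\<And>t. t \<in> {0..1} \<Longrightarrow> g t - c = exp (L t)"
  proof (rule continuous_logarithm_on_contractible[of "{0..1::real}" "\<lambda>t. g t - c"])
    show "continuous_on {0..1} (\<lambda>t. g t - c)" using contg by (intro continuous_intros)
    show "g t - c \<noteq> 0" if "t \<in> {0..1}" for t using gF[OF that] cF by auto
  qed (auto intro: convex_imp_contractible)
  have sgn_g: "sgn (g t - c) = cis (Im (L t))" if "t \<in> {0..1}" for t
    using L(2)[OF that] by (simp add: exp_eq_polar sgn_mult sgn_of_real)
  have "cis (Im (L 0)) = cis a"
    using sgn_g[of 0] g(3) V(2)[of a] by (simp add: pathstart_def)
  then obtain k :: int where k: "a = Im (L 0) + 2 * pi * of_int k"
    by (metis cis_eq_iff_int)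
  define \<Theta> where "\<Theta> t = Im (L t) + 2 * pi * of_int k" for t
  have \<Theta>0: "\<Theta> 0 = a" by (simp add: \<Theta>_def k)
  have cont\<Theta>: "continuous_on {0..1} \<Theta>" unfolding \<Theta>_def using L by (intro continuous_intros)
  have V\<Theta>: "V (\<Theta> t) = g t" if "t \<in> {0..1}" for t
    unfolding \<Theta>_def per using V(3) gF sgn_g that by blast
  have "cis (\<Theta> 1) = cis b"
    using V\<Theta>[of 1] g(4) V(2)[of b] V(2)[of "\<Theta> 1"] by (simp add: pathfinish_def)
  then obtain l :: int where l: "\<Theta> 1 = b + 2 * pi * of_int l"
    by (metis cis_eq_iff_int)
  show ?thesis
  proof (cases "0 \<le> l")
    case True
    then have "b \<le> \<Theta> 1" using l by simp
    then obtain t where t: "\<And>i. i \<le> m \<Longrightarrow> t i \<in> {0..1} \<and> \<Theta> (t i) = \<theta> i"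
      "\<And>i. i < m \<Longrightarrow> t i \<le> t (Suc i)"
      using increasing_times[of \<Theta> \<theta> m] cont\<Theta> \<Theta>0 \<theta> by auto
    have "(\<Sum>i<m. dist (V (\<theta> i)) (V (\<theta> (Suc i)))) = (\<Sum>i<m. dist (g (t i)) (g (t (Suc i))))"
    proof (rule sum.cong)
      fix i assume "i \<in> {..<m}"
      then show "dist (V (\<theta> i)) (V (\<theta> (Suc i))) = dist (g (t i)) (g (t (Suc i)))"
        using t(1)[of i] t(1)[of "Suc i"] V\<Theta> by (metis Suc_leI lessThan_iff less_imp_le)
    qed simp
    moreover have "ennreal (\<Sum>i<m. dist (g (t i)) (g (t (Suc i)))) \<le> path_length g"
      using path_length_ge_sum[of m t g] t(1)[of 0] t(1)[of m] t(2) by auto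
    ultimately show ?thesis by (intro order_trans[OF ennreal_leI[OF min.cobounded1]]) simp
  next
    case False
    then have "of_int l \<le> (-1::real)" by linarith
    then have "pi * of_int l \<le> pi * (-1)" by (intro mult_left_mono) auto
    then have "\<Theta> 1 \<le> b - 2 * pi" using l by simp
    moreover have "continuous_on {0..1} (\<lambda>s. \<Theta> (1 - s))"
      by (intro continuous_on_compose2[OF cont\<Theta>] continuous_intros) auto
    ultimately obtain t where t: "\<And>i. i \<le> n \<Longrightarrow> t i \<in> {0..1} \<and> \<Theta> (1 - t i) = \<psi> i - 2 * pi"
      "\<And>i. i < n \<Longrightarrow> t i \<le> t (Suc i)"
      using increasing_times[of "\<lambda>s. \<Theta> (1 - s)" "\<lambda>i. \<psi> i - 2 * pi" n] \<Theta>0 \<psi> by auto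
    have V\<psi>: "V (\<psi> i) = g (1 - t i)" if "i \<le> n" for i
      using t(1)[OF that] V\<Theta>[of "1 - t i"] per[of "\<psi> i" "-1"] by simp
    have "(\<Sum>i<n. dist (V (\<psi> i)) (V (\<psi> (Suc i))))
        = (\<Sum>i<n. dist (g (1 - t i)) (g (1 - t (Suc i))))"
      by (intro sum.cong refl) (simp add: V\<psi>)
    moreover have "ennreal (\<Sum>i<n. dist (g (1 - t i)) (g (1 - t (Suc i)))) \<le> path_length g"
      using path_length_ge_sum_decreasing[of n "\<lambda>i. 1 - t i" g] t(1)[of 0] t(1)[of n] t(2) by auto
    ultimately show ?thesis by (intro order_trans[OF ennreal_leI[OF min.cobounded2]]) simp
  qed
qed

text \<open>
  Gromov's argument that closed curves have distortion at least \<open>\<pi> / 2\<close>, for inscribed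
  polygons. Let \<open>l\<close> be the length of a fine inscribed polygon and join each vertex to the vertex
  half-way round. While the first vertex moves through half of the polygon, this chord turns into its negative,
  and it changes by at most \<open>l\<close> in total, because both of its ends travel about \<open>l / 2\<close>. So the
  chord cannot be longer than about \<open>l / \<pi>\<close> all the time, whereas its end points always have
  distance about \<open>l / 2\<close> along the curve.

  The last conclusion bounds the size of the curve by \<open>l\<close>; it makes the estimate robust against
  perturbations that are small relative to that size.
\<close>

lemma convex_curve_far_pair:
  fixes A :: "complex set"
  assumes A: "compact A" "convex A" "interior A \<noteq> {}" and \<tau>: "0 < \<tau>" "\<tau> < pi / 2"
  obtains u w l where "u \<in> frontier A" "w \<in> frontier A" "0 < l"
    "\<tau> * dist u w \<le> l" "ennreal l \<le> intrinsic_dist (frontier A) u w"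
    "\<And>x y. x \<in> frontier A \<Longrightarrow> y \<in> frontier A \<Longrightarrow> dist x y \<le> 2 * l"
proof -
  obtain c where c: "c \<in> interior A" using A by blast
  obtain V where V: "uniformly_continuous_on UNIV V" "\<And>\<theta>. V \<theta> \<in> frontier A"
    "\<And>\<theta>. sgn (V \<theta> - c) = cis \<theta>"
    "\<And>x \<theta>. x \<in> frontier A \<Longrightarrow> sgn (x - c) = cis \<theta> \<Longrightarrow> V \<theta> = x"
    using radial_parametrisation[OF A(1,2) c] by metis
  have cF: "c \<notin> frontier A" using c by (simp add: frontier_def)
  define D where "D = dist (V 0) (V pi)"
  have "V 0 \<noteq> V pi" using V(3)[of 0] V(3)[of pi] by auto
  then have "0 < D" by (simp add: D_def)
  \<comment> \<open>The mesh \<open>\<mu>\<close> is small against the slack \<open>1/2 - \<tau> / pi\<close>; all errors below add up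
    to at most \<open>13 * \<mu>\<close>.\<close>
  define \<mu> where "\<mu> = (1/2 - \<tau> / pi) * D / 13"
  have "0 < 1/2 - \<tau> / pi" using \<tau> by (simp add: field_simps)
  then have \<mu>0: "0 < \<mu>" using \<open>0 < D\<close> by (simp add: \<mu>_def)
  have "(1/2 - \<tau> / pi) * D \<le> 1/2 * D"
    using \<tau> \<open>0 < D\<close> by (intro mult_right_mono) auto
  moreover have "26 * \<mu> = 2 * ((1/2 - \<tau> / pi) * D)" by (simp add: \<mu>_def)
  ultimately have \<mu>D: "26 * \<mu> \<le> D" by linarith
  obtain \<delta> where \<delta>: "0 < \<delta>" "\<And>\<theta> \<phi>. \<bar>\<theta> - \<phi>\<bar> < \<delta> \<Longrightarrow> dist (V \<theta>) (V \<phi>) < \<mu>"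
    using V(1) \<mu>0 unfolding uniformly_continuous_on_def dist_real_def by (metis UNIV_I)
  obtain M0 :: nat where M0: "2 * pi / \<delta> < M0" using reals_Archimedean2 by blast
  \<comment> \<open>An even number of vertices, so that \<open>V 0\<close> and \<open>V pi\<close> are among them; their distance \<open>D\<close>
    bounds the length of the polygon from below.\<close>
  define M where "M = 2 * Suc M0"
  have M: "0 < M" "even M" "2 * pi / M < \<delta>"
  proof -
    have "2 * pi < \<delta> * M0" using M0 \<delta> by (simp add: field_simps)
    also have "\<dots> \<le> \<delta> * M" using \<delta> by (simp add: M_def)
    finally show "2 * pi / M < \<delta>" by (simp add: M_def field_simps)
  qed (auto simp: M_def)
  define \<alpha> where "\<alpha> k = 2 * pi * real k / M" for k :: nat
  define u where "u k = V (\<alpha> k)" for k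
  define d where "d k = dist (u k) (u (Suc k))" for k
  define S where "S n = (\<Sum>k<n. d k)" for n
  define l where "l = S M"
  have \<alpha>M: "\<alpha> (k + M) = \<alpha> k + 2 * pi" for k
    using M by (simp add: \<alpha>_def field_simps)
  have uM: "u (k + M) = u k" for k
    unfolding u_def \<alpha>M by (rule V(4)[OF V(2)]) (simp add: V(3) complex_eq_iff)
  have dM: "d (k + M) = d k" for k using uM[of k] uM[of "Suc k"] by (simp add: d_def)
  have \<alpha>S: "\<alpha> k \<le> \<alpha> (Suc k)" for k by (simp add: \<alpha>_def divide_right_mono)
  have d\<mu>: "d k \<le> \<mu>" for k
  proof -
    have "\<bar>\<alpha> k - \<alpha> (Suc k)\<bar> = 2 * pi / M"
      by (simp add: \<alpha>_def diff_divide_distrib[symmetric] algebra_simps)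
    then show ?thesis using \<delta>(2)[of "\<alpha> k" "\<alpha> (Suc k)"] M(3) by (simp add: d_def u_def)
  qed
  have d0: "0 \<le> d k" for k by (simp add: d_def)
  have SS: "S (Suc n) = S n + d n" for n by (simp add: S_def)
  have S0: "S 0 = 0" by (simp add: S_def)
  have Smono: "S i \<le> S j" if "i \<le> j" for i j
    using that by (rule lift_Suc_mono_le[rotated]) (simp add: SS d0)
  have SM: "S (n + M) = S n + l" for n
    by (induction n) (simp_all add: S0 l_def SS dM)
  have udist_le: "dist (u i) (u j) \<le> S j - S i" if "i \<le> j" for i j
    using that
  proof (induction j rule: dec_induct)
    case (step n)
    then show ?case using dist_triangle[of "u i" "u (Suc n)" "u n"] by (simp add: SS d_def)
  qed simp
  have udist: "dist (u i) (u j) \<le> \<bar>S j - S i\<bar>" for i j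
    using udist_le[of i j] udist_le[of j i] by (cases "i \<le> j") (auto simp: dist_commute)
  have half: "dist (u i) (u j) \<le> l / 2" if "i \<le> j" "j \<le> i + M" for i j
    using udist_le[of i j] udist_le[of j "i + M"] that SM[of i] uM[of i] by (simp add: dist_commute)
  have lD: "2 * D \<le> l"
  proof -
    have "\<alpha> (Suc M0) = pi" "\<alpha> 0 = 0" by (auto simp: \<alpha>_def M_def field_simps)
    then have "D = dist (u 0) (u (Suc M0))" by (simp add: D_def u_def)
    then show ?thesis using half[of 0 "Suc M0"] by (simp add: M_def)
  qed
  then have l0: "0 < l" and l\<mu>: "52 * \<mu> \<le> l" using \<open>0 < D\<close> \<mu>D by auto
  have diam: "dist x y \<le> l - 2 * \<mu>" if xy: "x \<in> frontier A" "y \<in> frontier A" for x y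
  proof -
    have near: "\<exists>k<M. dist x (u k) \<le> \<mu>" if x: "x \<in> frontier A" for x
    proof -
      define \<phi> where "\<phi> = Arg2pi (x - c)"
      have \<phi>: "0 \<le> \<phi>" "\<phi> < 2 * pi" by (auto simp: \<phi>_def Arg2pi_ge_0 Arg2pi_lt_2pi)
      have "x - c \<noteq> 0" using x cF by auto
      then have "sgn (x - c) = cis \<phi>"
        using Arg2pi_eq[of "x - c"] unfolding sgn_eq \<phi>_def cis_conv_exp
        by (metis mult.commute nonzero_mult_div_cancel_left norm_eq_zero of_real_eq_0_iff)
      then have x\<phi>: "V \<phi> = x" using V(4) x by blast
      define k where "k = nat \<lfloor>\<phi> * M / (2 * pi)\<rfloor>"
      have "0 \<le> \<phi> * M / (2 * pi)" using \<phi> by simp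
      then have k: "real k \<le> \<phi> * M / (2 * pi)" "\<phi> * M / (2 * pi) < real k + 1"
        by (auto simp: k_def)
      have "\<phi> * M / (2 * pi) < M" using \<phi> M by (simp add: field_simps)
      then have "k < M" using k by linarith
      have "\<alpha> k \<le> \<phi>" "\<phi> \<le> \<alpha> k + 2 * pi / M"
        using k M by (auto simp: \<alpha>_def field_simps)
      then have "dist (V \<phi>) (V (\<alpha> k)) < \<mu>" using \<delta>(2) M(3) by auto
      then show ?thesis using \<open>k < M\<close> x\<phi> by (intro exI[of _ k]) (simp add: u_def)
    qed
    obtain i where i: "i < M" "dist x (u i) \<le> \<mu>" using near[OF xy(1)] by blast
    obtain j where j: "j < M" "dist y (u j) \<le> \<mu>" using near[OF xy(2)] by blast
    have "dist (u i) (u j) \<le> l / 2"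
      using half[of i j] half[of j i] i j by (cases "i \<le> j") (auto simp: dist_commute)
    then have "dist x y \<le> l / 2 + 2 * \<mu>"
      using i j dist_triangle[of x y "u i"] dist_triangle[of "u i" y "u j"]
      by (simp add: dist_commute)
    then show ?thesis using l\<mu> \<mu>0 by linarith
  qed
  \<comment> \<open>The vertex half-way round from \<open>u i\<close>, up to one step.\<close>
  define j where "j i = (LEAST k. S i + l / 2 \<le> S k)" for i
  have jex: "S i + l / 2 \<le> S (i + M)" for i using SM[of i] l0 by simp
  have j1: "S i + l / 2 \<le> S (j i)" for i unfolding j_def by (rule LeastI) (rule jex)
  have jM: "j i \<le> i + M" for i unfolding j_def by (rule Least_le) (rule jex)
  have ij: "i \<le> j i" for i
    using j1[of i] l0 Smono[of "j i" i] by (cases "i \<le> j i") auto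
  have j2: "S (j i) \<le> S i + l / 2 + \<mu>" for i
  proof (cases "j i")
    case 0
    then show ?thesis using S0 Smono[of 0 i] l0 \<mu>0 by simp
  next
    case (Suc k)
    then have "S k < S i + l / 2" using not_less_Least[of k] unfolding j_def by (metis lessI not_le)
    then show ?thesis using d\<mu>[of k] by (simp add: Suc SS)
  qed
  have far: "ennreal (l / 2 - \<mu>) \<le> intrinsic_dist (frontier A) (u i) (u (j i))" for i
    unfolding intrinsic_dist_def
  proof (rule INF_greatest)
    fix g assume "g \<in> {g. path g \<and> path_image g \<subseteq> frontier A \<and> pathstart g = u i \<and> pathfinish g = u (j i)}"
    then have g: "path g" "path_image g \<subseteq> frontier A"
      "pathstart g = V (\<alpha> i)" "pathfinish g = V (\<alpha> (j i))" by (auto simp: u_def)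
    have sum: "(\<Sum>k<n. dist (V (\<alpha> (a + k))) (V (\<alpha> (a + Suc k)))) = S (a + n) - S a" for a n
      by (induction n) (auto simp: SS d_def u_def)
    have "ennreal (min (\<Sum>k<j i - i. dist (V (\<alpha> (i + k))) (V (\<alpha> (i + Suc k))))
             (\<Sum>k<i + M - j i. dist (V (\<alpha> (j i + k))) (V (\<alpha> (j i + Suc k))))) \<le> path_length g"
      by (rule path_length_in_convex_curve[OF A(1,2) c V(2-4) g,
            where \<theta> = "\<lambda>k. \<alpha> (i + k)" and \<psi> = "\<lambda>k. \<alpha> (j i + k)"])
         (use ij[of i] jM[of i] \<alpha>M[of i] \<alpha>S in auto)
    moreover have "l / 2 - \<mu> \<le> min (S (j i) - S i) (S (i + M) - S (j i))"
      using j1[of i] j2[of i] SM[of i] \<mu>0 by simp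
    moreover have "i + (j i - i) = j i" "j i + (i + M - j i) = i + M"
      using ij[of i] jM[of i] by auto
    ultimately show "ennreal (l / 2 - \<mu>) \<le> path_length g"
      unfolding sum by (metis ennreal_leI order_trans)
  qed
  have "\<exists>i. \<tau> * dist (u i) (u (j i)) \<le> l / 2 - \<mu>"
  proof (rule ccontr)
    assume no: "\<not> ?thesis"
    define \<rho> where "\<rho> = (l + 4 * \<mu>) / pi + 4 * \<mu>"
    have \<rho>0: "4 * \<mu> \<le> \<rho>" using \<mu>0 l0 by (simp add: \<rho>_def)
    have \<tau>\<rho>: "\<tau> * \<rho> \<le> l / 2 - \<mu>"
    proof -
      have "13 * \<mu> \<le> (1/2 - \<tau> / pi) * l"
        unfolding \<mu>_def using lD \<open>0 < D\<close> \<open>0 < 1/2 - \<tau> / pi\<close> by simp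
      moreover have "\<tau> * \<mu> \<le> 2 * \<mu>" using \<tau> pi_less_4 \<mu>0 by (intro mult_right_mono) auto
      moreover have "\<tau> * (4 * \<mu>) / pi \<le> 2 * \<mu>" using \<tau> \<mu>0 by (simp add: field_simps)
      moreover have "\<tau> * \<rho> = \<tau> / pi * l + \<tau> * (4 * \<mu>) / pi + 4 * (\<tau> * \<mu>)"
        by (simp add: \<rho>_def algebra_simps add_divide_distrib)
      moreover have "(1/2 - \<tau> / pi) * l = l / 2 - \<tau> / pi * l" by (simp add: algebra_simps)
      ultimately show ?thesis using \<mu>0 by linarith
    qed
    define \<beta> where "\<beta> i = u (j i) - u i" for i
    have big: "\<rho> \<le> norm (\<beta> i)" for i
    proof -
      have "\<tau> * \<rho> < \<tau> * norm (\<beta> i)"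
        using no \<tau>\<rho> by (auto simp: \<beta>_def dist_norm norm_minus_commute not_le intro: le_less_trans)
      then show ?thesis using \<tau>(1) by simp
    qed
    define J where "J = j 0"
    \<comment> \<open>The vertices \<open>j (j 0)\<close> and \<open>M\<close> may differ, by an arc of length at most
      \<open>2 * \<mu>\<close>; a last step makes the half turn exact.\<close>
    define \<gamma> where "\<gamma> i = (if i \<le> J then \<beta> i else - \<beta> 0)" for i
    have stepd: "norm (\<beta> (Suc i) - \<beta> i) \<le> d i + (S (j (Suc i)) - S (j i))" for i
    proof -
      have "S (j i) \<le> S (j (Suc i))"
      proof -
        have "j i \<le> j (Suc i)"
          using j1[of "Suc i"] unfolding j_def[of i]
          by (intro Least_le) (use d0[of i] in \<open>simp add: SS\<close>)
        then show ?thesis by (rule Smono)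
      qed
      then have "dist (u (j (Suc i))) (u (j i)) \<le> S (j (Suc i)) - S (j i)"
        using udist[of "j (Suc i)" "j i"] by simp
      moreover have "norm (\<beta> (Suc i) - \<beta> i) \<le> dist (u (j (Suc i))) (u (j i)) + d i"
        unfolding \<beta>_def d_def dist_norm
        using norm_triangle_ineq[of "u (j (Suc i)) - u (j i)" "u i - u (Suc i)"]
        by (simp add: algebra_simps)
      ultimately show ?thesis by simp
    qed
    have last: "norm (- \<beta> 0 - \<beta> J) \<le> 2 * \<mu>"
    proof -
      have "- \<beta> 0 - \<beta> J = u M - u (j J)" using uM[of 0] by (simp add: \<beta>_def J_def)
      then have "norm (- \<beta> 0 - \<beta> J) \<le> \<bar>S (j J) - S M\<bar>"
        using udist[of M "j J"] by (simp add: dist_norm)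
      also have "\<dots> \<le> 2 * \<mu>"
        using j1[of J] j2[of J] j1[of 0] j2[of 0] S0 by (simp add: J_def l_def)
      finally show ?thesis .
    qed
    have "pi * \<rho> * (1 - 3 * \<mu> / \<rho>) \<le> (\<Sum>i<Suc J. norm (\<gamma> (Suc i) - \<gamma> i))"
    proof (rule polygonal_half_turn_length)
      show "\<rho> \<le> norm (\<gamma> i)" for i using big by (simp add: \<gamma>_def)
      show "0 < \<rho>" "3 * \<mu> / \<rho> < 1" using \<rho>0 \<mu>0 by auto
      show "\<gamma> (Suc J) = - \<gamma> 0" by (simp add: \<gamma>_def)
      fix i assume "i < Suc J"
      have "norm (\<gamma> (Suc i) - \<gamma> i) \<le> 3 * \<mu>"
      proof (cases "i = J")
        case True
        then show ?thesis using last \<mu>0 by (simp add: \<gamma>_def)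
      next
        case False
        then have "norm (\<gamma> (Suc i) - \<gamma> i) \<le> d i + (S (j (Suc i)) - S (j i))"
          using stepd[of i] \<open>i < Suc J\<close> by (simp add: \<gamma>_def)
        also have "\<dots> \<le> 3 * \<mu>"
          using j2[of "Suc i"] j1[of i] d\<mu>[of i] by (simp add: SS)
        finally show ?thesis .
      qed
      then show "norm (\<gamma> (Suc i) - \<gamma> i) \<le> 3 * \<mu> / \<rho> * \<rho>" using \<open>0 < \<rho>\<close> by simp
    qed
    also have "\<dots> = (\<Sum>i<J. norm (\<beta> (Suc i) - \<beta> i)) + norm (- \<beta> 0 - \<beta> J)"
      by (simp add: \<gamma>_def)
    also have "\<dots> \<le> (\<Sum>i<J. d i + (S (j (Suc i)) - S (j i))) + 2 * \<mu>"
      by (intro add_mono sum_mono stepd last)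
    also have "\<dots> = S (j J) + 2 * \<mu>"
      using sum_lessThan_telescope[of "\<lambda>i. S (j i)" J] by (simp add: sum.distrib S_def J_def)
    also have "\<dots> \<le> l + 4 * \<mu>"
      using j2[of J] j2[of 0] S0 by (simp add: J_def)
    also have "pi * \<rho> * (1 - 3 * \<mu> / \<rho>) = pi * (\<rho> - 3 * \<mu>)"
      using \<rho>0 \<mu>0 by (simp add: field_simps)
    finally have "pi * (\<rho> - 3 * \<mu>) \<le> l + 4 * \<mu>" .
    moreover have "pi * (\<rho> - 3 * \<mu>) = l + 4 * \<mu> + pi * \<mu>"
      by (simp add: \<rho>_def field_simps)
    ultimately show False using mult_pos_pos[OF pi_gt_zero \<mu>0] by linarith
  qed
  then obtain i where i: "\<tau> * dist (u i) (u (j i)) \<le> l / 2 - \<mu>" ..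
  show thesis
    by (rule that[of "u i" "u (j i)" "l / 2 - \<mu>"])
       (use i far[of i] diam l\<mu> \<mu>0 V(2) in \<open>auto simp: u_def algebra_simps\<close>)
qed

section \<open>Elongated bodies\<close>

text \<open>
  The plane orthogonal to \<open>e\<close> is identified with the complex numbers, by the inclusion
  \<open>J\<close> and the orthogonal projection \<open>Q\<close>.
\<close>

lemma complex_coordinates_orthogonal_to:
  fixes e :: "real ^ 3"
  assumes "norm e = 1"
  obtains J :: "complex \<Rightarrow> real ^ 3" and Q :: "real ^ 3 \<Rightarrow> complex"
  where "linear J" "linear Q" "\<And>w z. Q (J w + z *\<^sub>R e) = w" "\<And>w z. (J w + z *\<^sub>R e) \<bullet> e = z"
    "\<And>x. J (Q x) + (x \<bullet> e) *\<^sub>R e = x" "\<And>w z. (norm (J w + z *\<^sub>R e))\<^sup>2 = (norm w)\<^sup>2 + z\<^sup>2"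
proof -
  obtain f where f: "orthogonal_transformation f" "f (axis (3::3) (1::real)) = e"
    by (rule orthogonal_transformation_exists_1[of "axis (3::3) 1 :: real^3" e]) (use assms in auto)
  have lin: "linear f" and inner: "\<And>x y. f x \<bullet> f y = x \<bullet> y"
    using f(1) by (auto simp: orthogonal_transformation_def)
  have surj: "surj f" using f(1) by (simp add: orthogonal_transformation_surj)
  define f1 where "f1 = f (axis (1::3) (1::real))"
  define f2 where "f2 = f (axis (2::3) (1::real))"
  have orth: "f1 \<bullet> f1 = 1" "f2 \<bullet> f2 = 1" "e \<bullet> e = 1" "f1 \<bullet> f2 = 0" "f2 \<bullet> f1 = 0"
      "f1 \<bullet> e = 0" "e \<bullet> f1 = 0" "f2 \<bullet> e = 0" "e \<bullet> f2 = 0"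
    unfolding f1_def f2_def f(2)[symmetric] inner by (simp_all add: inner_axis_axis)
  define J where "J w = Re w *\<^sub>R f1 + Im w *\<^sub>R f2" for w
  define Q where "Q x = Complex (x \<bullet> f1) (x \<bullet> f2)" for x
  have QJ: "Q (J w + z *\<^sub>R e) = w" "(J w + z *\<^sub>R e) \<bullet> e = z" for w z
    by (simp_all add: Q_def J_def inner_add_left orth)
  show thesis
  proof
    show "linear J" by (rule linearI) (simp_all add: J_def algebra_simps)
    show "linear Q" by (rule linearI) (simp_all add: Q_def inner_add_left complex_eq_iff)
    show "Q (J w + z *\<^sub>R e) = w" "(J w + z *\<^sub>R e) \<bullet> e = z" for w z by (fact QJ)+
    show "J (Q x) + (x \<bullet> e) *\<^sub>R e = x" for x
    proof -
      obtain y where y: "x = f y" using surj by blast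
      have "y = y $ 1 *\<^sub>R axis 1 1 + y $ 2 *\<^sub>R axis 2 1 + y $ 3 *\<^sub>R axis 3 1"
        by (simp add: vec_eq_iff forall_3 axis_def)
      then have "x = y $ 1 *\<^sub>R f1 + y $ 2 *\<^sub>R f2 + y $ 3 *\<^sub>R e"
        unfolding y f1_def f2_def f(2)[symmetric]
        by (metis linear_add[OF lin] linear_scale[OF lin])
      then have "x = J (Complex (y $ 1) (y $ 2)) + y $ 3 *\<^sub>R e" by (simp add: J_def)
      then show ?thesis using QJ by metis
    qed
    show "(norm (J w + z *\<^sub>R e))\<^sup>2 = (norm w)\<^sup>2 + z\<^sup>2" for w z
      unfolding power2_norm_eq_inner[of "J w + z *\<^sub>R e"] cmod_power2
      by (simp add: J_def inner_add_left inner_add_right orth power2_eq_square)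
  qed
qed

text \<open>
  Let \<open>C\<close> be the section of \<open>K\<close> through the midpoint of \<open>a b\<close> orthogonal to this
  segment. The convex hull of \<open>C\<close>, \<open>a\<close> and \<open>b\<close> lies in \<open>K\<close>, so near the
  section \<open>K\<close> contains the cylinder of half-height \<open>T\<close> over the slightly smaller copy \<open>A\<close> of
  \<open>C\<close>. A path on the surface of \<open>K\<close> which stays between the two ends of this cylinder
  has an orthogonal shadow outside the interior of \<open>A\<close>, hence is at least as long as the
  corresponding path on the frontier of \<open>A\<close>; a path that reaches an end has length at least
  \<open>T\<close>. The far pair on the frontier of \<open>A\<close> is moved outwards to the surface of \<open>K\<close>, which
  changes the chord by a small fraction only.
\<close>

lemma elongated_body_distortion:
  assumes q: "0 < q" "q < pi / 2"
  obtains \<epsilon> where "0 < \<epsilon>" "\<And>(K :: (real ^ 3) set) a b. convex_body K \<Longrightarrow> a \<in> K \<Longrightarrow> b \<in> K \<Longrightarrow> a \<noteq> b \<Longrightarrow>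
     (\<And>x. x \<in> K \<Longrightarrow> (x - midpoint a b) \<bullet> (b - a) = 0 \<Longrightarrow> dist x (midpoint a b) \<le> \<epsilon> * dist a b) \<Longrightarrow>
     ennreal q < distortion (frontier K)"
proof -
  define \<tau> where "\<tau> = (q + pi / 2) / 2"
  have \<tau>: "q < \<tau>" "0 < \<tau>" "\<tau> < pi / 2" using q by (auto simp: \<tau>_def)
  \<comment> \<open>\<open>\<tau>\<close> is the quotient achieved on the section curve; the loss of the chord, at most a fraction
    \<open>64 * \<epsilon>\<close> of the length, must leave a quotient above \<open>q\<close>.\<close>
  define \<epsilon> where "\<epsilon> = min (1/16) ((1 - q / \<tau>) / (128 * q))"
  have "0 < 1 - q / \<tau>" using \<tau> by simp
  then have \<epsilon>: "0 < \<epsilon>" "\<epsilon> \<le> 1/16" using q by (auto simp: \<epsilon>_def)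
  have "\<epsilon> \<le> (1 - q / \<tau>) / (128 * q)" by (simp add: \<epsilon>_def)
  then have "128 * (q * \<epsilon>) \<le> 1 - q / \<tau>" using q by (simp add: pos_le_divide_eq mult_ac)
  moreover have "q * (1 / \<tau> + 64 * \<epsilon>) = q / \<tau> + 64 * (q * \<epsilon>)" by (simp add: algebra_simps)
  moreover have "0 < q * \<epsilon>" using q \<epsilon> by simp
  ultimately have \<epsilon>q: "q * (1 / \<tau> + 64 * \<epsilon>) < 1" by linarith
  show thesis
  proof (rule that[OF \<epsilon>(1)])
    fix K :: "(real ^ 3) set" and a b
    assume K: "convex_body K" and ab: "a \<in> K" "b \<in> K" "a \<noteq> b"
      and thin: "\<And>x. x \<in> K \<Longrightarrow> (x - midpoint a b) \<bullet> (b - a) = 0 \<Longrightarrow>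
                  dist x (midpoint a b) \<le> \<epsilon> * dist a b"
    have cK: "compact K" "convex K" "interior K \<noteq> {}" "closed K"
      using K by (auto simp: convex_body_def compact_imp_closed)
    define L where "L = dist a b"
    have L: "0 < L" using ab by (simp add: L_def)
    define m where "m = midpoint a b"
    define e where "e = (b - a) /\<^sub>R L"
    have e1: "norm e = 1" using L by (simp add: e_def L_def dist_norm norm_minus_commute)
    then have ee: "e \<bullet> e = 1" by (simp add: norm_eq_1)
    have mb: "m + (L / 2) *\<^sub>R e = b" "m - (L / 2) *\<^sub>R e = a"
      using L by (simp_all add: m_def e_def midpoint_def vec_eq_iff field_simps)
    have ends: "m + (s * (L / 2)) *\<^sub>R e \<in> K" if "\<bar>s\<bar> = 1" for s
    proof -
      have "s = 1 \<or> s = -1" using that by linarith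
      then show ?thesis using mb ab by (auto simp: scaleR_minus_left)
    qed
    have mK: "m \<in> K"
      using convexD[OF cK(2) ab(1,2), of "1/2" "1/2"]
      by (simp add: m_def midpoint_def scaleR_add_right)
    obtain J :: "complex \<Rightarrow> real ^ 3" and Q where J: "linear J" "linear Q" "\<And>(w::complex) (z::real). Q (J w + z *\<^sub>R e) = w"
      "\<And>(w::complex) (z::real). (J w + z *\<^sub>R e) \<bullet> e = z" "\<And>x. J (Q x) + (x \<bullet> e) *\<^sub>R e = x"
      "\<And>(w::complex) (z::real). (norm (J w + z *\<^sub>R e))\<^sup>2 = (cmod w)\<^sup>2 + z\<^sup>2"
      using complex_coordinates_orthogonal_to[OF e1] by metis
    have QJ: "Q (J w) = w" and Je: "J w \<bullet> e = 0" for w using J(3,4)[of w 0] by simp_all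
    have nJ: "norm (J w) = norm w" for w
      using J(6)[of w 0] by (simp add: power2_eq_iff_nonneg)
    have nQ: "norm (Q x) \<le> norm x" for x
    proof (rule power2_le_imp_le)
      show "(norm (Q x))\<^sup>2 \<le> (norm x)\<^sup>2" using J(6)[of "Q x" "x \<bullet> e"] unfolding J(5) by simp
    qed simp
    have contJ: "continuous_on U J" and contQ: "continuous_on W Q" for U W
      using J(1,2) by (auto intro: linear_continuous_on linear_conv_bounded_linear[THEN iffD1])
    define C where "C = {w. m + J w \<in> K}"
    have contm: "continuous_on UNIV (\<lambda>w. m + J w)" by (intro continuous_intros contJ)
    have Cr: "norm w \<le> \<epsilon> * L" if "w \<in> C" for w
      using thin[of "m + J w", folded m_def L_def] that Je[of w] nJ[of w] L
      by (simp add: C_def e_def dist_norm)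
    have C: "compact C" "convex C"
    proof -
      have "closed C"
        using continuous_closed_vimage[OF cK(4), of "\<lambda>w. m + J w"] contm
        by (simp add: C_def vimage_def continuous_on_eq_continuous_at)
      moreover have "bounded C" using Cr by (auto simp: bounded_iff)
      ultimately show "compact C" by (simp add: compact_eq_bounded_closed)
      show "convex C"
      proof (rule convexI)
        fix x y and s t :: real
        assume *: "x \<in> C" "y \<in> C" "0 \<le> s" "0 \<le> t" "s + t = 1"
        then have "s *\<^sub>R (m + J x) + t *\<^sub>R (m + J y) \<in> K"
          using convexD[OF cK(2)] by (simp add: C_def)
        moreover have "s *\<^sub>R (m + J x) + t *\<^sub>R (m + J y) = (s + t) *\<^sub>R m + J (s *\<^sub>R x + t *\<^sub>R y)"
          by (simp add: linear_add[OF J(1)] linear_scale[OF J(1)] algebra_simps)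
        ultimately show "s *\<^sub>R x + t *\<^sub>R y \<in> C" using * by (simp add: C_def)
      qed
    qed
    have intC: "w \<in> interior C" if "m + J w \<in> interior K" for w
    proof -
      have "open ((\<lambda>w. m + J w) -` interior K)"
        using contm by (simp add: open_vimage)
      moreover have "(\<lambda>w. m + J w) -` interior K \<subseteq> C"
        using interior_subset by (auto simp: C_def)
      ultimately show ?thesis using that interior_maximal by blast
    qed
    have "interior C \<noteq> {}"
    proof -
      obtain y where y: "y \<in> interior K" using cK by blast
      define \<zeta> where "\<zeta> = (y - m) \<bullet> e"
      obtain y0 where y0: "y0 \<in> interior K" "(y0 - m) \<bullet> e = 0"
      proof (cases "\<zeta> = 0")
        case True
        then show ?thesis using that y by (simp add: \<zeta>_def)
      next
        case False
        define s where "s = \<bar>\<zeta>\<bar> / (\<bar>\<zeta>\<bar> + L / 2)"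
        define v where "v = m + (- sgn \<zeta> * (L / 2)) *\<^sub>R e"
        have "v \<in> K" unfolding v_def using False by (intro ends) simp
        have s: "0 < s" "s < 1" using False L by (auto simp: s_def)
        have "(y - s *\<^sub>R (y - v) - m) \<bullet> e = (1 - s) * \<zeta> - s * (sgn \<zeta> * (L / 2))"
          by (simp add: v_def \<zeta>_def inner_diff_left inner_add_left ee algebra_simps)
        also have "\<dots> = sgn \<zeta> * ((1 - s) * \<bar>\<zeta>\<bar> - s * (L / 2))"
          by (cases "0 < \<zeta>") (auto simp: sgn_if algebra_simps)
        also have "(1 - s) * \<bar>\<zeta>\<bar> - s * (L / 2) = 0" using L by (simp add: s_def field_simps)
        finally have "(v - (1 - s) *\<^sub>R (v - y) - m) \<bullet> e = 0" by (simp add: algebra_simps)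
        moreover have "v - (1 - s) *\<^sub>R (v - y) \<in> interior K"
          using mem_interior_convex_shrink[OF cK(2) y \<open>v \<in> K\<close>, of "1 - s"] s by simp
        ultimately show ?thesis using that by blast
      qed
      then have "y0 = m + J (Q (y0 - m))" using J(5)[of "y0 - m"] by (simp add: algebra_simps)
      then show ?thesis using intC y0(1) by (metis empty_iff)
    qed
    have "0 \<in> C" using mK linear_0[OF J(1)] by (simp add: C_def)
    define r where "r = \<epsilon> * L"
    have r: "0 < r" using \<epsilon> L by (simp add: r_def)
    \<comment> \<open>Twice the largest possible chord in the section, so that paths reaching an end of the cylinder
      have quotient at least \<open>2\<close>; \<open>\<theta>\<close> is then what convexity with \<open>a\<close> and \<open>b\<close> leaves of
      the section at height \<open>T\<close>.\<close>
    define T where "T = 4 * r"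
    define \<theta> where "\<theta> = 1 - 8 * \<epsilon>"
    have \<theta>: "1/2 \<le> \<theta>" "\<theta> \<le> 1" using \<epsilon> by (auto simp: \<theta>_def)
    have shrinkC: "s *\<^sub>R w \<in> C" if "w \<in> C" "0 \<le> s" "s \<le> 1" for s w
      using convexD[OF C(2) \<open>0 \<in> C\<close> that(1), of "1 - s" s] that by simp
    define A where "A = (\<lambda>w. \<theta> *\<^sub>R w) ` C"
    have A: "compact A" "convex A" "interior A \<noteq> {}"
    proof -
      show "compact A" "convex A" using C by (auto simp: A_def compact_scaling convex_scaling)
      show "interior A \<noteq> {}"
        using convex_body_similarity[of C \<theta> 0] C \<open>interior C \<noteq> {}\<close> \<theta>
        by (simp add: A_def convex_body_def)
    qed
    have AC: "A \<subseteq> C" using shrinkC \<theta> by (auto simp: A_def)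
    have CA: "C \<subseteq> (\<lambda>w. (1 / \<theta>) *\<^sub>R w) ` A" using \<theta> by (auto simp: A_def image_image)
    have "0 \<in> A" using \<open>0 \<in> C\<close> by (force simp: A_def)
    have cyl: "m + J w + z *\<^sub>R e \<in> K" if w: "w \<in> A" and z: "\<bar>z\<bar> < T" for w z
    proof -
      obtain w' where w': "w' \<in> C" "w = \<theta> *\<^sub>R w'" using w by (auto simp: A_def)
      define s where "s = 2 * \<bar>z\<bar> / L"
      have s: "0 \<le> s" "s < 1 - \<theta>"
        using z L by (auto simp: s_def T_def r_def \<theta>_def field_simps)
      then have "\<theta> / (1 - s) \<le> 1" "s < 1" "0 \<le> \<theta> / (1 - s)" using \<theta> by (auto simp: field_simps)
      then have w'K: "m + J ((\<theta> / (1 - s)) *\<^sub>R w') \<in> K"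
        using shrinkC[OF w'(1)] by (simp add: C_def)
      obtain v where v: "v \<in> K" "s *\<^sub>R v = s *\<^sub>R m + z *\<^sub>R e"
      proof (cases "z = 0")
        case True
        then show ?thesis using that[OF mK] by (simp add: s_def)
      next
        case False
        have "s * (sgn z * (L / 2)) = z" using L by (simp add: s_def sgn_if)
        then show ?thesis
          using that[OF ends[of "sgn z"]] False by (simp add: scaleR_add_right)
      qed
      have "(1 - s) *\<^sub>R (m + J ((\<theta> / (1 - s)) *\<^sub>R w')) + s *\<^sub>R v \<in> K"
        using convexD[OF cK(2) w'K v(1), of "1 - s" s] s \<open>s < 1\<close> by simp
      moreover have "(1 - s) *\<^sub>R (m + J ((\<theta> / (1 - s)) *\<^sub>R w')) + s *\<^sub>R v = m + J w + z *\<^sub>R e"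
      proof -
        have "(1 - s) * (\<theta> / (1 - s)) = \<theta>" using \<open>s < 1\<close> by simp
        then show ?thesis
          unfolding scaleR_add_right v(2) w'(2) linear_scale[OF J(1)] scaleR_scaleR
          by (simp add: algebra_simps)
      qed
      ultimately show ?thesis by simp
    qed
    have shadow: "Q (x - m) \<notin> interior A" if x: "x \<in> frontier K" "\<bar>(x - m) \<bullet> e\<bar> < T" for x
    proof
      assume in_A: "Q (x - m) \<in> interior A"
      define U where "U = (\<lambda>x. Q (x - m)) -` interior A \<inter> (\<lambda>x. \<bar>(x - m) \<bullet> e\<bar>) -` {..<T}"
      have "open U" unfolding U_def
        by (intro open_Int open_vimage continuous_intros continuous_on_compose2[OF contQ[of UNIV]]) auto
      moreover have "U \<subseteq> K"
      proof
        fix y assume "y \<in> U"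
        then have "m + J (Q (y - m)) + ((y - m) \<bullet> e) *\<^sub>R e \<in> K"
          using interior_subset by (intro cyl) (auto simp: U_def)
        then show "y \<in> K" using J(5)[of "y - m"] by (simp add: add.assoc)
      qed
      moreover have "x \<in> U" using in_A x by (simp add: U_def)
      ultimately have "x \<in> interior K" using interior_maximal by blast
      then show False using x by (simp add: frontier_def)
    qed
    have front: "m + J w \<in> frontier K" if "w \<in> frontier C" for w
      using that intC[of w] frontier_subset_closed[of C] C(1) closure_subset[of K]
      by (auto simp: C_def frontier_def compact_imp_closed)
    obtain u w l where uw: "u \<in> frontier A" "w \<in> frontier A" "0 < l" "\<tau> * dist u w \<le> l"
      "ennreal l \<le> intrinsic_dist (frontier A) u w"
      "\<And>x y. x \<in> frontier A \<Longrightarrow> y \<in> frontier A \<Longrightarrow> dist x y \<le> 2 * l"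
      using convex_curve_far_pair[OF A \<tau>(2,3)] by metis
    have size: "norm x \<le> 2 * l" if x: "x \<in> frontier A" for x
    proof (cases "0 \<in> interior A \<and> x \<noteq> 0")
      case True
      then have "0 \<in> interior A" "- x \<noteq> 0" by auto
      from ray_to_frontier[OF compact_imp_bounded[OF A(1)] this]
      obtain d where d: "0 < d" "0 + d *\<^sub>R (- x) \<in> frontier A" by metis
      have "x - (0 + d *\<^sub>R (- x)) = (1 + d) *\<^sub>R x" by (simp add: algebra_simps)
      then have "(1 + d) * norm x \<le> 2 * l"
        using uw(6)[OF x d(2)] d(1) by (simp add: dist_norm)
      moreover have "0 \<le> d * norm x" using d(1) by simp
      ultimately show ?thesis by (simp add: algebra_simps)
    next
      case False
      then show ?thesis
        using uw(3) uw(6)[OF x, of 0] \<open>0 \<in> A\<close> closure_subset[of A] by (auto simp: frontier_def)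
    qed
    have \<kappa>: "1 \<le> 1 / \<theta>" "1 / \<theta> - 1 \<le> 16 * \<epsilon>"
      using \<theta> \<epsilon> by (auto simp: \<theta>_def field_simps)
    obtain x where x: "x \<in> frontier C" "closest_point A x = u" "dist x u \<le> (1 / \<theta> - 1) * norm u"
      using ray_from_frontier_normal[OF compact_imp_closed[OF A(1)] A(2,3) C(1) AC CA \<kappa>(1) uw(1)] .
    obtain y where y: "y \<in> frontier C" "closest_point A y = w" "dist y w \<le> (1 / \<theta> - 1) * norm w"
      using ray_from_frontier_normal[OF compact_imp_closed[OF A(1)] A(2,3) C(1) AC CA \<kappa>(1) uw(2)] .
    have lift: "(1 / \<theta> - 1) * norm v \<le> 32 * \<epsilon> * l" if "v \<in> frontier A" for v
      using mult_mono[OF \<kappa>(2) size[OF that]] \<epsilon> by simp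
    have "dist u w \<le> l / \<tau>" using uw(4) \<tau>(2) by (simp add: pos_le_divide_eq mult.commute)
    have "dist x y \<le> dist x u + dist u w + dist y w"
      using dist_triangle[of x y u] dist_triangle[of u y w] by (simp add: dist_commute)
    also have "\<dots> \<le> 32 * \<epsilon> * l + l / \<tau> + 32 * \<epsilon> * l"
      using x(3) y(3) lift[OF uw(1)] lift[OF uw(2)] \<open>dist u w \<le> l / \<tau>\<close> by linarith
    also have "\<dots> = (1 / \<tau> + 64 * \<epsilon>) * l" by (simp add: algebra_simps)
    finally have "q * dist x y \<le> q * ((1 / \<tau> + 64 * \<epsilon>) * l)" using q by simp
    also have "\<dots> = (q * (1 / \<tau> + 64 * \<epsilon>)) * l" by simp
    also have "\<dots> < 1 * l" using \<epsilon>q uw(3) by (intro mult_strict_right_mono)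
    finally have chord1: "q * dist x y < l" by simp
    have xyr: "dist x y \<le> 2 * r"
      using Cr[of x] Cr[of y] x(1) y(1) frontier_subset_closed[of C] C(1) norm_triangle_ineq4[of x y]
      by (fastforce simp: dist_norm r_def compact_imp_closed)
    have "q < 2" using q pi_less_4 by linarith
    have chord2: "q * dist x y < T"
    proof (cases "dist x y = 0")
      case False
      then have "q * dist x y < 2 * dist x y" using \<open>q < 2\<close> by (intro mult_strict_right_mono) (auto simp: less_le)
      then show ?thesis using xyr by (simp add: T_def)
    qed (use r in \<open>simp add: T_def\<close>)
    have chord: "q * dist x y < min T l" using chord1 chord2 by simp
    have "ennreal (min T l) \<le> intrinsic_dist (frontier K) (m + J x) (m + J y)"
      unfolding intrinsic_dist_def[of "frontier K"]
    proof (rule INF_greatest)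
      fix g assume "g \<in> {g. path g \<and> path_image g \<subseteq> frontier K \<and> pathstart g = m + J x \<and> pathfinish g = m + J y}"
      then have g: "path g" "path_image g \<subseteq> frontier K" "g 0 = m + J x" "g 1 = m + J y"
        by (auto simp: pathstart_def pathfinish_def)
      show "ennreal (min T l) \<le> path_length g"
      proof (cases "\<exists>s\<in>{0..1}. T \<le> \<bar>(g s - m) \<bullet> e\<bar>")
        case True
        then obtain s where s: "s \<in> {0..1}" "T \<le> \<bar>(g s - m) \<bullet> e\<bar>" by blast
        have "(g s - m) \<bullet> e = (g s - g 0) \<bullet> e"
          using Je[of x] by (simp add: g(3) inner_diff_left inner_add_left)
        then have "T \<le> dist (g s) (g 0)"
          using s(2) Cauchy_Schwarz_ineq2[of "g s - g 0" e] e1 by (simp add: dist_norm)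
        then have "ennreal (min T l) \<le> ennreal (dist (g s) (g 0))" by (intro ennreal_leI) simp
        also have "\<dots> \<le> path_length g" using s by (intro path_length_ge_dist) auto
        finally show ?thesis .
      next
        case False
        define \<sigma> where "\<sigma> s = Q (g s - m)" for s
        have \<sigma>_in: "\<sigma> s \<in> - interior A" if "s \<in> {0..1}" for s
        proof -
          have "g s \<in> frontier K" using g(2) that by (auto simp: path_image_def)
          then show ?thesis using shadow[of "g s"] that False by (auto simp: \<sigma>_def not_le)
        qed
        have "path \<sigma>"
          using g(1) unfolding path_def \<sigma>_def
          by (intro continuous_on_compose2[OF contQ[of UNIV]] continuous_intros) auto
        have "ennreal l \<le> intrinsic_dist (frontier A) u w" by (fact uw(5))
        also have "\<dots> \<le> intrinsic_dist (- interior A) x y"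
          using intrinsic_dist_closest_point_le[of A x y] A(2) compact_imp_closed[OF A(1)] \<open>0 \<in> A\<close>
          unfolding x(2) y(2) by blast
        also have "\<dots> \<le> path_length \<sigma>"
          unfolding intrinsic_dist_def using \<sigma>_in \<open>path \<sigma>\<close> g(3,4)
          by (intro INF_lower) (auto simp: path_image_def pathstart_def pathfinish_def \<sigma>_def QJ)
        also have "\<dots> \<le> ennreal 1 * path_length g"
        proof (rule path_length_le_scaled)
          fix s t
          have "\<sigma> s - \<sigma> t = Q (g s - g t)"
            by (simp add: \<sigma>_def linear_diff[OF J(2), symmetric])
          then show "dist (\<sigma> s) (\<sigma> t) \<le> 1 * dist (g s) (g t)" using nQ by (simp add: dist_norm)
        qed
        finally have "ennreal l \<le> path_length g" by simp
        then show ?thesis by (rule order_trans[rotated]) (intro ennreal_leI, simp)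
      qed
    qed
    moreover have "dist (m + J x) (m + J y) = dist x y"
      using nJ[of "x - y"] by (simp add: dist_norm linear_diff[OF J(1)])
    ultimately have "ennreal (min T l) \<le> distortion (frontier K) * ennreal (dist x y)"
      using intrinsic_dist_le_distortion[OF front[OF x(1)] front[OF y(1)]] by simp
    show "ennreal q < distortion (frontier K)"
    proof (rule ccontr)
      assume "\<not> ?thesis"
      then have "distortion (frontier K) * ennreal (dist x y) \<le> ennreal q * ennreal (dist x y)"
        by (intro mult_right_mono) auto
      also have "\<dots> = ennreal (q * dist x y)" using q by (simp add: ennreal_mult)
      also have "\<dots> < ennreal (min T l)" using chord r uw(3) by (intro ennreal_lessI) (auto simp: T_def)
      finally show False
        using \<open>ennreal (min T l) \<le> distortion (frontier K) * ennreal (dist x y)\<close> by simp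
    qed
  qed
qed

section \<open>Flat bodies\<close>

lemma complex_coordinates_aligned:
  fixes e v :: "real ^ 3"
  assumes "norm e = 1" "v \<bullet> e = 0"
  obtains J :: "complex \<Rightarrow> real ^ 3" and Q :: "real ^ 3 \<Rightarrow> complex"
  where "linear J" "linear Q" "\<And>(w::complex) (z::real). Q (J w + z *\<^sub>R e) = w"
    "\<And>(w::complex) (z::real). (J w + z *\<^sub>R e) \<bullet> e = z"
    "\<And>x. J (Q x) + (x \<bullet> e) *\<^sub>R e = x"
    "\<And>(w::complex) (z::real). (norm (J w + z *\<^sub>R e))\<^sup>2 = (norm w)\<^sup>2 + z\<^sup>2"
    "J (of_real (norm v)) = v"
proof -
  obtain J :: "complex \<Rightarrow> real ^ 3" and Q where J: "linear J" "linear Q" "\<And>(w::complex) (z::real). Q (J w + z *\<^sub>R e) = w"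
    "\<And>(w::complex) (z::real). (J w + z *\<^sub>R e) \<bullet> e = z" "\<And>x. J (Q x) + (x \<bullet> e) *\<^sub>R e = x"
    "\<And>(w::complex) (z::real). (norm (J w + z *\<^sub>R e))\<^sup>2 = (cmod w)\<^sup>2 + z\<^sup>2"
    using complex_coordinates_orthogonal_to[OF assms(1)] by metis
  define \<omega> where "\<omega> = (if Q v = 0 then 1 else sgn (Q v))"
  have "norm \<omega> = 1" by (simp add: \<omega>_def norm_sgn)
  then have \<omega>: "norm \<omega> = 1" "\<omega> * cnj \<omega> = 1" "cnj \<omega> * \<omega> = 1"
    using complex_norm_square[of \<omega>] by (simp_all add: mult.commute)
  have Jv: "J (Q v) = v" using J(5)[of v] assms(2) by simp
  have "norm v = norm (Q v)"
    using J(6)[of "Q v" 0] Jv by (simp add: power2_eq_iff_nonneg)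
  then have Qv: "\<omega> * of_real (norm v) = Q v" by (simp add: \<omega>_def sgn_eq)
  show thesis
  proof (rule that[of "\<lambda>w. J (\<omega> * w)" "\<lambda>x. cnj \<omega> * Q x"])
    show "linear (\<lambda>w. J (\<omega> * w))"
      by (rule linearI) (simp_all add: linear_add[OF J(1)] linear_scale[OF J(1), symmetric] distrib_left)
    show "linear (\<lambda>x. cnj \<omega> * Q x)"
      by (rule linearI) (simp_all add: linear_add[OF J(2)] linear_scale[OF J(2)] distrib_left)
    show "cnj \<omega> * Q (J (\<omega> * w) + z *\<^sub>R e) = w" for w z
      using \<omega>(3) by (simp add: J(3) mult.assoc[symmetric])
    show "(J (\<omega> * w) + z *\<^sub>R e) \<bullet> e = z" for w z by (rule J(4))
    show "J (\<omega> * (cnj \<omega> * Q x)) + (x \<bullet> e) *\<^sub>R e = x" for x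
      using \<omega>(2) J(5)[of x] by (simp add: mult.assoc[symmetric])
    show "(norm (J (\<omega> * w) + z *\<^sub>R e))\<^sup>2 = (norm w)\<^sup>2 + z\<^sup>2" for w z
      using J(6)[of "\<omega> * w" z] \<omega>(1) by (simp add: norm_mult)
    show "J (\<omega> * of_real (norm v)) = v" by (simp add: Qv Jv)
  qed
qed

text \<open>
  The triangle \<open>a b x\<close> contains a disc of radius proportional to its height, and shrinking it by the
  factor \<open>1 / 2\<close> towards an interior point of \<open>K\<close> moves it into the interior. The double
  cone over this disc whose tips are the surface points above and below the centre lies in
  \<open>K\<close>. Since \<open>K\<close> contains no large ball, both tips are near the centre. A path on the
  surface from one tip to the other meets the plane of the disc, and it does so outside the disc.
\<close>

lemma flat_body_distortion:
  fixes K :: "(real ^ 3) set"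
  assumes K: "convex_body K" and abx: "a \<in> K" "b \<in> K" "x \<in> K" "a \<noteq> b"
    and orth: "(x - midpoint a b) \<bullet> (b - a) = 0"
    and h: "0 < dist x (midpoint a b)" "dist x (midpoint a b) \<le> dist a b"
    and flat: "\<And>c r. cball c r \<subseteq> K \<Longrightarrow> 300 * r \<le> dist x (midpoint a b)"
    and q: "0 < q" "q < 2"
  shows "ennreal q < distortion (frontier K)"
proof -
  have cK: "compact K" "convex K" "interior K \<noteq> {}" "closed K" "bounded K"
    using K by (auto simp: convex_body_def compact_imp_closed compact_imp_bounded)
  define L where "L = dist a b"
  define m where "m = midpoint a b"
  define h where "h = dist x m"
  have hL: "0 < h" "h \<le> L" "0 < L" using h abx by (auto simp: h_def L_def m_def)
  define e where "e = (b - a) /\<^sub>R L"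
  have e1: "norm e = 1" using hL by (simp add: e_def L_def dist_norm norm_minus_commute)
  have "(x - m) \<bullet> e = 0" using orth by (simp add: e_def m_def)
  then obtain J :: "complex \<Rightarrow> real ^ 3" and Q where J: "linear J" "linear Q"
    "\<And>(w::complex) (z::real). Q (J w + z *\<^sub>R e) = w"
    "\<And>(w::complex) (z::real). (J w + z *\<^sub>R e) \<bullet> e = z" "\<And>x. J (Q x) + (x \<bullet> e) *\<^sub>R e = x"
    "\<And>(w::complex) (z::real). (norm (J w + z *\<^sub>R e))\<^sup>2 = (cmod w)\<^sup>2 + z\<^sup>2"
    "J (of_real (norm (x - m))) = x - m"
    using complex_coordinates_aligned[OF e1, of "x - m"] by metis
  \<comment> \<open>Cartesian coordinates: the triangle lies in \<open>\<gamma> = 0\<close>, with \<open>x\<close> on the \<open>\<alpha>\<close>-axis and \<open>a\<close>,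
    \<open>b\<close> on the \<open>\<beta>\<close>-axis.\<close>
  define X where "X \<alpha> \<beta> \<gamma> = J (Complex \<alpha> \<gamma>) + \<beta> *\<^sub>R e" for \<alpha> \<beta> \<gamma>
  have Xadd: "X \<alpha> \<beta> \<gamma> + X \<alpha>' \<beta>' \<gamma>' = X (\<alpha> + \<alpha>') (\<beta> + \<beta>') (\<gamma> + \<gamma>')" for \<alpha> \<beta> \<gamma> \<alpha>' \<beta>' \<gamma>'
  proof -
    have "Complex (\<alpha> + \<alpha>') (\<gamma> + \<gamma>') = Complex \<alpha> \<gamma> + Complex \<alpha>' \<gamma>'"
      by (simp add: complex_eq_iff)
    then show ?thesis by (simp only: X_def linear_add[OF J(1)] scaleR_add_left) simp
  qed
  have Xscale: "s *\<^sub>R X \<alpha> \<beta> \<gamma> = X (s * \<alpha>) (s * \<beta>) (s * \<gamma>)" for s \<alpha> \<beta> \<gamma>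
  proof -
    have "Complex (s * \<alpha>) (s * \<gamma>) = s *\<^sub>R Complex \<alpha> \<gamma>" by (simp add: complex_eq_iff)
    then show ?thesis by (simp only: X_def linear_scale[OF J(1)] scaleR_add_right scaleR_scaleR)
  qed
  have Xnorm: "(norm (X \<alpha> \<beta> \<gamma>))\<^sup>2 = \<alpha>\<^sup>2 + \<beta>\<^sup>2 + \<gamma>\<^sup>2" for \<alpha> \<beta> \<gamma>
    by (simp add: X_def J(6) cmod_power2)
  have Xcoord: "y = X (Re (Q y)) (y \<bullet> e) (Im (Q y))" for y
    using J(5)[of y] by (simp add: X_def)
  have Xx: "x = m + X h 0 0"
    using J(7) by (simp add: X_def h_def dist_norm Complex_eq)
  have Xe: "X 0 (s * (L / 2)) 0 = (s / 2) *\<^sub>R (b - a)" for s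
    using hL linear_0[OF J(1)] by (simp add: X_def e_def Complex_eq)
  have disc: "m + X \<alpha> \<beta> 0 \<in> K" if "(\<alpha> - h / 3)\<^sup>2 + \<beta>\<^sup>2 \<le> (h / 5)\<^sup>2" for \<alpha> \<beta>
  proof -
    define s where "s = \<alpha> / h"
    define t where "t = \<beta> / (L / 2)"
    have "(\<alpha> - h / 3)\<^sup>2 \<le> (h / 5)\<^sup>2" "\<beta>\<^sup>2 \<le> (h / 5)\<^sup>2"
      using that zero_le_power2[of "\<alpha> - h / 3"] zero_le_power2[of \<beta>] by linarith+
    then have "\<bar>\<alpha> - h / 3\<bar> \<le> h / 5" "\<bar>\<beta>\<bar> \<le> h / 5"
      using hL by (simp_all add: abs_le_square_iff[symmetric])
    then have "0 \<le> \<alpha>" "15 * \<alpha> \<le> 8 * h" "5 * \<bar>\<beta>\<bar> \<le> L" using hL by linarith+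
    then have s: "0 \<le> s" "s \<le> 8/15" and t: "\<bar>t\<bar> \<le> 2/5"
      using hL by (auto simp: s_def t_def field_simps)
    have "s *\<^sub>R x + (((1 - s + t) / 2) *\<^sub>R b + ((1 - s - t) / 2) *\<^sub>R a) \<in> K"
    proof -
      define r where "r = t / (1 - s)"
      have "\<bar>t\<bar> \<le> 1 - s" using s t by linarith
      then have "\<bar>r\<bar> \<le> 1" using s by (simp add: r_def abs_divide)
      then have zK: "((1 + r) / 2) *\<^sub>R b + ((1 - r) / 2) *\<^sub>R a \<in> K"
        by (intro convexD[OF cK(2)] abx) (auto simp: abs_le_iff field_simps)
      have "s *\<^sub>R x + (1 - s) *\<^sub>R (((1 + r) / 2) *\<^sub>R b + ((1 - r) / 2) *\<^sub>R a) \<in> K"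
        by (rule convexD[OF cK(2) abx(3) zK]) (use s in auto)
      moreover have "(1 - s) * ((1 + r) / 2) = (1 - s + t) / 2" "(1 - s) * ((1 - r) / 2) = (1 - s - t) / 2"
        using s by (auto simp: r_def field_simps)
      ultimately show ?thesis by (simp only: scaleR_add_right scaleR_scaleR)
    qed
    also have "s *\<^sub>R x + (((1 - s + t) / 2) *\<^sub>R b + ((1 - s - t) / 2) *\<^sub>R a)
        = m + s *\<^sub>R (x - m) + (t / 2) *\<^sub>R (b - a)"
      by (simp add: m_def midpoint_def vec_eq_iff field_simps)
    also have "s *\<^sub>R (x - m) = X \<alpha> 0 0" using hL by (simp add: Xx Xscale s_def)
    also have "(t / 2) *\<^sub>R (b - a) = X 0 \<beta> 0" using hL Xe[of t] by (simp add: t_def)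
    also have "m + X \<alpha> 0 0 + X 0 \<beta> 0 = m + X \<alpha> \<beta> 0" by (simp add: add.assoc Xadd)
    finally show ?thesis .
  qed
  obtain y1 where y1: "y1 \<in> interior K" using cK by blast
  define c where "c = (1/2) *\<^sub>R (m + X (h / 3) 0 0) + (1/2) *\<^sub>R y1"
  define \<rho> where "\<rho> = h / 10"
  have \<rho>: "0 < \<rho>" using hL by (simp add: \<rho>_def)
  have half: "z - (1/2) *\<^sub>R (z - y) = (1/2) *\<^sub>R z + (1/2) *\<^sub>R y" for z y :: "real ^ 3"
    by (simp add: vec_eq_iff field_simps)
  have inner_disc: "c + X \<alpha> \<beta> 0 \<in> interior K" if "\<alpha>\<^sup>2 + \<beta>\<^sup>2 \<le> \<rho>\<^sup>2" for \<alpha> \<beta>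
  proof -
    have "m + X (h / 3 + 2 * \<alpha>) (2 * \<beta>) 0 \<in> K"
      using that by (intro disc) (simp add: \<rho>_def power2_eq_square algebra_simps)
    from mem_interior_convex_shrink[OF cK(2) y1 this, of "1/2"]
    have "(m + X (h / 3 + 2 * \<alpha>) (2 * \<beta>) 0) - (1/2) *\<^sub>R ((m + X (h / 3 + 2 * \<alpha>) (2 * \<beta>) 0) - y1)
        \<in> interior K" by simp
    also have "(m + X (h / 3 + 2 * \<alpha>) (2 * \<beta>) 0) - (1/2) *\<^sub>R ((m + X (h / 3 + 2 * \<alpha>) (2 * \<beta>) 0) - y1)
        = (1/2) *\<^sub>R (m + X (h / 3 + 2 * \<alpha>) (2 * \<beta>) 0) + (1/2) *\<^sub>R y1"
      using half[of "m + X (h / 3 + 2 * \<alpha>) (2 * \<beta>) 0" y1] .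
    also have "X (h / 3 + 2 * \<alpha>) (2 * \<beta>) 0 = X (h / 3) 0 0 + 2 *\<^sub>R X \<alpha> \<beta> 0"
      by (simp add: Xscale Xadd)
    also have "(1/2) *\<^sub>R (m + (X (h / 3) 0 0 + 2 *\<^sub>R X \<alpha> \<beta> 0)) + (1/2) *\<^sub>R y1 = c + X \<alpha> \<beta> 0"
      unfolding c_def scaleR_add_right scaleR_scaleR by simp
    finally show ?thesis .
  qed
  have X0: "X 0 0 0 = 0" using Xscale[of 0 0 0 0] by simp
  have c_int: "c \<in> interior K" using inner_disc[of 0 0] \<rho> by (simp add: X0)
  have pole: "\<exists>s>0. 75 * s \<le> h \<and> c + X 0 0 (\<sigma> * s) \<in> frontier K" if \<sigma>: "\<bar>\<sigma>\<bar> = 1" for \<sigma>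
  proof -
    have "(norm (X 0 0 \<sigma>))\<^sup>2 = 1" using \<sigma> Xnorm[of 0 0 \<sigma>] by (simp add: power2_eq_1_iff abs_eq_iff')
    then have "X 0 0 \<sigma> \<noteq> 0" by auto
    from ray_to_frontier[OF cK(5) c_int this]
    obtain s where s: "0 < s" "c + s *\<^sub>R X 0 0 \<sigma> \<in> frontier K" by metis
    then have pK: "c + X 0 0 (\<sigma> * s) \<in> K"
      using frontier_subset_closed[OF cK(4)] by (auto simp: Xscale mult.commute)
    \<comment> \<open>A ball half-way between the disc and the tip, of size limited by the cone over the disc.\<close>
    have "cball (c + X 0 0 (\<sigma> * (s / 2))) (min s \<rho> / 4) \<subseteq> K"
    proof
      fix y assume "y \<in> cball (c + X 0 0 (\<sigma> * (s / 2))) (min s \<rho> / 4)"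
      then have y: "norm (y - c - X 0 0 (\<sigma> * (s / 2))) \<le> min s \<rho> / 4"
        by (simp add: dist_norm norm_minus_commute algebra_simps)
      define \<alpha> where "\<alpha> = Re (Q (y - c))"
      define \<beta> where "\<beta> = (y - c) \<bullet> e"
      define \<gamma> where "\<gamma> = Im (Q (y - c))"
      have yX: "y = c + X \<alpha> \<beta> \<gamma>" using Xcoord[of "y - c"] by (simp add: \<alpha>_def \<beta>_def \<gamma>_def algebra_simps)
      have "y - c - X 0 0 (\<sigma> * (s / 2)) = X \<alpha> \<beta> \<gamma> + (-1) *\<^sub>R X 0 0 (\<sigma> * (s / 2))" by (simp add: yX)
      also have "\<dots> = X \<alpha> \<beta> (\<gamma> - \<sigma> * (s / 2))" unfolding Xscale Xadd by simp
      finally have "\<alpha>\<^sup>2 + \<beta>\<^sup>2 + (\<gamma> - \<sigma> * (s / 2))\<^sup>2 = (norm (y - c - X 0 0 (\<sigma> * (s / 2))))\<^sup>2"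
        by (simp add: Xnorm)
      also have "\<dots> \<le> (min s \<rho> / 4)\<^sup>2" using y by (intro power_mono) auto
      finally have sq: "\<alpha>\<^sup>2 + \<beta>\<^sup>2 + (\<gamma> - \<sigma> * (s / 2))\<^sup>2 \<le> (min s \<rho> / 4)\<^sup>2" .
      have "(min s \<rho> / 4)\<^sup>2 \<le> (\<rho> / 4)\<^sup>2" "(min s \<rho> / 4)\<^sup>2 \<le> (s / 4)\<^sup>2"
        using s \<rho> by (auto intro!: power_mono)
      then have \<alpha>\<beta>: "\<alpha>\<^sup>2 + \<beta>\<^sup>2 \<le> (\<rho> / 4)\<^sup>2" and "(\<gamma> - \<sigma> * (s / 2))\<^sup>2 \<le> (s / 4)\<^sup>2"
        using sq zero_le_power2[of \<alpha>] zero_le_power2[of \<beta>] zero_le_power2[of "\<gamma> - \<sigma> * (s / 2)"]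
        by linarith+
      then have "\<bar>\<gamma> - \<sigma> * (s / 2)\<bar> \<le> s / 4"
        using s by (simp add: abs_le_square_iff[symmetric])
      define t where "t = \<sigma> * \<gamma> / s"
      have \<sigma>2: "\<sigma> = 1 \<or> \<sigma> = -1" using \<sigma> by linarith
      have t: "1/4 \<le> t" "t \<le> 3/4"
      proof -
        have "s / 4 \<le> \<sigma> * \<gamma> \<and> \<sigma> * \<gamma> \<le> 3 * s / 4"
          using \<sigma>2
        proof
          assume "\<sigma> = 1"
          with \<open>\<bar>\<gamma> - \<sigma> * (s / 2)\<bar> \<le> s / 4\<close> have "\<bar>\<gamma> - s / 2\<bar> \<le> s / 4" by simp
          then show ?thesis unfolding \<open>\<sigma> = 1\<close> by linarith
        next
          assume "\<sigma> = -1"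
          with \<open>\<bar>\<gamma> - \<sigma> * (s / 2)\<bar> \<le> s / 4\<close> have "\<bar>\<gamma> + s / 2\<bar> \<le> s / 4" by simp
          then show ?thesis unfolding \<open>\<sigma> = -1\<close> by linarith
        qed
        then show "1/4 \<le> t" "t \<le> 3/4" using s by (auto simp: t_def field_simps)
      qed
      have "(\<alpha> / (1 - t))\<^sup>2 + (\<beta> / (1 - t))\<^sup>2 = (\<alpha>\<^sup>2 + \<beta>\<^sup>2) / (1 - t)\<^sup>2"
        by (simp add: power_divide add_divide_distrib)
      also have "\<dots> \<le> (\<rho> / 4)\<^sup>2 / (1/4)\<^sup>2"
        using \<alpha>\<beta> t by (intro frac_le power_mono) auto
      also have "\<dots> = \<rho>\<^sup>2" by (simp add: power2_eq_square)
      finally have "c + X (\<alpha> / (1 - t)) (\<beta> / (1 - t)) 0 \<in> K"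
        using inner_disc interior_subset by blast
      then have "(1 - t) *\<^sub>R (c + X (\<alpha> / (1 - t)) (\<beta> / (1 - t)) 0) + t *\<^sub>R (c + X 0 0 (\<sigma> * s)) \<in> K"
        using t pK by (intro convexD[OF cK(2)]) auto
      also have "(1 - t) *\<^sub>R (c + X (\<alpha> / (1 - t)) (\<beta> / (1 - t)) 0) + t *\<^sub>R (c + X 0 0 (\<sigma> * s))
          = c + ((1 - t) *\<^sub>R X (\<alpha> / (1 - t)) (\<beta> / (1 - t)) 0 + t *\<^sub>R X 0 0 (\<sigma> * s))"
        by (simp add: algebra_simps)
      also have "t * (\<sigma> * s) = \<gamma>" using \<sigma>2 s by (auto simp: t_def)
      then have "(1 - t) *\<^sub>R X (\<alpha> / (1 - t)) (\<beta> / (1 - t)) 0 + t *\<^sub>R X 0 0 (\<sigma> * s) = X \<alpha> \<beta> \<gamma>"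
        unfolding Xscale Xadd using t by simp
      finally show "y \<in> K" by (simp add: yX)
    qed
    from flat[OF this] have "300 * (min s \<rho> / 4) \<le> h" by (simp add: h_def m_def)
    then have "75 * s \<le> h" using \<rho> by (auto simp: \<rho>_def min_def split: if_splits)
    then show ?thesis using s by (intro exI[of _ s]) (simp add: Xscale mult.commute)
  qed
  obtain s where s: "0 < s" "75 * s \<le> h" "c + X 0 0 s \<in> frontier K" using pole[of 1] by auto
  obtain t where t: "0 < t" "75 * t \<le> h" "c + X 0 0 (- t) \<in> frontier K" using pole[of "-1"] by auto
  have nX: "norm (X 0 0 \<gamma>) = \<bar>\<gamma>\<bar>" for \<gamma>
    using Xnorm[of 0 0 \<gamma>] by (simp add: power2_eq_iff_nonneg[of _ "\<bar>\<gamma>\<bar>", simplified])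
  have "(c + X 0 0 s) - (c + X 0 0 (- t)) = X 0 0 s + (-1) *\<^sub>R X 0 0 (- t)" by simp
  also have "\<dots> = X 0 0 (s + t)" unfolding Xscale Xadd by simp
  finally have chord: "dist (c + X 0 0 s) (c + X 0 0 (- t)) = s + t"
    using s t by (simp add: dist_norm nX)
  have QX: "Im (Q (X \<alpha> \<beta> \<gamma>)) = \<gamma>" for \<alpha> \<beta> \<gamma> by (simp add: X_def J(3))
  have "ennreal (\<rho> - s) \<le> intrinsic_dist (frontier K) (c + X 0 0 s) (c + X 0 0 (- t))"
    unfolding intrinsic_dist_def
  proof (rule INF_greatest)
    fix g assume "g \<in> {g. path g \<and> path_image g \<subseteq> frontier K \<and> pathstart g = c + X 0 0 s
                       \<and> pathfinish g = c + X 0 0 (- t)}"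
    then have g: "path g" "path_image g \<subseteq> frontier K" "g 0 = c + X 0 0 s" "g 1 = c + X 0 0 (- t)"
      by (auto simp: pathstart_def pathfinish_def)
    have "continuous_on UNIV Q" using J(2) by (simp add: linear_continuous_on linear_conv_bounded_linear)
    then have "continuous_on {0..1} (\<lambda>u. Im (Q (g u - c)))"
      using g(1) unfolding path_def
      by (intro continuous_on_Im continuous_on_compose2[OF \<open>continuous_on UNIV Q\<close>]
            continuous_on_diff continuous_on_const) auto
    then obtain u where u: "u \<in> {0..1}" "Im (Q (g u - c)) = 0"
      using IVT2'[of "\<lambda>u. Im (Q (g u - c))" 1 0 0] g(3,4) s t by (auto simp: QX)
    have "g u \<in> frontier K" using g(2) u by (auto simp: path_image_def)
    then have "g u \<notin> interior K" by (simp add: frontier_def)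
    moreover have gu: "g u - c = X (Re (Q (g u - c))) ((g u - c) \<bullet> e) 0"
      using Xcoord[of "g u - c"] u(2) by simp
    ultimately have "\<not> (Re (Q (g u - c)))\<^sup>2 + ((g u - c) \<bullet> e)\<^sup>2 \<le> \<rho>\<^sup>2"
      using inner_disc by (metis add.commute diff_add_cancel)
    then have "\<rho>\<^sup>2 < (norm (g u - c))\<^sup>2"
      using Xnorm[of "Re (Q (g u - c))" "(g u - c) \<bullet> e" 0] gu by simp
    then have "\<rho> < norm (g u - c)" by (rule power2_less_imp_less) simp
    moreover have "norm (g u - c) \<le> dist (g 0) (g u) + s"
      using norm_triangle_ineq[of "g u - g 0" "g 0 - c"] s nX[of s]
      by (simp add: g(3) dist_norm norm_minus_commute)
    ultimately have "ennreal (\<rho> - s) \<le> ennreal (dist (g 0) (g u))" by (intro ennreal_leI) simp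
    also have "\<dots> \<le> path_length g" using u by (intro path_length_ge_dist) auto
    finally show "ennreal (\<rho> - s) \<le> path_length g" .
  qed
  also have "\<dots> \<le> distortion (frontier K) * ennreal (s + t)"
    using intrinsic_dist_le_distortion[OF s(3) t(3)] unfolding chord .
  finally have lower: "ennreal (\<rho> - s) \<le> distortion (frontier K) * ennreal (s + t)" .
  have "q * (s + t) < 2 * (s + t)" using q s t by (intro mult_strict_right_mono) auto
  then have less: "q * (s + t) < \<rho> - s" using s(2) t(2) hL by (simp add: \<rho>_def)
  show ?thesis
  proof (rule ccontr)
    assume "\<not> ?thesis"
    then have "distortion (frontier K) * ennreal (s + t) \<le> ennreal q * ennreal (s + t)"
      by (intro mult_right_mono) auto
    also have "\<dots> = ennreal (q * (s + t))" using q s t by (simp add: ennreal_mult)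
    also have "\<dots> < ennreal (\<rho> - s)"
      using less s(2) hL by (intro ennreal_lessI) (auto simp: \<rho>_def)
    finally show False using lower by simp
  qed
qed

section \<open>A cone of distortion less than \<open>\<pi> / 2\<close>\<close>

text \<open>
  At a point with \<open>f x = 0\<close>, moving away from \<open>x0\<close> makes \<open>f\<close> positive, by
  convexity.
\<close>

lemma frontier_sublevel_convex:
  fixes f :: "'a::euclidean_space \<Rightarrow> real"
  assumes cont: "continuous_on UNIV f"
    and conv: "\<And>x y t. 0 \<le> t \<Longrightarrow> t \<le> 1 \<Longrightarrow> f ((1 - t) *\<^sub>R x + t *\<^sub>R y) \<le> (1 - t) * f x + t * f y"
    and x0: "f x0 < 0"
  shows "frontier {x. f x \<le> 0} = {x. f x = 0}"
proof -
  have cl: "closed {x. f x \<le> 0}" using cont by (intro closed_Collect_le continuous_intros)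
  have int: "interior {x. f x \<le> 0} = {x. f x < 0}"
  proof (intro antisym subsetI)
    fix x assume x: "x \<in> interior {x. f x \<le> 0}"
    then obtain r where r: "0 < r" "cball x r \<subseteq> {x. f x \<le> 0}"
      by (meson mem_interior_cball)
    show "x \<in> {x. f x < 0}"
    proof (cases "x = x0")
      case False
      define s where "s = r / norm (x - x0)"
      have s: "0 < s" using r False by (simp add: s_def)
      define y where "y = x + s *\<^sub>R (x - x0)"
      have "dist x y = r" using r False by (simp add: y_def s_def dist_norm)
      then have "f y \<le> 0" using r(2) by (auto simp: subset_iff)
      define t where "t = s / (1 + s)"
      have t: "0 < t" "t < 1" using s by (auto simp: t_def)
      have "(1 - t) * (1 + s) = 1" "(1 - t) * s = t" using s by (auto simp: t_def field_simps)
      moreover have "(1 - t) *\<^sub>R y + t *\<^sub>R x0 = ((1 - t) * (1 + s)) *\<^sub>R x + (t - (1 - t) * s) *\<^sub>R x0"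
        by (simp add: y_def algebra_simps)
      ultimately have "(1 - t) *\<^sub>R y + t *\<^sub>R x0 = x" by simp
      then have "f x \<le> (1 - t) * f y + t * f x0" using conv[of t y x0] t by simp
      also have "\<dots> < 0"
      proof -
        have "(1 - t) * f y \<le> 0" "t * f x0 < 0"
          using t x0 \<open>f y \<le> 0\<close> by (auto simp: mult_le_0_iff mult_pos_neg)
        then show ?thesis by linarith
      qed
      finally show ?thesis by simp
    qed (use x0 in simp)
  next
    fix x assume "x \<in> {x. f x < 0}"
    moreover have "open {x. f x < 0}" using cont by (intro open_Collect_less continuous_intros)
    ultimately show "x \<in> interior {x. f x \<le> 0}"
      using interior_maximal[of "{x. f x < 0}" "{x. f x \<le> 0}"] less_imp_le by blast
  qed
  show ?thesis unfolding frontier_def int using cl by (auto simp: closure_closed)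
qed

lemma intrinsic_dist_two_segments:
  fixes p m q :: "'a::real_normed_vector"
  assumes pm: "closed_segment p m \<subseteq> S" and mq: "closed_segment m q \<subseteq> S"
  shows "intrinsic_dist S p q \<le> ennreal (dist p m + dist m q)"
proof -
  define t where "t = dist p m"
  define b where "b = dist m q"
  have t0: "0 \<le> t" "0 \<le> b" by (auto simp: t_def b_def)
  define f where "f s = p + (s / t) *\<^sub>R (m - p)" for s
  define h where "h s = m + ((s - t) / b) *\<^sub>R (q - m)" for s
  have unit_speed: "dist (x + (s / l) *\<^sub>R (y - x)) (x + (s' / l) *\<^sub>R (y - x)) \<le> \<bar>s - s'\<bar>"
    if "l = dist x y" for x y :: 'a and s s' l
  proof -
    have "dist (x + (s / l) *\<^sub>R (y - x)) (x + (s' / l) *\<^sub>R (y - x)) = norm (((s - s') / l) *\<^sub>R (y - x))"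
      by (simp add: dist_norm scaleR_diff_left[symmetric] diff_divide_distrib)
    also have "\<dots> \<le> \<bar>s - s'\<bar>" using that by (simp add: dist_norm norm_minus_commute)
    finally show ?thesis .
  qed
  have "1-lipschitz_on {0..t} f"
    using unit_speed[OF t_def] by (auto simp: lipschitz_on_def f_def dist_real_def)
  moreover have "1-lipschitz_on {t..t + b} h"
  proof (rule lipschitz_onI)
    fix x y :: real
    show "dist (h x) (h y) \<le> 1 * dist x y"
      using unit_speed[OF b_def, of "x - t" "y - t"] by (simp add: h_def dist_real_def)
  qed simp
  moreover have "f t = h t" by (simp add: f_def h_def t_def)
  ultimately have lip: "1-lipschitz_on {0..t + b} (\<lambda>s. if s \<le> t then f s else h s)" (is "1-lipschitz_on _ ?g")
    by (rule lipschitz_on_concat)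
  have "intrinsic_dist S p q \<le> ennreal (t + b)"
  proof (rule intrinsic_dist_le_lipschitz)
    show "(t + b)-lipschitz_on {0..1} (\<lambda>u. ?g ((t + b) * u))"
    proof (rule lipschitz_onI)
      fix x y :: real assume "x \<in> {0..1}" "y \<in> {0..1}"
      then have "dist (?g ((t + b) * x)) (?g ((t + b) * y)) \<le> 1 * dist ((t + b) * x) ((t + b) * y)"
        using t0 by (intro lipschitz_onD[OF lip]) (auto simp: mult_left_le)
      also have "\<dots> = (t + b) * dist x y"
        using t0 by (simp add: dist_real_def abs_mult flip: right_diff_distrib)
      finally show "dist (?g ((t + b) * x)) (?g ((t + b) * y)) \<le> (t + b) * dist x y" .
    qed (use t0 in simp)
    have f_seg: "f s \<in> S" if "0 \<le> s" "s \<le> t" for s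
    proof -
      have "f s = (1 - s / t) *\<^sub>R p + (s / t) *\<^sub>R m" by (simp add: f_def algebra_simps)
      moreover have "0 \<le> s / t" "s / t \<le> 1" using that by (auto simp: divide_le_eq_1)
      ultimately have "f s \<in> closed_segment p m" unfolding in_segment by blast
      then show ?thesis using pm by blast
    qed
    have h_seg: "h s \<in> S" if "t \<le> s" "s \<le> t + b" for s
    proof -
      have "h s = (1 - (s - t) / b) *\<^sub>R m + ((s - t) / b) *\<^sub>R q" by (simp add: h_def algebra_simps)
      moreover have "0 \<le> (s - t) / b" "(s - t) / b \<le> 1" using that by (auto simp: divide_le_eq_1)
      ultimately have "h s \<in> closed_segment m q" unfolding in_segment by blast
      then show ?thesis using mq by blast
    qed
    have "(t + b) * u \<le> t + b" if "u \<le> 1" for u using that t0 by (simp add: mult_left_le)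
    then show "(\<lambda>u. ?g ((t + b) * u)) ` {0..1} \<subseteq> S"
      using f_seg h_seg t0 by auto
    show "?g ((t + b) * 0) = p" using t0 by (simp add: f_def)
    show "?g ((t + b) * 1) = q"
    proof (cases "b = 0")
      case True
      then show ?thesis by (simp add: f_def t_def b_def)
    next
      case False
      then show ?thesis using t0 by (simp add: h_def)
    qed
  qed
  then show ?thesis by (simp add: t_def b_def)
qed

lemma mult_sin_le_sin_mult:
  assumes c: "0 < c" "c \<le> 1" and y: "0 \<le> y" "y \<le> pi / 2"
  shows "c * sin y \<le> sin (c * (y::real))"
proof -
  have "sin (c * 0) - c * sin 0 \<le> sin (c * y) - c * sin y"
  proof (rule DERIV_nonneg_imp_nondecreasing[OF y(1)])
    fix x assume x: "0 \<le> x" "x \<le> y"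
    have "cos x \<le> cos (c * x)"
      using x y c by (intro cos_monotone_0_pi_le) (auto simp: mult_left_le_one_le)
    then have "0 \<le> cos (c * x) * c - c * cos x" using c by simp
    moreover have "((\<lambda>x. sin (c * x) - c * sin x) has_real_derivative cos (c * x) * c - c * cos x) (at x)"
      by (auto intro!: derivative_eq_intros)
    ultimately show "\<exists>d. ((\<lambda>x. sin (c * x) - c * sin x) has_real_derivative d) (at x) \<and> 0 \<le> d"
      by blast
  qed
  then show ?thesis by simp
qed

text \<open>
  This makes rolling a planar sector onto a cone 1-Lipschitz. For \<open>\<bar>x\<bar> \<le> c * pi / 2\<close> it is the
  concavity of the sine, and for larger \<open>\<bar>x\<bar>\<close> the right-hand side exceeds \<open>c\<close>.
\<close>

lemma sin_div_contraction:
  assumes c: "0 < c" "c \<le> 1" and x: "\<bar>x\<bar> \<le> pi / 2"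
  shows "c * \<bar>sin (x / c)\<bar> \<le> \<bar>sin (x::real)\<bar>"
proof -
  have nonneg: "c * \<bar>sin (x / c)\<bar> \<le> \<bar>sin x\<bar>" if x: "0 \<le> x" "x \<le> pi / 2" for x :: real
  proof (cases "x \<le> c * (pi / 2)")
    case True
    then have "0 \<le> x / c" "x / c \<le> pi / 2" using c x by (auto simp: field_simps)
    moreover from this have "0 \<le> sin (x / c)" using pi_gt_zero by (intro sin_ge_zero) linarith+
    moreover have "0 \<le> sin x" using x by (intro sin_ge_zero) auto
    ultimately show ?thesis using mult_sin_le_sin_mult[OF c, of "x / c"] c by simp
  next
    case False
    have "c * \<bar>sin (x / c)\<bar> \<le> c * 1" using c by (intro mult_left_mono) auto
    also have "\<dots> = c * sin (pi / 2)" by simp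
    also have "\<dots> \<le> sin (c * (pi / 2))" by (intro mult_sin_le_sin_mult c) auto
    also have "\<dots> \<le> sin x"
    proof (rule sin_monotone_2pi_le)
      show "- (pi / 2) \<le> c * (pi / 2)" using c by (auto intro: order_trans[of _ 0])
    qed (use False x in auto)
    finally show ?thesis by simp
  qed
  show ?thesis using nonneg[of x] nonneg[of "- x"] x by (cases "0 \<le> x") auto
qed

text \<open>
  The quotient \<open>sin (c * x) / sin x\<close> increases on \<open>(0, pi / 2]\<close>. On a cone this says that
  among pairs of points at given distances from the apex the opposite ones are the worst.
\<close>

lemma sin_mult_le_sin_half_pi:
  assumes c: "0 < c" "c \<le> 1" and x: "\<bar>x\<bar> \<le> pi / 2"
  shows "\<bar>sin (c * x)\<bar> \<le> sin (c * (pi / 2)) * \<bar>sin (x::real)\<bar>"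
proof -
  have pos: "sin (c * x) \<le> sin (c * (pi / 2)) * sin x \<and> 0 \<le> sin x \<and> 0 \<le> sin (c * x)"
    if x: "0 < x" "x \<le> pi / 2" for x :: real
  proof -
    have cx: "c * y \<le> y" "0 \<le> c * y" if "0 \<le> y" for y
      using c that by (auto simp: mult_left_le_one_le)
    have num: "sin (c * y) * cos y \<le> c * cos (c * y) * sin y" if y: "0 \<le> y" "y \<le> pi / 2" for y
    proof -
      have "c * cos (c * 0) * sin 0 - sin (c * 0) * cos 0
          \<le> c * cos (c * y) * sin y - sin (c * y) * cos y"
      proof (rule DERIV_nonneg_imp_nondecreasing[OF y(1)])
        fix u assume u: "0 \<le> u" "u \<le> y"
        have "0 \<le> sin u" "0 \<le> sin (c * u)"
          using u y cx[of u] by (auto intro!: sin_ge_zero)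
        then have "0 \<le> (1 - c * c) * (sin u * sin (c * u))"
          using c by (intro mult_nonneg_nonneg) (auto simp: mult_le_one)
        moreover have "((\<lambda>y. c * cos (c * y) * sin y - sin (c * y) * cos y)
            has_real_derivative (1 - c * c) * (sin u * sin (c * u))) (at u)"
          by (auto intro!: derivative_eq_intros simp: algebra_simps)
        ultimately show "\<exists>d. ((\<lambda>y. c * cos (c * y) * sin y - sin (c * y) * cos y)
            has_real_derivative d) (at u) \<and> 0 \<le> d" by blast
      qed
      then show ?thesis by simp
    qed
    have "sin (c * x) / sin x \<le> sin (c * (pi / 2)) / sin (pi / 2)"
    proof (rule DERIV_nonneg_imp_nondecreasing[OF x(2)])
      fix u assume u: "x \<le> u" "u \<le> pi / 2"
      have "0 < sin u" using u x by (intro sin_gt_zero) auto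
      then have "((\<lambda>u. sin (c * u) / sin u) has_real_derivative
          (c * cos (c * u) * sin u - sin (c * u) * cos u) / (sin u * sin u)) (at u)"
        by (auto intro!: derivative_eq_intros simp: algebra_simps)
      moreover have "0 \<le> (c * cos (c * u) * sin u - sin (c * u) * cos u) / (sin u * sin u)"
        using num[of u] u x \<open>0 < sin u\<close> by (intro divide_nonneg_pos) auto
      ultimately show "\<exists>d. ((\<lambda>u. sin (c * u) / sin u) has_real_derivative d) (at u) \<and> 0 \<le> d"
        by blast
    qed
    moreover have "0 < sin x" using x by (intro sin_gt_zero) auto
    moreover have "0 \<le> sin (c * x)" using cx[of x] x by (intro sin_ge_zero) linarith+
    ultimately show ?thesis by (simp add: divide_le_eq)
  qed
  consider "0 < x" | "x = 0" | "x < 0" by linarith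
  then show ?thesis
    by cases (use pos[of x] pos[of "- x"] x in auto)
qed

text \<open>
  A cone with half-angle \<open>arcsin c\<close> unrolls to a planar sector in which angles are multiplied by
  \<open>c\<close>. The left-hand side is the squared Euclidean distance of the points of the cone that correspond to
  \<open>w\<close> and \<open>w'\<close>; by the law of cosines both sides have the same radial part.
\<close>

lemma cone_development_lipschitz:
  fixes w w' :: complex
  assumes c: "0 < c" "c \<le> 1" and w: "w = 0 \<or> 0 < Re w" "w' = 0 \<or> 0 < Re w'"
  shows "c\<^sup>2 * (dist (of_real (norm w) * cis (\<alpha> + Arg w / c)) (of_real (norm w') * cis (\<alpha> + Arg w' / c)))\<^sup>2
       + (1 - c\<^sup>2) * (norm w - norm w')\<^sup>2 \<le> (dist w w')\<^sup>2"
proof -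
  define r where "r = norm w"
  define r' where "r' = norm w'"
  define x where "x = (Arg w - Arg w') / 2"
  have polar: "z = of_real (norm z) * cis (Arg z)" for z
    by (cases "z = 0") (auto simp: cis_Arg sgn_eq)
  have lhs: "(dist (of_real r * cis (\<alpha> + Arg w / c)) (of_real r' * cis (\<alpha> + Arg w' / c)))\<^sup>2
      = (r - r')\<^sup>2 + 4 * r * r' * (sin (x / c))\<^sup>2"
  proof -
    have "(\<alpha> + Arg w / c - (\<alpha> + Arg w' / c)) / 2 = x / c"
      by (simp add: x_def diff_divide_distrib mult.commute)
    then show ?thesis using dist_polar_sq[of r "\<alpha> + Arg w / c" r' "\<alpha> + Arg w' / c"] by simp
  qed
  have rhs: "(dist w w')\<^sup>2 = (r - r')\<^sup>2 + 4 * r * r' * (sin x)\<^sup>2"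
    using dist_polar_sq[of r "Arg w" r' "Arg w'"] polar[of w] polar[of w']
    by (simp add: x_def r_def r'_def)
  have "r * r' * (c\<^sup>2 * (sin (x / c))\<^sup>2) \<le> r * r' * (sin x)\<^sup>2"
  proof (cases "w = 0 \<or> w' = 0")
    case False
    then have "\<bar>Arg w\<bar> < pi / 2" "\<bar>Arg w'\<bar> < pi / 2"
      using w Re_Ln_pos_lt[of w] Re_Ln_pos_lt[of w'] Arg_eq_Im_Ln[of w] Arg_eq_Im_Ln[of w'] by auto
    then have "\<bar>Arg w - Arg w'\<bar> \<le> pi" by linarith
    then have "\<bar>x\<bar> \<le> pi / 2" by (simp add: x_def)
    then have "c * \<bar>sin (x / c)\<bar> \<le> \<bar>sin x\<bar>" by (rule sin_div_contraction[OF c])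
    then have "(c * \<bar>sin (x / c)\<bar>)\<^sup>2 \<le> \<bar>sin x\<bar>\<^sup>2" using c by (intro power_mono) auto
    then show ?thesis by (intro mult_left_mono) (auto simp: power_mult_distrib r_def r'_def)
  qed (auto simp: r_def r'_def)
  then show ?thesis unfolding r_def[symmetric] r'_def[symmetric] lhs rhs
    by (simp add: algebra_simps)
qed

text \<open>
  For the two sides \<open>t\<close>, \<open>b\<close> of an angle with cosine at most \<open>c\<close>, the
  isosceles case is the extremal one: the defect is \<open>(1 + c) * (t - b)\<^sup>2\<close>.
\<close>

lemma two_sides_of_angle:
  fixes c t b s :: real
  assumes c: "0 \<le> c" "c < 1" and tb: "0 \<le> t" "0 \<le> b" and s: "t\<^sup>2 + b\<^sup>2 - 2 * c * t * b \<le> s\<^sup>2" "0 \<le> s"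
  shows "t + b \<le> sqrt (2 / (1 - c)) * s"
proof (rule power2_le_imp_le)
  have "0 \<le> (1 + c) * (t - b)\<^sup>2" using c by simp
  then have "(1 - c) * (t + b)\<^sup>2 \<le> 2 * (t\<^sup>2 + b\<^sup>2 - 2 * c * t * b)"
    by (simp add: power2_eq_square algebra_simps)
  also have "\<dots> \<le> 2 * s\<^sup>2" using s by simp
  finally show "(t + b)\<^sup>2 \<le> (sqrt (2 / (1 - c)) * s)\<^sup>2"
    using c by (simp add: power_mult_distrib field_simps)
qed (use c s in simp)

text \<open>
  The cone has apex \<open>0\<close>, slant height \<open>1\<close>, height \<open>k\<close> and base radius \<open>c\<close>.
  Between two lateral points, the segment between their images in the planar development is a short
  path; the worst case are opposite points at equal height, with quotient \<open>sin (c * (pi / 2)) / c\<close>.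
  A lateral point is joined to a point of the base via the rim point below it, where the path has an
  angle with cosine at most \<open>c\<close>. Two points of the base are joined by a segment.
\<close>

lemma cone_distortion:
  fixes c k :: real
  assumes ck: "0 < c" "0 < k" "c\<^sup>2 + k\<^sup>2 = 1" and half: "c < 1/2"
  obtains K :: "(real ^ 3) set" where "convex_body K"
    "distortion (frontier K) \<le> ennreal (max (sqrt (2 / (1 - c))) (sin (c * (pi / 2)) / c))"
proof -
  define \<Lambda> where "\<Lambda> = max (sqrt (2 / (1 - c))) (sin (c * (pi / 2)) / c)"
  have c1: "c \<le> 1" using half by simp
  have c2: "k\<^sup>2 = 1 - c\<^sup>2" using ck by simp
  have \<Lambda>1: "1 \<le> \<Lambda>"
  proof -
    have "1 \<le> sqrt (2 / (1 - c))" using ck c1 half by (simp add: field_simps)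
    then show ?thesis unfolding \<Lambda>_def by (rule max.coboundedI1)
  qed
  define e :: "real ^ 3" where "e = axis 3 1"
  have e1: "norm e = 1" by (simp add: e_def)
  obtain J :: "complex \<Rightarrow> real ^ 3" and Q where J: "linear J" "linear Q" "\<And>(w::complex) (z::real). Q (J w + z *\<^sub>R e) = w"
    "\<And>(w::complex) (z::real). (J w + z *\<^sub>R e) \<bullet> e = z" "\<And>x. J (Q x) + (x \<bullet> e) *\<^sub>R e = x"
    "\<And>(w::complex) (z::real). (norm (J w + z *\<^sub>R e))\<^sup>2 = (cmod w)\<^sup>2 + z\<^sup>2"
    using complex_coordinates_orthogonal_to[OF e1] by metis
  define X where "X w z = J w + z *\<^sub>R e" for w z
  have Xx: "X (Q x) (x \<bullet> e) = x" for x by (simp add: X_def J(5))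
  have QX: "Q (X w z) = w" "X w z \<bullet> e = z" for w z by (simp_all add: X_def J(3,4))
  have Xdist: "(dist (X w z) (X w' z'))\<^sup>2 = (dist w w')\<^sup>2 + (z - z')\<^sup>2" for w z w' z'
  proof -
    have "X w z - X w' z' = J (w - w') + (z - z') *\<^sub>R e"
      by (simp add: X_def linear_diff[OF J(1)] algebra_simps)
    then show ?thesis by (simp add: dist_norm J(6))
  qed
  have Xcomb: "s *\<^sub>R X w z + t *\<^sub>R X w' z' = X (s *\<^sub>R w + t *\<^sub>R w') (s * z + t * z')" for s t w z w' z'
    by (simp add: X_def linear_add[OF J(1)] linear_scale[OF J(1)] algebra_simps)
  define f where "f x = max (k * norm (Q x) - c * (x \<bullet> e)) (x \<bullet> e - k)" for x
  have fX: "f (X w z) = max (k * norm w - c * z) (z - k)" for w z by (simp add: f_def QX)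
  have contf: "continuous_on UNIV f"
    unfolding f_def using J(2)
    by (intro continuous_intros) (auto simp: linear_continuous_on linear_conv_bounded_linear)
  have convf: "f ((1 - t) *\<^sub>R x + t *\<^sub>R y) \<le> (1 - t) * f x + t * f y" if t: "0 \<le> t" "t \<le> 1" for x y t
  proof -
    have "norm (Q ((1 - t) *\<^sub>R x + t *\<^sub>R y)) \<le> norm ((1 - t) *\<^sub>R Q x) + norm (t *\<^sub>R Q y)"
      unfolding linear_add[OF J(2)] linear_scale[OF J(2)] by (rule norm_triangle_ineq)
    then have "norm (Q ((1 - t) *\<^sub>R x + t *\<^sub>R y)) \<le> (1 - t) * norm (Q x) + t * norm (Q y)"
      using t by simp
    then have "k * norm (Q ((1 - t) *\<^sub>R x + t *\<^sub>R y)) \<le> k * ((1 - t) * norm (Q x) + t * norm (Q y))"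
      using ck by (intro mult_left_mono) auto
    then have "k * norm (Q ((1 - t) *\<^sub>R x + t *\<^sub>R y)) - c * (((1 - t) *\<^sub>R x + t *\<^sub>R y) \<bullet> e)
        \<le> (1 - t) * (k * norm (Q x) - c * (x \<bullet> e)) + t * (k * norm (Q y) - c * (y \<bullet> e))"
      by (simp add: inner_add_left algebra_simps)
    also have "\<dots> \<le> (1 - t) * f x + t * f y"
      using t by (intro add_mono mult_left_mono) (auto simp: f_def)
    finally have 1: "k * norm (Q ((1 - t) *\<^sub>R x + t *\<^sub>R y)) - c * (((1 - t) *\<^sub>R x + t *\<^sub>R y) \<bullet> e)
        \<le> (1 - t) * f x + t * f y" .
    have "((1 - t) *\<^sub>R x + t *\<^sub>R y) \<bullet> e - k = (1 - t) * (x \<bullet> e - k) + t * (y \<bullet> e - k)"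
      by (simp add: inner_add_left algebra_simps)
    also have "\<dots> \<le> (1 - t) * f x + t * f y"
      using t by (intro add_mono mult_left_mono) (auto simp: f_def)
    finally show ?thesis using 1 by (simp add: f_def)
  qed
  define K where "K = {x. f x \<le> 0}"
  have f0: "f (X 0 (k / 2)) < 0" using ck by (simp add: fX)
  have front: "frontier K = {x. f x = 0}"
    unfolding K_def by (rule frontier_sublevel_convex[OF contf convf f0])
  have body: "convex_body K"
    unfolding convex_body_def
  proof (intro conjI)
    have "bounded K"
      unfolding bounded_iff
    proof (intro exI ballI)
      fix x assume "x \<in> K"
      then have x: "k * norm (Q x) \<le> c * (x \<bullet> e)" "x \<bullet> e \<le> k" by (auto simp: K_def f_def)
      have "0 \<le> c * (x \<bullet> e)" using x(1) ck(2) by (meson mult_nonneg_nonneg norm_ge_zero order_trans less_imp_le)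
      then have "0 \<le> x \<bullet> e" using ck by (simp add: zero_le_mult_iff)
      have "c * (x \<bullet> e) \<le> c * k" using x ck by simp
      then have "k * norm (Q x) \<le> k * c" using x by (simp add: mult.commute)
      then have "norm (Q x) \<le> c" using ck by simp
      then have "(norm (Q x))\<^sup>2 \<le> c\<^sup>2" "(x \<bullet> e)\<^sup>2 \<le> k\<^sup>2"
        using x \<open>0 \<le> x \<bullet> e\<close> by (auto intro: power_mono)
      then have "(norm x)\<^sup>2 \<le> 1" using J(6)[of "Q x" "x \<bullet> e"] ck(3) unfolding J(5) by linarith
      then show "norm x \<le> 1" using power2_le_imp_le[of "norm x" 1] by simp
    qed
    moreover have "closed K" unfolding K_def using contf by (intro closed_Collect_le continuous_intros)
    ultimately show "compact K" by (simp add: compact_eq_bounded_closed)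
    show "convex K"
      unfolding convex_alt K_def
    proof (intro ballI allI impI, clarsimp)
      fix x y t assume "f x \<le> 0" "f y \<le> 0" "0 \<le> t" "t \<le> (1::real)"
      then have "(1 - t) * f x \<le> 0" "t * f y \<le> 0" by (auto simp: mult_le_0_iff)
      then show "f ((1 - t) *\<^sub>R x + t *\<^sub>R y) \<le> 0"
        using convf[of t x y] \<open>0 \<le> t\<close> \<open>t \<le> 1\<close> by linarith
    qed
    have "X 0 (k / 2) \<in> K - frontier K" using f0 by (simp add: front) (simp add: K_def)
    then show "interior K \<noteq> {}"
      using closure_subset[of K] by (auto simp: frontier_def)
  qed
  have lateral: "X (of_real (R * c) * cis \<theta>) (R * k) \<in> frontier K" if "0 \<le> R" "R \<le> 1" for R \<theta>
    using that ck by (simp add: front fX norm_mult max_def)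
  have base: "X w k \<in> frontier K" if "norm w \<le> c" for w
    using that ck by (simp add: front fX max_def mult.commute)
  have frontier_cases: "(\<exists>R \<theta>. 0 \<le> R \<and> R \<le> 1 \<and> p = X (of_real (R * c) * cis \<theta>) (R * k)) \<or>
      (\<exists>w. norm w \<le> c \<and> p = X w k)" if "p \<in> frontier K" for p
  proof -
    define w where "w = Q p"
    define z where "z = p \<bullet> e"
    have p: "p = X w z" by (simp add: w_def z_def Xx)
    have fp: "max (k * norm w - c * z) (z - k) = 0" using that by (simp add: front p fX)
    show ?thesis
    proof (cases "z = k")
      case True
      then have "k * norm w \<le> k * c" using fp by (simp add: mult.commute max_def split: if_splits)
      then show ?thesis using True ck p by auto
    next
      case False
      then have z: "k * norm w = c * z" "z \<le> k" using fp by (auto simp: max_def split: if_splits)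
      define R where "R = z / k"
      have "0 \<le> c * z" using z(1) ck by (metis mult_nonneg_nonneg norm_ge_zero less_imp_le)
      then have "0 \<le> z" using ck by (simp add: zero_le_mult_iff)
      have R: "0 \<le> R" "R \<le> 1" "R * k = z" using ck z \<open>0 \<le> z\<close> by (auto simp: R_def)
      have "norm w = R * c" using z(1) ck by (simp add: R_def field_simps)
      then obtain \<theta> where "w = of_real (R * c) * cis \<theta>"
        using rcis_cmod_Arg[of w] unfolding rcis_def by metis
      then show ?thesis using R p by (intro disjI1 exI[of _ R] exI[of _ \<theta>]) simp
    qed
  qed
  have Lbound: "intrinsic_dist (frontier K) p q \<le> ennreal \<Lambda> * ennreal (dist p q)"
    if "intrinsic_dist (frontier K) p q \<le> ennreal d" "d \<le> \<Lambda> * dist p q" for p q d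
  proof -
    have "ennreal d \<le> ennreal (\<Lambda> * dist p q)" using that(2) by (rule ennreal_leI)
    also have "\<dots> = ennreal \<Lambda> * ennreal (dist p q)" using \<Lambda>1 by (intro ennreal_mult) auto
    finally show ?thesis using that(1) by order
  qed
  have base_base: "intrinsic_dist (frontier K) (X w k) (X w' k) \<le> ennreal (dist (X w k) (X w' k))"
    if w: "norm w \<le> c" "norm w' \<le> c" for w w'
  proof -
    have seg: "closed_segment (X w k) (X w' k) \<subseteq> frontier K"
    proof
      fix x assume "x \<in> closed_segment (X w k) (X w' k)"
      then obtain t where t: "0 \<le> t" "t \<le> 1" "x = (1 - t) *\<^sub>R X w k + t *\<^sub>R X w' k"
        unfolding in_segment by blast
      have "x = X ((1 - t) *\<^sub>R w + t *\<^sub>R w') k" unfolding t(3) Xcomb by (simp add: algebra_simps)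
      moreover have "norm ((1 - t) *\<^sub>R w + t *\<^sub>R w') \<le> (1 - t) * c + t * c"
        using t w by (intro order_trans[OF norm_triangle_ineq] add_mono) (auto intro: mult_left_mono)
      ultimately show "x \<in> frontier K" using base by (simp add: algebra_simps)
    qed
    from intrinsic_dist_two_segments[of "X w k" "X w k" "frontier K" "X w' k"] seg base[OF w(1)]
    show ?thesis by simp
  qed
  have mixed: "intrinsic_dist (frontier K) p q \<le> ennreal \<Lambda> * ennreal (dist p q) \<and>
      intrinsic_dist (frontier K) q p \<le> ennreal \<Lambda> * ennreal (dist q p)"
    if R: "0 \<le> R" "R \<le> 1" and p: "p = X (of_real (R * c) * cis \<theta>) (R * k)"
      and w: "norm w \<le> c" and q: "q = X w k" for p q R \<theta> w
  proof -
    define m where "m = X (of_real c * cis \<theta>) k"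
    have mbase: "norm (of_real c * cis \<theta>) \<le> c" using ck by (simp add: norm_mult)
    have pm: "closed_segment p m \<subseteq> frontier K"
    proof
      fix x assume "x \<in> closed_segment p m"
      then obtain t where t: "0 \<le> t" "t \<le> 1" "x = (1 - t) *\<^sub>R p + t *\<^sub>R m"
        unfolding in_segment by blast
      have "x = X (of_real (((1 - t) * R + t) * c) * cis \<theta>) (((1 - t) * R + t) * k)"
        unfolding t(3) p m_def Xcomb by (simp add: scaleR_conv_of_real algebra_simps)
      moreover have "(1 - t) * R \<le> (1 - t) * 1" "0 \<le> (1 - t) * R + t"
        using t R mult_left_mono[of R 1 "1 - t"] by auto
      ultimately show "x \<in> frontier K" using lateral[of "(1 - t) * R + t" \<theta>] by simp
    qed
    have mq: "closed_segment m q \<subseteq> frontier K"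
    proof
      fix x assume "x \<in> closed_segment m q"
      then obtain t where t: "0 \<le> t" "t \<le> 1" "x = (1 - t) *\<^sub>R m + t *\<^sub>R q"
        unfolding in_segment by blast
      have "x = X ((1 - t) *\<^sub>R (of_real c * cis \<theta>) + t *\<^sub>R w) k"
        unfolding t(3) m_def q Xcomb by (simp add: algebra_simps)
      moreover have "norm ((1 - t) *\<^sub>R (of_real c * cis \<theta>) + t *\<^sub>R w) \<le> (1 - t) * c + t * c"
        using t w mbase ck
        by (intro order_trans[OF norm_triangle_ineq] add_mono) (auto simp: norm_mult intro: mult_left_mono)
      ultimately show "x \<in> frontier K" using base by (simp add: algebra_simps)
    qed
    have t: "dist p m = 1 - R"
    proof -
      have "(dist p m)\<^sup>2 = (1 - R)\<^sup>2 * (c\<^sup>2 + k\<^sup>2)"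
        unfolding p m_def Xdist
        using dist_polar_sq[of "R * c" \<theta> c \<theta>] by (simp add: power2_eq_square algebra_simps)
      then show ?thesis using ck R by (simp add: power2_eq_iff_nonneg)
    qed
    define d where "d = w - of_real c * cis \<theta>"
    define b where "b = norm d"
    have b: "dist m q = b"
    proof -
      have "(dist m q)\<^sup>2 = b\<^sup>2"
        unfolding m_def q Xdist by (simp add: b_def d_def dist_norm norm_minus_commute)
      then show ?thesis by (simp add: power2_eq_iff_nonneg b_def)
    qed
    have "(1 - R)\<^sup>2 + b\<^sup>2 - 2 * c * (1 - R) * b \<le> (dist p q)\<^sup>2"
    proof -
      have "(dist p q)\<^sup>2 = (norm (d + ((1 - R) * c) *\<^sub>R cis \<theta>))\<^sup>2 + ((1 - R) * k)\<^sup>2"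
        unfolding p q Xdist
        by (simp add: dist_norm d_def norm_minus_commute scaleR_conv_of_real power2_eq_square algebra_simps)
      also have "(norm (d + ((1 - R) * c) *\<^sub>R cis \<theta>))\<^sup>2
          = b\<^sup>2 + 2 * ((1 - R) * c) * (d \<bullet> cis \<theta>) + ((1 - R) * c)\<^sup>2"
      proof -
        have "cis \<theta> \<bullet> cis \<theta> = 1" using norm_cis[of \<theta>] by (simp only: norm_eq_1)
        then show ?thesis
          unfolding power2_norm_eq_inner b_def
          by (simp add: inner_add_left inner_add_right inner_commute power2_eq_square algebra_simps)
      qed
      finally have "(dist p q)\<^sup>2
          = b\<^sup>2 + 2 * ((1 - R) * c) * (d \<bullet> cis \<theta>) + ((1 - R) * c)\<^sup>2 + ((1 - R) * k)\<^sup>2" .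
      moreover have "((1 - R) * c)\<^sup>2 + ((1 - R) * k)\<^sup>2 = (1 - R)\<^sup>2 * (c\<^sup>2 + k\<^sup>2)"
        by (simp only: power_mult_distrib distrib_left)
      moreover have "- b \<le> d \<bullet> cis \<theta>"
        using Cauchy_Schwarz_ineq2[of d "cis \<theta>"] by (simp add: b_def)
      then have "2 * ((1 - R) * c) * (- b) \<le> 2 * ((1 - R) * c) * (d \<bullet> cis \<theta>)"
        using R ck by (intro mult_left_mono) auto
      ultimately show ?thesis using ck(3) by (simp add: algebra_simps)
    qed
    then have "(1 - R) + b \<le> sqrt (2 / (1 - c)) * dist p q"
      using R ck half by (intro two_sides_of_angle) (auto simp: b_def)
    also have "\<dots> \<le> \<Lambda> * dist p q" by (intro mult_right_mono) (auto simp: \<Lambda>_def)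
    finally have len: "(1 - R) + b \<le> \<Lambda> * dist p q" .
    have "intrinsic_dist (frontier K) p q \<le> ennreal ((1 - R) + b)"
      using intrinsic_dist_two_segments[OF pm mq] unfolding t b .
    moreover have "intrinsic_dist (frontier K) q p \<le> ennreal ((1 - R) + b)"
      using intrinsic_dist_two_segments[of q m "frontier K" p] pm mq t b
      by (simp add: closed_segment_commute dist_commute add.commute)
    ultimately show ?thesis using Lbound[OF _ len] Lbound[of q p "1 - R + b"] len by (simp add: dist_commute)
  qed
  have lateral_lateral: "intrinsic_dist (frontier K) p q \<le> ennreal \<Lambda> * ennreal (dist p q)"
    if R: "0 \<le> R" "R \<le> 1" and p: "p = X (of_real (R * c) * cis \<alpha>) (R * k)"
      and S: "0 \<le> S" "S \<le> 1" and q: "q = X (of_real (S * c) * cis \<beta>) (S * k)" for p q R S \<alpha> \<beta>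
  proof -
    \<comment> \<open>The angle between the rulings, reduced to at most half a turn so that the development of the
      shorter side fits into a half-plane.\<close>
    define \<phi> where "\<phi> = Arg (cis (\<beta> - \<alpha>))"
    have "cis \<phi> = cis (\<beta> - \<alpha>)" by (simp add: \<phi>_def cis_Arg)
    then have cis\<beta>: "cis \<beta> = cis (\<alpha> + \<phi>)" by (simp add: cis_mult[symmetric]) (simp add: cis_mult)
    have \<phi>: "\<bar>\<phi>\<bar> \<le> pi" using Arg_bounded[of "cis (\<beta> - \<alpha>)"] by (auto simp: \<phi>_def)
    have c\<phi>: "\<bar>c * \<phi>\<bar> < pi / 2"
    proof -
      have "\<bar>c * \<phi>\<bar> \<le> c * pi" using \<phi> ck by (simp add: abs_mult mult_left_mono)
      also have "\<dots> < 1/2 * pi" using half by (intro mult_strict_right_mono) auto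
      finally show ?thesis by simp
    qed
    have cospos: "0 < cos (c * \<phi>)" using c\<phi> by (intro cos_gt_zero_pi) auto
    define P0 :: complex where "P0 = of_real R"
    define Q0 where "Q0 = of_real S * cis (c * \<phi>)"
    define \<Psi> where "\<Psi> w = X (of_real (norm w * c) * cis (\<alpha> + Arg w / c)) (norm w * k)" for w
    have lip: "dist (\<Psi> w) (\<Psi> w') \<le> dist w w'" if "w = 0 \<or> 0 < Re w" "w' = 0 \<or> 0 < Re w'" for w w'
    proof (rule power2_le_imp_le)
      have "of_real (norm v * c) * cis \<gamma> = of_real c * (of_real (norm v) * cis \<gamma>)" for v :: complex and \<gamma>
        by simp
      then have "(dist (\<Psi> w) (\<Psi> w'))\<^sup>2
          = c\<^sup>2 * (dist (of_real (norm w) * cis (\<alpha> + Arg w / c)) (of_real (norm w') * cis (\<alpha> + Arg w' / c)))\<^sup>2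
            + (norm w * k - norm w' * k)\<^sup>2"
        unfolding \<Psi>_def Xdist
        using ck by (simp only: dist_norm right_diff_distrib[symmetric] norm_mult norm_of_real power_mult_distrib power2_abs)
      also have "(norm w * k - norm w' * k)\<^sup>2 = (1 - c\<^sup>2) * (norm w - norm w')\<^sup>2"
        by (simp add: c2[symmetric] power_mult_distrib[symmetric] algebra_simps)
      finally show "(dist (\<Psi> w) (\<Psi> w'))\<^sup>2 \<le> (dist w w')\<^sup>2"
        using cone_development_lipschitz[OF ck(1) c1 that, of \<alpha>] by simp
    qed simp
    define g where "g t = (1 - t) *\<^sub>R P0 + t *\<^sub>R Q0" for t
    have g_sector: "g t = 0 \<or> 0 < Re (g t)" if t: "t \<in> {0..1}" for t
    proof -
      have nonneg: "0 \<le> (1 - t) * R" "0 \<le> t * S" using t R S by auto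
      have gt: "g t = of_real ((1 - t) * R) + of_real (t * S) * cis (c * \<phi>)"
        by (simp add: g_def P0_def Q0_def scaleR_conv_of_real)
      have Re_g: "Re (g t) = (1 - t) * R + t * S * cos (c * \<phi>)" by (simp add: gt)
      consider "(1 - t) * R = 0" "t * S = 0" | "0 < (1 - t) * R" | "0 < t * S"
        using nonneg by linarith
      then show ?thesis
      proof cases
        case 1
        then show ?thesis unfolding gt by (simp only: of_real_0) simp
      next
        case 2
        then show ?thesis using nonneg cospos unfolding Re_g by (intro disjI2 add_pos_nonneg) auto
      next
        case 3
        then show ?thesis using nonneg cospos unfolding Re_g by (intro disjI2 add_nonneg_pos) auto
      qed
    qed
    have "norm P0 = R" "norm Q0 = S" using R S by (auto simp: P0_def Q0_def norm_mult)
    have g_norm: "norm (g t) \<le> 1" if t: "t \<in> {0..1}" for t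
    proof -
      have "norm (g t) \<le> (1 - t) * R + t * S"
        unfolding g_def using t \<open>norm P0 = R\<close> \<open>norm Q0 = S\<close>
        by (intro order_trans[OF norm_triangle_ineq]) simp
      also have "\<dots> \<le> (1 - t) * 1 + t * 1" using t R S by (intro add_mono mult_left_mono) auto
      finally show ?thesis by simp
    qed
    have "intrinsic_dist (frontier K) p q \<le> ennreal (dist P0 Q0)"
    proof (rule intrinsic_dist_le_lipschitz)
      show "(dist P0 Q0)-lipschitz_on {0..1} (\<lambda>t. \<Psi> (g t))"
      proof (rule lipschitz_onI)
        fix s t :: real assume st: "s \<in> {0..1}" "t \<in> {0..1}"
        have "g s - g t = (s - t) *\<^sub>R (Q0 - P0)" by (simp add: g_def algebra_simps)
        then have "dist (g s) (g t) = dist P0 Q0 * dist s t"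
          by (simp add: dist_norm norm_minus_commute mult.commute)
        then show "dist (\<Psi> (g s)) (\<Psi> (g t)) \<le> dist P0 Q0 * dist s t"
          using lip[OF g_sector[OF st(1)] g_sector[OF st(2)]] by simp
      qed simp
      show "(\<lambda>t. \<Psi> (g t)) ` {0..1} \<subseteq> frontier K"
        using g_norm lateral by (auto simp: \<Psi>_def)
      show "\<Psi> (g 0) = p"
        using R by (simp add: g_def \<Psi>_def P0_def p)
      show "\<Psi> (g 1) = q"
      proof (cases "S = 0")
        case True
        then show ?thesis by (simp add: g_def \<Psi>_def Q0_def q)
      next
        case False
        have "Arg Q0 = c * \<phi>"
        proof (rule cis_Arg_unique)
          show "sgn Q0 = cis (c * \<phi>)" using False S by (simp add: Q0_def sgn_mult sgn_of_real)
        qed (use c\<phi> in auto)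
        then show ?thesis using \<open>norm Q0 = S\<close> ck by (simp add: g_def \<Psi>_def q cis\<beta>)
      qed
    qed
    moreover have "dist P0 Q0 \<le> \<Lambda> * dist p q"
    proof (rule power2_le_imp_le)
      have P: "(dist P0 Q0)\<^sup>2 = (R - S)\<^sup>2 + 4 * R * S * (sin (c * (\<phi> / 2)))\<^sup>2"
        using dist_polar_sq[of R 0 S "c * \<phi>"] by (simp add: P0_def Q0_def)
      have "(dist p q)\<^sup>2 = (R * c - S * c)\<^sup>2 + 4 * (R * c) * (S * c) * (sin (\<phi> / 2))\<^sup>2 + (R * k - S * k)\<^sup>2"
        unfolding p q cis\<beta> Xdist dist_polar_sq by simp
      also have "\<dots> = (R - S)\<^sup>2 * (c\<^sup>2 + k\<^sup>2) + 4 * R * S * (c\<^sup>2 * (sin (\<phi> / 2))\<^sup>2)"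
        by (simp add: power2_eq_square algebra_simps)
      finally have D: "(dist p q)\<^sup>2 = (R - S)\<^sup>2 + 4 * R * S * (c\<^sup>2 * (sin (\<phi> / 2))\<^sup>2)"
        using ck by simp
      have "\<bar>sin (c * (\<phi> / 2))\<bar> \<le> sin (c * (pi / 2)) * \<bar>sin (\<phi> / 2)\<bar>"
        using \<phi> by (intro sin_mult_le_sin_half_pi ck c1) auto
      also have "\<dots> \<le> \<Lambda> * c * \<bar>sin (\<phi> / 2)\<bar>"
      proof (intro mult_right_mono)
        have "sin (c * (pi / 2)) / c \<le> \<Lambda>" by (simp add: \<Lambda>_def)
        then show "sin (c * (pi / 2)) \<le> \<Lambda> * c" using ck by (simp add: divide_le_eq)
      qed simp
      finally have "\<bar>sin (c * (\<phi> / 2))\<bar>\<^sup>2 \<le> (\<Lambda> * c * \<bar>sin (\<phi> / 2)\<bar>)\<^sup>2"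
        by (intro power_mono) auto
      then have "4 * R * S * (sin (c * (\<phi> / 2)))\<^sup>2 \<le> 4 * R * S * (\<Lambda>\<^sup>2 * (c\<^sup>2 * (sin (\<phi> / 2))\<^sup>2))"
        using R S by (intro mult_left_mono) (auto simp: power_mult_distrib mult_ac)
      moreover have "1 * (R - S)\<^sup>2 \<le> \<Lambda>\<^sup>2 * (R - S)\<^sup>2"
        using \<Lambda>1 by (intro mult_right_mono) (auto simp: one_le_power)
      ultimately show "(dist P0 Q0)\<^sup>2 \<le> (\<Lambda> * dist p q)\<^sup>2"
        unfolding power_mult_distrib P D by (simp add: algebra_simps)
    qed (use \<Lambda>1 in simp)
    ultimately show ?thesis by (rule Lbound)
  qed
  have "distortion (frontier K) \<le> ennreal \<Lambda>"
  proof (rule distortion_le)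
    fix p q assume "p \<in> frontier K" "q \<in> frontier K"
    then consider
      (ll) R \<alpha> S \<beta> where "0 \<le> R" "R \<le> 1" "p = X (of_real (R * c) * cis \<alpha>) (R * k)"
        "0 \<le> S" "S \<le> 1" "q = X (of_real (S * c) * cis \<beta>) (S * k)"
      | (lb) R \<alpha> w where "0 \<le> R" "R \<le> 1" "p = X (of_real (R * c) * cis \<alpha>) (R * k)" "norm w \<le> c" "q = X w k"
      | (bl) R \<alpha> w where "0 \<le> R" "R \<le> 1" "q = X (of_real (R * c) * cis \<alpha>) (R * k)" "norm w \<le> c" "p = X w k"
      | (bb) w w' where "norm w \<le> c" "norm w' \<le> c" "p = X w k" "q = X w' k"
      using frontier_cases[of p] frontier_cases[of q] by metis
    then show "intrinsic_dist (frontier K) p q \<le> ennreal \<Lambda> * ennreal (dist p q)"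
    proof cases
      case ll
      then show ?thesis by (rule lateral_lateral)
    next
      case lb
      then show ?thesis using mixed by blast
    next
      case bl
      then show ?thesis using mixed by blast
    next
      case bb
      have "dist p q \<le> \<Lambda> * dist p q" using \<Lambda>1 mult_right_mono[of 1 \<Lambda> "dist p q"] by simp
      then show ?thesis using Lbound[OF base_base[OF bb(1,2), folded bb(3,4)]] by simp
    qed
  qed
  then show thesis using that body by (simp add: \<Lambda>_def)
qed

text \<open>
  As \<open>sin x < x\<close>, the lateral bound is below \<open>\<pi> / 2\<close> for every \<open>c > 0\<close>; the bound at the rim
  needs \<open>c\<close> small. The Pythagorean triple \<open>19, 180, 181\<close> gives \<open>c < 1 / 9\<close>, so that
  the bound at the rim is below \<open>3 / 2\<close>.
\<close>

lemma convex_body_distortion_less_half_pi: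
  obtains K :: "(real ^ 3) set" and q :: real
  where "convex_body K" "0 < q" "q < pi / 2" "distortion (frontier K) \<le> ennreal q"
proof -
  define c :: real where "c = 19 / 181"
  define k :: real where "k = 180 / 181"
  obtain K :: "(real ^ 3) set" where K: "convex_body K"
    "distortion (frontier K) \<le> ennreal (max (sqrt (2 / (1 - c))) (sin (c * (pi / 2)) / c))"
    by (rule cone_distortion[of c k]) (auto simp: c_def k_def power2_eq_square)
  have "sqrt (2 / (1 - c)) < 3 / 2"
    by (rule real_less_lsqrt) (auto simp: c_def power2_eq_square)
  also have "\<dots> < pi / 2" using pi_gt3 by simp
  finally have 1: "sqrt (2 / (1 - c)) < pi / 2" .
  have "sin (c * (pi / 2)) < c * (pi / 2)"
  proof -
    define x where "x = c * (pi / 4)"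
    have x: "0 < x" "x < pi" by (auto simp: x_def c_def)
    then have "cos x < 1" using cos_monotone_0_pi[of 0 x] by simp
    have "sin (2 * x) = 2 * (sin x * cos x)" by (simp add: sin_double)
    also have "\<dots> < 2 * (sin x * 1)"
      using \<open>cos x < 1\<close> sin_gt_zero[OF x] by (intro mult_strict_left_mono) auto
    also have "\<dots> \<le> 2 * x" using sin_x_le_x[of x] x by simp
    finally show ?thesis by (simp add: x_def mult.commute)
  qed
  then have 2: "sin (c * (pi / 2)) / c < pi / 2" by (simp add: c_def field_simps)
  show thesis
    by (rule that[OF K(1) _ _ K(2)]) (use 1 2 in \<open>auto simp: less_max_iff_disj c_def\<close>)
qed

section \<open>Eccentricity of bodies of small distortion\<close>

text \<open>
  Apply the two previous estimates to a diameter \<open>a b\<close> of \<open>K\<close>. The body is not elongated, so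
  the section through the midpoint contains a point \<open>x\<close> at distance comparable to the diameter;
  and it is not flat over the triangle \<open>a b x\<close>, so it contains a ball of comparable radius.
\<close>

lemma inradius_diameter_bound:
  assumes q: "0 < q" "q < pi / 2"
  obtains E where "\<And>K :: (real ^ 3) set. convex_body K \<Longrightarrow> distortion (frontier K) \<le> ennreal q \<Longrightarrow>
     \<exists>c r. 0 < r \<and> cball c r \<subseteq> K \<and> diameter K \<le> E * r"
proof -
  obtain \<epsilon> where \<epsilon>: "0 < \<epsilon>" "\<And>(K :: (real ^ 3) set) a b. convex_body K \<Longrightarrow> a \<in> K \<Longrightarrow> b \<in> K \<Longrightarrow> a \<noteq> b \<Longrightarrow>
     (\<And>x. x \<in> K \<Longrightarrow> (x - midpoint a b) \<bullet> (b - a) = 0 \<Longrightarrow> dist x (midpoint a b) \<le> \<epsilon> * dist a b) \<Longrightarrow>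
     ennreal q < distortion (frontier K)"
    using elongated_body_distortion[OF q] by metis
  have "q < 2" using q pi_less_4 by linarith
  show thesis
  proof (rule that[of "300 / \<epsilon>"])
    fix K :: "(real ^ 3) set"
    assume K: "convex_body K" and dK: "distortion (frontier K) \<le> ennreal q"
    have cK: "compact K" "convex K" "interior K \<noteq> {}" "K \<noteq> {}" "bounded K"
      using K by (auto simp: convex_body_def compact_imp_bounded)
    obtain a b where ab: "a \<in> K" "b \<in> K" "dist a b = diameter K"
      using diameter_compact_attained[OF cK(1,4)] by blast
    have "a \<noteq> b"
    proof
      assume "a = b"
      then have "diameter K = 0" using ab by simp
      then have "K \<subseteq> {a}"
        using diameter_bounded_bound[OF cK(5) ab(1)] by (metis dist_le_zero_iff singletonI subsetI)
      then have "interior K \<subseteq> interior {a}" by (rule interior_mono)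
      then show False using cK(3) by simp
    qed
    have "\<exists>x\<in>K. (x - midpoint a b) \<bullet> (b - a) = 0 \<and> \<epsilon> * dist a b < dist x (midpoint a b)"
    proof (rule ccontr)
      assume "\<not> ?thesis"
      then have "ennreal q < distortion (frontier K)"
        using \<epsilon>(2)[OF K ab(1,2) \<open>a \<noteq> b\<close>] by (meson not_le)
      then show False using dK by simp
    qed
    then obtain x where x: "x \<in> K" "(x - midpoint a b) \<bullet> (b - a) = 0"
      "\<epsilon> * dist a b < dist x (midpoint a b)" by blast
    have "midpoint a b \<in> K"
      using convexD[OF cK(2) ab(1,2), of "1/2" "1/2"] by (simp add: midpoint_def scaleR_add_right)
    then have le: "dist x (midpoint a b) \<le> dist a b"
      using diameter_bounded_bound[OF cK(5) x(1)] ab(3) by simp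
    have "0 < \<epsilon> * dist a b" using \<epsilon>(1) \<open>a \<noteq> b\<close> by simp
    then have pos: "0 < dist x (midpoint a b)" using x(3) by linarith
    have "\<exists>c r. cball c r \<subseteq> K \<and> dist x (midpoint a b) < 300 * r"
    proof (rule ccontr)
      assume "\<not> ?thesis"
      then have "ennreal q < distortion (frontier K)"
        using flat_body_distortion[OF K ab(1,2) x(1) \<open>a \<noteq> b\<close> x(2) pos le _ q(1) \<open>q < 2\<close>]
        by (meson not_le)
      then show False using dK by simp
    qed
    then obtain c r where cr: "cball c r \<subseteq> K" "dist x (midpoint a b) < 300 * r" by blast
    have "\<epsilon> * diameter K < 300 * r" using x(3) cr(2) ab(3) by simp
    then have "diameter K \<le> 300 / \<epsilon> * r" using \<epsilon>(1) by (simp add: field_simps)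
    moreover have "0 < r" using cr(2) pos by linarith
    ultimately show "\<exists>c r. 0 < r \<and> cball c r \<subseteq> K \<and> diameter K \<le> 300 / \<epsilon> * r"
      using cr(1) by blast
  qed
qed

lemma eccentricity_le:
  fixes K :: "'a::euclidean_space set"
  assumes K: "bounded K" "cball c r \<subseteq> K" "0 < r" "diameter K \<le> E * r"
  shows "eccentricity K \<le> E"
proof -
  have "c \<in> K" using K by auto
  have "circumradius K \<le> diameter K"
    unfolding circumradius_def
  proof (rule cInf_lower)
    have "K \<subseteq> cball c (diameter K)"
      using diameter_bounded_bound[OF K(1) \<open>c \<in> K\<close>] by auto
    then show "diameter K \<in> {r. 0 \<le> r \<and> (\<exists>c. K \<subseteq> cball c r)}"
      using diameter_ge_0[OF K(1)] by blast
    show "bdd_below {r. 0 \<le> r \<and> (\<exists>c. K \<subseteq> cball c r)}" by (rule bdd_belowI[of _ 0]) auto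
  qed
  moreover have "r \<le> inradius K"
    unfolding inradius_def
  proof (rule cSup_upper)
    show "r \<in> {r. 0 \<le> r \<and> (\<exists>c. cball c r \<subseteq> K)}" using K by auto
    show "bdd_above {r. 0 \<le> r \<and> (\<exists>c. cball c r \<subseteq> K)}"
    proof (rule bdd_aboveI[of _ "diameter K"], clarify)
      fix s c' assume s: "0 \<le> s" "cball c' s \<subseteq> K"
      obtain v :: 'a where v: "norm v = 1" using vector_choose_size[of 1] by auto
      have "c' \<in> K" "c' + s *\<^sub>R v \<in> K" using s v by (auto simp: subset_iff dist_norm)
      then show "s \<le> diameter K"
        using diameter_bounded_bound[OF K(1), of c' "c' + s *\<^sub>R v"] s v by (simp add: dist_norm)
    qed
  qed
  ultimately have "eccentricity K \<le> diameter K / r"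
    unfolding eccentricity_def using K diameter_ge_0[OF K(1)]
    by (intro frac_le) auto
  also have "\<dots> \<le> E" using K by (simp add: divide_le_eq)
  finally show ?thesis .
qed

section \<open>Existence of minimisers\<close>

definition support_function :: "'a::real_inner set \<Rightarrow> 'a \<Rightarrow> real" where
  "support_function A u = (SUP x\<in>A. u \<bullet> x)"

lemma inner_le_support_function:
  assumes "bounded A" "x \<in> A"
  shows "u \<bullet> x \<le> support_function A u"
proof -
  obtain R where R: "\<And>y. y \<in> A \<Longrightarrow> norm y \<le> R" using assms(1) by (auto simp: bounded_iff)
  have "u \<bullet> y \<le> norm u * R" if "y \<in> A" for y
    using norm_cauchy_schwarz[of u y] R[OF that] by (meson mult_left_mono norm_ge_zero order_trans)
  then have "bdd_above ((\<bullet>) u ` A)" by (auto intro!: bdd_aboveI[of _ "norm u * R"])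
  then show ?thesis unfolding support_function_def using assms(2) by (rule cSUP_upper[rotated])
qed

lemma support_function_le:
  assumes "A \<noteq> {}" "\<And>x. x \<in> A \<Longrightarrow> u \<bullet> x \<le> b"
  shows "support_function A u \<le> b"
  unfolding support_function_def using assms by (rule cSUP_least)

text \<open>
  A point outside a closed convex set is separated from it by a hyperplane, and the normal of the
  hyperplane is a direction in which the support function is too small.
\<close>

lemma mem_if_inner_le_support_function:
  fixes A :: "'a::euclidean_space set"
  assumes "closed A" "convex A" "bounded A" "A \<noteq> {}"
    and x: "\<And>u. norm u = 1 \<Longrightarrow> u \<bullet> x \<le> support_function A u"
  shows "x \<in> A"
proof (rule ccontr)
  assume "x \<notin> A"
  then obtain a b where a: "a \<bullet> x < b" "\<And>y. y \<in> A \<Longrightarrow> b < a \<bullet> y"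
    using separating_hyperplane_closed_point[OF assms(2,1)] by metis
  have "a \<noteq> 0" using a assms(4) by fastforce
  define u where "u = - sgn a"
  have u: "norm u = 1" using \<open>a \<noteq> 0\<close> by (simp add: u_def norm_sgn)
  have ua: "norm a * (u \<bullet> y) = - (a \<bullet> y)" for y
    using \<open>a \<noteq> 0\<close> by (simp add: u_def sgn_div_norm)
  have "support_function A u \<le> - b / norm a"
  proof (rule support_function_le[OF assms(4)])
    fix y assume "y \<in> A"
    then have "norm a * (u \<bullet> y) \<le> - b" using a(2) ua[of y] by fastforce
    then show "u \<bullet> y \<le> - b / norm a"
      by (subst pos_le_divide_eq) (use \<open>a \<noteq> 0\<close> in \<open>simp_all add: mult.commute\<close>)
  qed
  also have "\<dots> < u \<bullet> x"
    by (subst pos_divide_less_eq) (use a(1) ua[of x] \<open>a \<noteq> 0\<close> in \<open>simp_all add: mult.commute\<close>)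
  finally show False using x[OF u] by simp
qed

text \<open>
  Blaschke's selection theorem in the form needed here. On the unit sphere the support functions are bounded and
  have the common Lipschitz constant \<open>R\<close>, so by Arzela-Ascoli a subsequence converges uniformly. The
  limit function is at least \<open>1\<close>, hence uniform closeness amounts to a factor close to \<open>1\<close>, and
  this factor passes from the functions to the sets which they cut out.
\<close>

lemma convex_sets_subsequence:
  fixes K :: "nat \<Rightarrow> 'a::euclidean_space set"
  assumes K: "\<And>n. closed (K n)" "\<And>n. convex (K n)"
    and bounds: "\<And>n. cball 0 1 \<subseteq> K n" "\<And>n. K n \<subseteq> cball 0 R"
  obtains L and s :: "nat \<Rightarrow> nat" where "compact L" "convex L" "cball 0 1 \<subseteq> L" "L \<subseteq> cball 0 R" "strict_mono s"
    "\<And>\<epsilon>. 0 < \<epsilon> \<Longrightarrow> \<exists>N. \<forall>n\<ge>N. L \<subseteq> (\<lambda>x. (1 + \<epsilon>) *\<^sub>R x) ` K (s n) \<and> K (s n) \<subseteq> (\<lambda>x. (1 + \<epsilon>) *\<^sub>R x) ` L"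
proof -
  define h where "h n = support_function (K n)" for n
  have bdd: "bounded (K n)" for n using bounds(2) bounded_cball bounded_subset by blast
  have ne: "K n \<noteq> {}" for n using bounds(1)[of n] by force
  have inner_le: "u \<bullet> x \<le> h n u" if "x \<in> K n" for n u x
    unfolding h_def using inner_le_support_function[OF bdd that] .
  have h_ge: "1 \<le> h n u" if "norm u = 1" for n u
  proof -
    have "u \<in> K n" using bounds(1)[of n] that by (auto simp: subset_iff)
    from inner_le[OF this, of u] show ?thesis using that by (simp add: norm_eq_1)
  qed
  have KR: "norm x \<le> R" if "x \<in> K n" for x n using bounds(2)[of n] that by auto
  have h_le: "h n u \<le> R" if "norm u = 1" for n u
    unfolding h_def
  proof (rule support_function_le[OF ne])
    fix x assume "x \<in> K n"
    then show "u \<bullet> x \<le> R" using norm_cauchy_schwarz[of u x] KR that by fastforce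
  qed
  have h_lip: "h n u - h n v \<le> R * norm (u - v)" for n u v
  proof -
    have "h n u \<le> h n v + R * norm (u - v)"
      unfolding h_def[of n]
    proof (rule support_function_le[OF ne])
      fix x assume x: "x \<in> K n"
      have "u \<bullet> x = v \<bullet> x + (u - v) \<bullet> x" by (simp add: inner_diff_left)
      also have "\<dots> \<le> h n v + norm (u - v) * R"
        using inner_le[OF x, of v] norm_cauchy_schwarz[of "u - v" x] KR[OF x]
        by (meson add_mono mult_left_mono norm_ge_zero order_trans)
      finally show "u \<bullet> x \<le> support_function (K n) v + R * norm (u - v)" by (simp add: h_def mult.commute)
    qed
    then show ?thesis by simp
  qed
  have R1: "1 \<le> R"
  proof -
    obtain v :: 'a where v: "norm v = 1" using vector_choose_size[of 1] by auto
    show ?thesis using h_ge[OF v, of 0] h_le[OF v, of 0] by linarith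
  qed
  obtain g s where g: "continuous_on (sphere 0 1) g" "strict_mono (s :: nat \<Rightarrow> nat)"
    "\<And>e. 0 < e \<Longrightarrow> \<exists>N. \<forall>n u. n \<ge> N \<and> u \<in> sphere 0 1 \<longrightarrow> norm (h (s n) u - g u) < e"
  proof (rule Arzela_Ascoli[of "sphere (0::'a) 1" h R])
    show "norm (h n u) \<le> R" if "u \<in> sphere 0 1" for n u
      using h_ge[of u n] h_le[of u n] that by simp
    show "\<exists>d. 0 < d \<and> (\<forall>n v. v \<in> sphere 0 1 \<and> norm (u - v) < d \<longrightarrow> norm (h n u - h n v) < e)"
      if "0 < e" for u e
    proof (intro exI[of _ "e / R"] conjI allI impI)
      fix n v assume "v \<in> sphere 0 1 \<and> norm (u - v) < e / R"
      then have "R * norm (u - v) < e" using R1 by (simp add: pos_less_divide_eq mult.commute)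
      then show "norm (h n u - h n v) < e"
        using h_lip[of n u v] h_lip[of n v u] by (simp add: norm_minus_commute abs_less_iff)
    qed (use that R1 in simp)
  qed auto
  define L where "L = {x. \<forall>u\<in>sphere 0 1. u \<bullet> x \<le> g u}"
  have g_ge: "1 \<le> g u" and g_le: "g u \<le> R" if u: "u \<in> sphere 0 1" for u
  proof -
    have close: "\<exists>n. norm (h (s n) u - g u) < e" if "0 < e" for e
      using g(3)[OF that] u by blast
    show "1 \<le> g u"
    proof (rule field_le_epsilon)
      fix e :: real assume "0 < e"
      then obtain n where "norm (h (s n) u - g u) < e" using close by blast
      then show "1 \<le> g u + e" using h_ge[of u "s n"] u by auto
    qed
    show "g u \<le> R"
    proof (rule field_le_epsilon)
      fix e :: real assume "0 < e"
      then obtain n where "norm (h (s n) u - g u) < e" using close by blast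
      then show "g u \<le> R + e" using h_le[of u "s n"] u by auto
    qed
  qed
  show thesis
  proof (rule that[OF _ _ _ _ g(2)])
    have L_eq: "L = (\<Inter>u\<in>sphere 0 1. {x. u \<bullet> x \<le> g u})" by (auto simp: L_def)
    show "convex L" unfolding L_eq by (intro convex_INT convex_halfspace_le)
    have "closed L" unfolding L_eq by (intro closed_INT ballI closed_halfspace_le)
    show LR: "L \<subseteq> cball 0 R"
    proof
      fix x assume x: "x \<in> L"
      show "x \<in> cball 0 R"
      proof (cases "x = 0")
        case False
        then have sph: "sgn x \<in> sphere 0 1" by (simp add: norm_sgn)
        then have "sgn x \<bullet> x \<le> g (sgn x)" using x unfolding L_def by blast
        then have "sgn x \<bullet> x \<le> R" using g_le[OF sph] by linarith
        moreover have "sgn x \<bullet> x = norm x"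
          using False by (simp add: sgn_div_norm power2_norm_eq_inner[symmetric] power2_eq_square)
        ultimately show ?thesis by simp
      qed (use R1 in simp)
    qed
    then show "compact L" using \<open>closed L\<close> bounded_cball bounded_subset compact_eq_bounded_closed by blast
    show "cball 0 1 \<subseteq> L"
    proof
      fix x :: 'a assume x: "x \<in> cball 0 1"
      have "u \<bullet> x \<le> g u" if "u \<in> sphere 0 1" for u
        using norm_cauchy_schwarz[of u x] x that g_ge[OF that] by auto
      then show "x \<in> L" by (simp add: L_def)
    qed
    fix \<epsilon> :: real assume \<epsilon>: "0 < \<epsilon>"
    then obtain N where N: "\<And>n u. n \<ge> N \<Longrightarrow> u \<in> sphere 0 1 \<Longrightarrow> norm (h (s n) u - g u) < \<epsilon>"
      using g(3) by meson
    have scale: "x \<in> (\<lambda>x. (1 + \<epsilon>) *\<^sub>R x) ` A" if "(1 / (1 + \<epsilon>)) *\<^sub>R x \<in> A" for A and x :: 'a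
      using that \<epsilon> by (intro image_eqI[of _ _ "(1 / (1 + \<epsilon>)) *\<^sub>R x"]) auto
    have shrink: "u \<bullet> ((1 / (1 + \<epsilon>)) *\<^sub>R x) \<le> b" if "u \<bullet> x \<le> a" "a \<le> b + \<epsilon>" "1 \<le> b" for u x :: 'a and a b
    proof -
      have "u \<bullet> x \<le> b + \<epsilon> * 1" using that by simp
      also have "\<dots> \<le> b + \<epsilon> * b" using \<epsilon> that by (intro add_left_mono mult_left_mono) auto
      finally show ?thesis using \<epsilon> by (simp add: field_simps)
    qed
    show "\<exists>N. \<forall>n\<ge>N. L \<subseteq> (\<lambda>x. (1 + \<epsilon>) *\<^sub>R x) ` K (s n) \<and> K (s n) \<subseteq> (\<lambda>x. (1 + \<epsilon>) *\<^sub>R x) ` L"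
    proof (intro exI[of _ N] allI impI conjI subsetI scale)
      fix n x assume n: "N \<le> n" and x: "x \<in> L"
      show "(1 / (1 + \<epsilon>)) *\<^sub>R x \<in> K (s n)"
      proof (rule mem_if_inner_le_support_function[OF K bdd ne])
        fix u :: 'a assume u: "norm u = 1"
        then show "u \<bullet> (1 / (1 + \<epsilon>)) *\<^sub>R x \<le> support_function (K (s n)) u"
          using x N[OF n, of u] h_ge[OF u, of "s n"]
          by (intro shrink[of _ _ "g u"]) (auto simp: L_def h_def)
      qed
    next
      fix n x assume n: "N \<le> n" and x: "x \<in> K (s n)"
      have "u \<bullet> (1 / (1 + \<epsilon>)) *\<^sub>R x \<le> g u" if u: "u \<in> sphere 0 1" for u
        using inner_le[OF x, of u] N[OF n u] g_ge[OF u]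
        by (intro shrink[of _ _ "h (s n) u"]) auto
      then show "(1 / (1 + \<epsilon>)) *\<^sub>R x \<in> L" by (simp add: L_def)
    qed
  qed
qed

text \<open>
  Lower semicontinuity of the distortion: the points \<open>p\<close> and \<open>q\<close> are the projections of nearby
  points of the surface of \<open>B\<close>, and projecting does not increase intrinsic distances.
\<close>

lemma intrinsic_dist_le_outer_distortion:
  fixes L B :: "'a::euclidean_space set"
  assumes L: "compact L" "convex L" "interior L \<noteq> {}" "L \<subseteq> cball 0 R"
    and B: "compact B" "L \<subseteq> B" "B \<subseteq> (\<lambda>x. \<kappa> *\<^sub>R x) ` L" "1 \<le> \<kappa>"
    and pq: "p \<in> frontier L" "q \<in> frontier L"
  shows "intrinsic_dist (frontier L) p q
       \<le> distortion (frontier B) * ennreal (dist p q + 2 * ((\<kappa> - 1) * R))"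
proof -
  have cl: "closed L" using L by (simp add: compact_imp_closed)
  obtain x where x: "x \<in> frontier B" "closest_point L x = p" "dist x p \<le> (\<kappa> - 1) * norm p"
    using ray_from_frontier_normal[OF cl L(2,3) B pq(1)] .
  obtain y where y: "y \<in> frontier B" "closest_point L y = q" "dist y q \<le> (\<kappa> - 1) * norm q"
    using ray_from_frontier_normal[OF cl L(2,3) B pq(2)] .
  have norm: "(\<kappa> - 1) * norm v \<le> (\<kappa> - 1) * R" if "v \<in> frontier L" for v
    using that frontier_subset_closed[OF cl] L(4) B(4) by (intro mult_left_mono) auto
  have "dist x y \<le> dist x p + dist p q + dist y q"
    using dist_triangle[of x y p] dist_triangle[of p y q] by (simp add: dist_commute)
  then have xy: "dist x y \<le> dist p q + 2 * ((\<kappa> - 1) * R)"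
    using x(3) y(3) norm[OF pq(1)] norm[OF pq(2)] by linarith
  have "frontier B \<subseteq> - interior L"
    using interior_mono[OF B(2)] by (auto simp: frontier_def)
  have "intrinsic_dist (frontier L) p q \<le> intrinsic_dist (- interior L) x y"
    using intrinsic_dist_closest_point_le[OF cl L(2), of x y] L(3) interior_subset[of L]
    unfolding x(2) y(2) by blast
  also have "\<dots> \<le> intrinsic_dist (frontier B) x y"
    by (rule intrinsic_dist_mono) fact
  also have "\<dots> \<le> distortion (frontier B) * ennreal (dist x y)"
    by (rule intrinsic_dist_le_distortion) fact+
  also have "\<dots> \<le> distortion (frontier B) * ennreal (dist p q + 2 * ((\<kappa> - 1) * R))"
    using xy by (intro mult_left_mono ennreal_leI) auto
  finally show ?thesis .
qed

theorem theorem2: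
  shows "(\<exists>K :: (real ^ 3) set. minimises_distortion K) \<and>
         (\<exists>E :: real. \<forall>K :: (real ^ 3) set. minimises_distortion K \<longrightarrow> eccentricity K \<le> E)"
proof -
  obtain K0 :: "(real ^ 3) set" and q0 where K0: "convex_body K0" "0 < q0" "q0 < pi / 2"
    "distortion (frontier K0) \<le> ennreal q0"
    using convex_body_distortion_less_half_pi by metis
  define q where "q = (q0 + pi / 2) / 2"
  have q: "q0 < q" "0 < q" "q < pi / 2" using K0 by (auto simp: q_def)
  obtain E where E: "\<And>K :: (real ^ 3) set. convex_body K \<Longrightarrow> distortion (frontier K) \<le> ennreal q \<Longrightarrow>
     \<exists>c r. 0 < r \<and> cball c r \<subseteq> K \<and> diameter K \<le> E * r"
    using inradius_diameter_bound[OF q(2,3)] by metis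
  have ecc: "eccentricity K \<le> E" if "minimises_distortion K" for K :: "(real ^ 3) set"
  proof -
    have K: "convex_body K" using that by (simp add: minimises_distortion_def)
    have "distortion (frontier K) \<le> distortion (frontier K0)"
      using that K0(1) by (simp add: minimises_distortion_def)
    also have "\<dots> \<le> ennreal q"
      using K0(4) q(1) ennreal_leI[of q0 q] by (meson less_imp_le order_trans)
    finally obtain c r where "0 < r" "cball c r \<subseteq> K" "diameter K \<le> E * r" using E[OF K] by blast
    then show ?thesis
      using K by (intro eccentricity_le) (auto simp: convex_body_def compact_imp_bounded)
  qed
  define I where "I = (INF K\<in>Collect (convex_body :: (real ^ 3) set \<Rightarrow> bool). distortion (frontier K))"
  have I_le: "I \<le> distortion (frontier K)" if "convex_body K" for K :: "(real ^ 3) set"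
    unfolding I_def using that by (intro INF_lower) simp
  have "I \<le> ennreal q0" using I_le[OF K0(1)] K0(4) by order
  then obtain i where i: "0 \<le> i" "I = ennreal i"
    by (metis ennreal_cases ennreal_neq_top top.extremum_uniqueI)
  have "i \<le> q0" using \<open>I \<le> ennreal q0\<close> K0(2) by (simp add: i)
  have "\<exists>K :: (real ^ 3) set. convex_body K \<and> distortion (frontier K) < ennreal (min (i + 1 / real (Suc n)) q)" for n
  proof -
    have "i < min (i + 1 / real (Suc n)) q" using \<open>i \<le> q0\<close> q(1) by simp
    then have "I < ennreal (min (i + 1 / real (Suc n)) q)"
      unfolding i(2) using i(1) q(2) by (intro ennreal_lessI) (auto intro: add_nonneg_pos)
    then show ?thesis unfolding I_def INF_less_iff by auto
  qed
  then obtain K :: "nat \<Rightarrow> (real ^ 3) set" where K: "\<And>n. convex_body (K n)"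
    "\<And>n. distortion (frontier (K n)) < ennreal (min (i + 1 / real (Suc n)) q)" by metis
  have "\<exists>c r. 0 < r \<and> cball c r \<subseteq> K n \<and> diameter (K n) \<le> E * r" for n
  proof (rule E[OF K(1)])
    have "ennreal (min (i + 1 / real (Suc n)) q) \<le> ennreal q" by (rule ennreal_leI) simp
    then show "distortion (frontier (K n)) \<le> ennreal q" using K(2)[of n] by order
  qed
  then obtain c r where cr: "\<And>n. 0 < r n" "\<And>n. cball (c n) (r n) \<subseteq> K n"
    "\<And>n. diameter (K n) \<le> E * r n" by metis
  define M where "M n = (\<lambda>x. - (c n /\<^sub>R r n) + (1 / r n) *\<^sub>R x) ` K n" for n
  have M_eq: "- (c n /\<^sub>R r n) + (1 / r n) *\<^sub>R x = (1 / r n) *\<^sub>R (x - c n)" for n x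
    by (simp add: scaleR_diff_right divide_inverse)
  have M_body: "convex_body (M n)" for n
    unfolding M_def using cr(1)[of n] by (intro convex_body_similarity K) auto
  have M_dist: "distortion (frontier (M n)) = distortion (frontier (K n))" for n
    unfolding M_def using cr(1)[of n] by (intro distortion_frontier_similarity) auto
  have M1: "cball 0 1 \<subseteq> M n" for n
  proof
    fix x :: "real ^ 3" assume "x \<in> cball 0 1"
    then have "c n + r n *\<^sub>R x \<in> K n" using cr(1,2)[of n] by (auto simp: subset_iff dist_norm)
    moreover have "x = (1 / r n) *\<^sub>R (c n + r n *\<^sub>R x - c n)" using cr(1)[of n] by simp
    ultimately show "x \<in> M n" unfolding M_def M_eq by blast
  qed
  have M2: "M n \<subseteq> cball 0 E" for n
  proof
    fix x assume "x \<in> M n"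
    then obtain y where y: "y \<in> K n" "x = (1 / r n) *\<^sub>R (y - c n)" unfolding M_def M_eq by blast
    have "c n \<in> K n" using cr(1,2)[of n] by (auto simp: subset_iff less_imp_le)
    then have "dist y (c n) \<le> E * r n"
      using diameter_bounded_bound[OF _ y(1), of "c n"] cr(3)[of n] K(1)[of n]
      by (fastforce simp: convex_body_def compact_imp_bounded)
    then show "x \<in> cball 0 E" using cr(1)[of n] by (simp add: y(2) dist_norm pos_divide_le_eq)
  qed
  obtain L and s :: "nat \<Rightarrow> nat" where L: "compact L" "convex L" "cball 0 1 \<subseteq> L" "L \<subseteq> cball 0 E" "strict_mono s"
    "\<And>\<epsilon>. 0 < \<epsilon> \<Longrightarrow> \<exists>N. \<forall>n\<ge>N. L \<subseteq> (\<lambda>x. (1 + \<epsilon>) *\<^sub>R x) ` M (s n) \<and> M (s n) \<subseteq> (\<lambda>x. (1 + \<epsilon>) *\<^sub>R x) ` L"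
    by (rule convex_sets_subsequence[of M E])
       (use M_body M1 M2 in \<open>auto simp: convex_body_def compact_imp_closed\<close>)
  have "ball 0 1 \<subseteq> interior L" using L(3) by (intro interior_maximal) auto
  then have L_int: "interior L \<noteq> {}" by force
  then have L_body: "convex_body L" using L by (simp add: convex_body_def)
  have "distortion (frontier L) \<le> I"
  proof (rule distortion_le)
    fix x y assume xy: "x \<in> frontier L" "y \<in> frontier L"
    \<comment> \<open>Bounds from the bodies of the sequence, enlarged by \<open>1 + \<epsilon>\<close> in order to contain the limit.\<close>
    define F where "F \<epsilon> = (i + \<epsilon>) * (dist x y + 2 * (((1 + \<epsilon>) * (1 + \<epsilon>) - 1) * E))" for \<epsilon> :: real
    have bound: "intrinsic_dist (frontier L) x y \<le> ennreal (F \<epsilon>)" if \<epsilon>: "0 < \<epsilon>" for \<epsilon>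
    proof -
      obtain N where N: "\<And>n. n \<ge> N \<Longrightarrow> L \<subseteq> (\<lambda>x. (1 + \<epsilon>) *\<^sub>R x) ` M (s n) \<and> M (s n) \<subseteq> (\<lambda>x. (1 + \<epsilon>) *\<^sub>R x) ` L"
        using L(6)[OF \<epsilon>] by blast
      obtain N' :: nat where N': "1 / \<epsilon> < N'" using reals_Archimedean2 by blast
      define n where "n = max N N'"
      have "N' \<le> s n" using seq_suble[OF L(5), of n] by (simp add: n_def)
      then have "1 / \<epsilon> < real (Suc (s n))" using N' by linarith
      then have small: "1 / real (Suc (s n)) \<le> \<epsilon>" using \<epsilon> by (simp add: field_simps)
      define B where "B = (\<lambda>x. 0 + (1 + \<epsilon>) *\<^sub>R x) ` M (s n)"
      have B: "compact B" "L \<subseteq> B" "B \<subseteq> (\<lambda>x. ((1 + \<epsilon>) * (1 + \<epsilon>)) *\<^sub>R x) ` L"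
      proof -
        have "convex_body B" unfolding B_def using \<epsilon> by (intro convex_body_similarity M_body) auto
        then show "compact B" by (simp add: convex_body_def)
        show "L \<subseteq> B" using N[of n] by (simp add: B_def n_def)
        show "B \<subseteq> (\<lambda>x. ((1 + \<epsilon>) * (1 + \<epsilon>)) *\<^sub>R x) ` L"
          using N[of n] by (force simp: B_def n_def)
      qed
      have \<kappa>: "1 \<le> (1 + \<epsilon>) * (1 + \<epsilon>)" using \<epsilon> by (simp add: algebra_simps)
      have "distortion (frontier B) = distortion (frontier (K (s n)))"
        unfolding B_def using \<epsilon> by (subst distortion_frontier_similarity) (auto simp: M_dist)
      also have "\<dots> \<le> ennreal (min (i + 1 / real (Suc (s n))) q)" using K(2) by (rule less_imp_le)
      also have "\<dots> \<le> ennreal (i + \<epsilon>)" using small by (intro ennreal_leI) simp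
      finally have dB: "distortion (frontier B) \<le> ennreal (i + \<epsilon>)" .
      have "intrinsic_dist (frontier L) x y
          \<le> distortion (frontier B) * ennreal (dist x y + 2 * (((1 + \<epsilon>) * (1 + \<epsilon>) - 1) * E))"
        by (rule intrinsic_dist_le_outer_distortion[OF L(1,2) L_int L(4) B \<kappa> xy])
      also have "\<dots> \<le> ennreal (i + \<epsilon>) * ennreal (dist x y + 2 * (((1 + \<epsilon>) * (1 + \<epsilon>) - 1) * E))"
        using dB by (rule mult_right_mono) simp
      also have "\<dots> = ennreal (F \<epsilon>)"
        unfolding F_def using i \<epsilon> by (intro ennreal_mult'[symmetric]) auto
      finally show ?thesis .
    qed
    have "(F \<longlongrightarrow> F 0) (at_right 0)"
      unfolding F_def by (intro tendsto_intros)
    then have "((\<lambda>\<epsilon>. ennreal (F \<epsilon>)) \<longlongrightarrow> ennreal (F 0)) (at_right 0)" by (rule tendsto_ennrealI)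
    then have "intrinsic_dist (frontier L) x y \<le> ennreal (F 0)"
    proof (rule tendsto_lowerbound)
      show "\<forall>\<^sub>F \<epsilon> in at_right 0. intrinsic_dist (frontier L) x y \<le> ennreal (F \<epsilon>)"
        using eventually_at_right_less[of "0::real"] bound by (rule eventually_mono)
    qed simp
    also have "\<dots> = I * ennreal (dist x y)" using i by (simp add: F_def ennreal_mult)
    finally show "intrinsic_dist (frontier L) x y \<le> I * ennreal (dist x y)" .
  qed
  then have "minimises_distortion L"
    unfolding minimises_distortion_def using L_body I_le by (meson order_trans)
  then show ?thesis using ecc by blast
qed

end
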